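(* Let $\Gamma$ be a finite group. There is a Hopf algebra structure (over $\mathbb{Z}$) on the ring $\Lambda(\Gamma_* )$ with comultiplication $$\Delta(m_{\boldsymbol\lambda})=\sum_{\boldsymbol\mu,\boldsymbol\nu}m_{\boldsymbol\mu}\otimes m_{\boldsymbol\nu},$$ where the sum is over all pairs of multipartitions $\boldsymbol\mu,\boldsymbol\nu$ such that $m_i(\boldsymbol\mu(c))+m_i(\boldsymbol\nu(c))=m_i(\boldsymbol\lambda(c))$ for all $i\in\mathbb{Z}_{>0}$ and $c\in\Gamma_*$. The counit $\varepsilon$ obeys $\varepsilon(m_{\boldsymbol\mu})=0$ when $|\boldsymbol\mu|>0$ (and $\varepsilon(1)=1$).
   Context: $\Gamma_*$ is the set of conjugacy classes of $\Gamma$; a class is identified with its class sum, so $\mathbb{Z}\Gamma_*=Z(\mathbb{Z}\Gamma)$. A multipartition is a function $\boldsymbol\lambda$ from $\Gamma_*$ to the set of partitions, $|\boldsymbol\lambda|=\sum_c|\boldsymbol\lambda(c)|$, and $m_i(\lambda)$ is the number of parts of the partition $\lambda$ equal to $i$. Let $Q\subset\mathbb{Z}\Gamma_*[x]$ be the subring of polynomials whose constant term is an integer multiple of the identity. $S_n$ permutes the factors of $Q^{\otimes n}$ (over $\mathbb{Z}$). $\Lambda_n(\Gamma_* )=(Q^{\otimes n})^{S_n}$, graded by degree in $x$, with degree-$k$ part $\Lambda^k_n(\Gamma_* )$. For $m>n$, setting $x=0$ in the tensor factors after the $n$-th gives maps $\Lambda_m^k(\Gamma_* )\to\Lambda_n^k(\Gamma_*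 )$; put $\Lambda^k(\Gamma_* )=\varprojlim_n\Lambda_n^k(\Gamma_* )$ and $\Lambda(\Gamma_* )=\bigoplus_{k\ge0}\Lambda^k(\Gamma_* )$, a graded ring. $Q$ has $\mathbb{Z}$-basis $1$ and $cx^j$ ($c\in\Gamma_*$, $j\ge1$); the $\Gamma_*$-weighted monomial symmetric polynomial $m_{\boldsymbol\lambda}(x_1,\dots,x_n)\in Q^{\otimes n}$ is the sum of all pure tensors in this basis in which, for each $c$ and each $j\ge1$, $cx^j$ appears exactly $m_j(\boldsymbol\lambda(c))$ times as a tensor factor (all other factors being $1$). These are compatible as $n$ varies and define $m_{\boldsymbol\lambda}\in\Lambda^{|\boldsymbol\lambda|}(\Gamma_* )$; the $m_{\boldsymbol\lambda}$ form a $\mathbb{Z}$-basis of $\Lambda(\Gamma_* )$. *)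

theory Defs
  imports
    "HOL-Algebra.UnivPoly"
    "HOL-Algebra.QuotRing"
    "HOL-Algebra.IntRing"
    "HOL-Algebra.Generated_Groups"
    "HOL-Library.Poly_Mapping"
    "HOL-Library.Multiset"
    "HOL-Combinatorics.Permutations"
begin

section \<open>Integral monoid rings\<close>

definition monoid_ring :: "('a, 'b) monoid_scheme \<Rightarrow> ('a \<Rightarrow>\<^sub>0 int) ring" where
  "monoid_ring M =
    \<lparr>carrier = {f. Poly_Mapping.keys f \<subseteq> carrier M},
     monoid.mult = (\<lambda>f g. frag_extend (\<lambda>s. frag_extend (\<lambda>t. frag_of (s \<otimes>\<^bsub>M\<^esub> t)) g) f),
     one = frag_of \<one>\<^bsub>M\<^esub>,
     zero = 0,
     add = (+)\<rparr>"


section \<open>Tensor powers of a ring over the integers\<close>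

definition tuple_monoid :: "('a, 'b) ring_scheme \<Rightarrow> nat \<Rightarrow> 'a list monoid" where
  "tuple_monoid R n =
    \<lparr>carrier = {xs. length xs = n \<and> set xs \<subseteq> carrier R},
     monoid.mult = map2 (\<lambda>x y. x \<otimes>\<^bsub>R\<^esub> y),
     one = replicate n \<one>\<^bsub>R\<^esub>\<rparr>"

definition multilinear_relations ::
    "('a, 'b) ring_scheme \<Rightarrow> nat \<Rightarrow> ('a list \<Rightarrow>\<^sub>0 int) set" where
  "multilinear_relations R n =
    {frag_of (us @ [a \<oplus>\<^bsub>R\<^esub> b] @ vs) - frag_of (us @ [a] @ vs) - frag_of (us @ [b] @ vs) | us a b vs.
       us @ [a] @ vs \<in> carrier (tuple_monoid R n) \<and> b \<in> carrier R}"

text \<open>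
  The free abelian group on the \<open>n\<close>-tuples carries the ring structure in which tuples are
  multiplied componentwise.  The additive subgroup generated by the relations is already an
  ideal, so dividing by it gives the tensor power of abelian groups together with its usual
  ring structure.
\<close>

definition tensor_relations ::
    "('a, 'b) ring_scheme \<Rightarrow> nat \<Rightarrow> ('a list \<Rightarrow>\<^sub>0 int) set" where
  "tensor_relations R n =
    generate (add_monoid (monoid_ring (tuple_monoid R n))) (multilinear_relations R n)"

definition tensor_power :: "('a, 'b) ring_scheme \<Rightarrow> nat \<Rightarrow> ('a list \<Rightarrow>\<^sub>0 int) set ring" where
  "tensor_power R n = monoid_ring (tuple_monoid R n) Quot tensor_relations R n"

definition pure_tensor :: "('a, 'b) ring_scheme \<Rightarrow> 'a list \<Rightarrow> ('a list \<Rightarrow>\<^sub>0 int) set" where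
  "pure_tensor R xs =
    tensor_relations R (length xs) +>\<^bsub>monoid_ring (tuple_monoid R (length xs))\<^esub> frag_of xs"

text \<open>
  \<open>tensor_lift C \<phi>\<close> is the additive map with \<open>pure_tensor R xs \<mapsto> \<phi> xs\<close>.  It is meaningful
  only for multilinear \<open>\<phi>\<close> with values in \<open>C\<close>: then all representatives of a class give the
  same value, and \<^const>\<open>the_elem\<close> picks it.
\<close>

definition tensor_lift ::
    "('c, 'd) ring_scheme \<Rightarrow> ('a list \<Rightarrow> 'c) \<Rightarrow> ('a list \<Rightarrow>\<^sub>0 int) set \<Rightarrow> 'c" where
  "tensor_lift C \<phi> X =
    the_elem ((\<lambda>r. \<Oplus>\<^bsub>C\<^esub>xs \<in> Poly_Mapping.keys r. [Poly_Mapping.lookup r xs] \<cdot>\<^bsub>C\<^esub> \<phi> xs) ` X)"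


section \<open>Hopf algebras over the integers\<close>

text \<open>
  Both \<open>(A \<otimes> A) \<otimes> A\<close> and \<open>A \<otimes> (A \<otimes> A)\<close> are identified with \<^term>\<open>tensor_power A 3\<close>, and
  \<open>\<Z> \<otimes> A\<close> and \<open>A \<otimes> \<Z>\<close> with \<open>A\<close>.  So \<open>\<Delta> \<otimes> id\<close> sends \<open>a \<otimes> b\<close> to the image of \<open>\<Delta> a\<close> under
  \<open>y \<otimes> z \<mapsto> y \<otimes> z \<otimes> b\<close>, and \<open>\<epsilon> \<otimes> id\<close> sends \<open>a \<otimes> b\<close> to \<open>\<epsilon> a \<cdot> b\<close>.
\<close>

locale hopf_algebra = ring A for A (structure) +
  fixes \<Delta> :: "'a \<Rightarrow> ('a list \<Rightarrow>\<^sub>0 int) set"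
    and \<epsilon> :: "'a \<Rightarrow> int"
    and S :: "'a \<Rightarrow> 'a"
  assumes comult_hom: "\<Delta> \<in> ring_hom A (tensor_power A 2)"
    and counit_hom: "\<epsilon> \<in> ring_hom A \<Z>"
    and antipode_hom: "S \<in> hom (add_monoid A) (add_monoid A)"
    and coassoc: "a \<in> carrier A \<Longrightarrow>
      tensor_lift (tensor_power A 3)
        (\<lambda>xs. tensor_lift (tensor_power A 3) (\<lambda>ys. pure_tensor A (ys @ [xs ! 1])) (\<Delta> (xs ! 0))) (\<Delta> a) =
      tensor_lift (tensor_power A 3)
        (\<lambda>xs. tensor_lift (tensor_power A 3) (\<lambda>ys. pure_tensor A ([xs ! 0] @ ys)) (\<Delta> (xs ! 1))) (\<Delta> a)"
    and counit_left: "a \<in> carrier A \<Longrightarrow> tensor_lift A (\<lambda>xs. [\<epsilon> (xs ! 0)] \<cdot> (xs ! 1)) (\<Delta> a) = a"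
    and counit_right: "a \<in> carrier A \<Longrightarrow> tensor_lift A (\<lambda>xs. [\<epsilon> (xs ! 1)] \<cdot> (xs ! 0)) (\<Delta> a) = a"
    and antipode_left: "a \<in> carrier A \<Longrightarrow>
      tensor_lift A (\<lambda>xs. S (xs ! 0) \<otimes> (xs ! 1)) (\<Delta> a) = [\<epsilon> a] \<cdot> \<one>"
    and antipode_right: "a \<in> carrier A \<Longrightarrow>
      tensor_lift A (\<lambda>xs. (xs ! 0) \<otimes> S (xs ! 1)) (\<Delta> a) = [\<epsilon> a] \<cdot> \<one>"


section \<open>The ring \<open>Q\<close> of a finite group\<close>

definition conj_classes :: "('g, 'b) monoid_scheme \<Rightarrow> 'g set set" where
  "conj_classes G =
    (\<lambda>h. (\<lambda>g. g \<otimes>\<^bsub>G\<^esub> h \<otimes>\<^bsub>G\<^esub> inv\<^bsub>G\<^esub> g) ` carrier G) ` carrier G"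

definition class_sum :: "'g set \<Rightarrow> 'g \<Rightarrow>\<^sub>0 int" where
  "class_sum c = (\<Sum>g\<in>c. frag_of g)"

definition class_ring :: "('g, 'b) monoid_scheme \<Rightarrow> ('g \<Rightarrow>\<^sub>0 int) ring" where
  "class_ring G = (monoid_ring G)
    \<lparr>carrier := {z \<in> carrier (monoid_ring G). \<forall>y\<in>carrier (monoid_ring G).
                  z \<otimes>\<^bsub>monoid_ring G\<^esub> y = y \<otimes>\<^bsub>monoid_ring G\<^esub> z}\<rparr>"

type_synonym 'g class_poly = "nat \<Rightarrow> 'g \<Rightarrow>\<^sub>0 int"

definition Q_ring :: "('g, 'b) monoid_scheme \<Rightarrow> ('g \<Rightarrow>\<^sub>0 int, 'g class_poly) up_ring" where
  "Q_ring G = (UP (class_ring G))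
    \<lparr>carrier := {q \<in> carrier (UP (class_ring G)).
       \<exists>k::int. up_ring.coeff (UP (class_ring G)) q 0 = [k] \<cdot>\<^bsub>class_ring G\<^esub> \<one>\<^bsub>class_ring G\<^esub>}\<rparr>"

text \<open>The value of an element of \<open>Q\<close> at \<open>x = 0\<close>, as an integer.\<close>

definition Q_eval0 :: "('g, 'b) monoid_scheme \<Rightarrow> 'g class_poly \<Rightarrow> int" where
  "Q_eval0 G q =
    (THE k. up_ring.coeff (UP (class_ring G)) q 0 = [k] \<cdot>\<^bsub>class_ring G\<^esub> \<one>\<^bsub>class_ring G\<^esub>)"


section \<open>Symmetric tensors and their limit\<close>

type_synonym 'g Q_tensor = "('g class_poly list \<Rightarrow>\<^sub>0 int) set"

definition Q_tensor_deg :: "('g, 'b) monoid_scheme \<Rightarrow> nat \<Rightarrow> nat \<Rightarrow> 'g Q_tensor set" where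
  "Q_tensor_deg G n k =
    generate (add_monoid (tensor_power (Q_ring G) n))
      {pure_tensor (Q_ring G) qs | qs js.
         qs \<in> carrier (tuple_monoid (Q_ring G) n) \<and> sum_list js = k \<and>
         list_all2 (\<lambda>q j. \<exists>a\<in>carrier (class_ring G). q = up_ring.monom (UP (class_ring G)) a j) qs js}"

definition permute_tensor ::
    "('g, 'b) monoid_scheme \<Rightarrow> nat \<Rightarrow> (nat \<Rightarrow> nat) \<Rightarrow> 'g Q_tensor \<Rightarrow> 'g Q_tensor" where
  "permute_tensor G n \<sigma> =
    tensor_lift (tensor_power (Q_ring G) n) (\<lambda>qs. pure_tensor (Q_ring G) (permute_list \<sigma> qs))"

definition Lambda_fin :: "('g, 'b) monoid_scheme \<Rightarrow> nat \<Rightarrow> 'g Q_tensor set" where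
  "Lambda_fin G n =
    {t \<in> carrier (tensor_power (Q_ring G) n). \<forall>\<sigma>. \<sigma> permutes {..<n} \<longrightarrow> permute_tensor G n \<sigma> t = t}"

definition Lambda_fin_deg :: "('g, 'b) monoid_scheme \<Rightarrow> nat \<Rightarrow> nat \<Rightarrow> 'g Q_tensor set" where
  "Lambda_fin_deg G n k = Lambda_fin G n \<inter> Q_tensor_deg G n k"

text \<open>
  Setting \<open>x = 0\<close> in the factors after the \<open>n\<close>-th turns those factors into integers, which
  then act as scalars.
\<close>

definition truncate_tensor ::
    "('g, 'b) monoid_scheme \<Rightarrow> nat \<Rightarrow> 'g Q_tensor \<Rightarrow> 'g Q_tensor" where
  "truncate_tensor G n =
    tensor_lift (tensor_power (Q_ring G) n)
      (\<lambda>qs. [prod_list (map (Q_eval0 G) (drop n qs))] \<cdot>\<^bsub>tensor_power (Q_ring G) n\<^esub>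
              pure_tensor (Q_ring G) (take n qs))"

definition Lambda_deg :: "('g, 'b) monoid_scheme \<Rightarrow> nat \<Rightarrow> (nat \<Rightarrow> 'g Q_tensor) set" where
  "Lambda_deg G k =
    {f. (\<forall>n. f n \<in> Lambda_fin_deg G n k) \<and> (\<forall>m n. n < m \<longrightarrow> truncate_tensor G n (f m) = f n)}"

text \<open>
  An element \<open>f\<close> of the direct sum is the family of its homogeneous parts; \<open>f k n\<close> is the
  component in \<open>n\<close> variables of the part of degree \<open>k\<close>.
\<close>

definition Lambda ::
    "('g, 'b) monoid_scheme \<Rightarrow> (nat \<Rightarrow> nat \<Rightarrow> 'g Q_tensor) ring" where
  "Lambda G =
    \<lparr>carrier = {f. (\<forall>k. f k \<in> Lambda_deg G k) \<and>
                    finite {k. f k \<noteq> (\<lambda>n. \<zero>\<^bsub>tensor_power (Q_ring G) n\<^esub>)}},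
     monoid.mult = (\<lambda>f g k n. \<Oplus>\<^bsub>tensor_power (Q_ring G) n\<^esub>i\<in>{..k}.
                          f i n \<otimes>\<^bsub>tensor_power (Q_ring G) n\<^esub> g (k - i) n),
     one = (\<lambda>k n. if k = 0 then \<one>\<^bsub>tensor_power (Q_ring G) n\<^esub> else \<zero>\<^bsub>tensor_power (Q_ring G) n\<^esub>),
     zero = (\<lambda>k n. \<zero>\<^bsub>tensor_power (Q_ring G) n\<^esub>),
     add = (\<lambda>f g k n. f k n \<oplus>\<^bsub>tensor_power (Q_ring G) n\<^esub> g k n)\<rparr>"


section \<open>Multipartitions and weighted monomial symmetric functions\<close>

text \<open>
  A partition \<open>p\<close> is the multiset of its (positive) parts, so its number of parts equal to \<open>i\<close> is \<open>count p i\<close>.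
  Multipartitions take the value \<open>{#}\<close> away from the conjugacy classes, so that each is
  represented once.
\<close>

definition multipartitions :: "('g, 'b) monoid_scheme \<Rightarrow> ('g set \<Rightarrow> nat multiset) set" where
  "multipartitions G =
    {l. (\<forall>c\<in>conj_classes G. 0 \<notin># l c) \<and> (\<forall>c. c \<notin> conj_classes G \<longrightarrow> l c = {#})}"

definition mp_size :: "('g, 'b) monoid_scheme \<Rightarrow> ('g set \<Rightarrow> nat multiset) \<Rightarrow> nat" where
  "mp_size G l = (\<Sum>c\<in>conj_classes G. sum_mset (l c))"

definition class_monom :: "('g, 'b) monoid_scheme \<Rightarrow> 'g set \<Rightarrow> nat \<Rightarrow> 'g class_poly" where
  "class_monom G c j = up_ring.monom (UP (class_ring G)) (class_sum c) j"

definition Q_basis :: "('g, 'b) monoid_scheme \<Rightarrow> 'g class_poly set" where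
  "Q_basis G = insert \<one>\<^bsub>Q_ring G\<^esub> {class_monom G c j | c j. c \<in> conj_classes G \<and> j \<ge> 1}"

definition monomial_poly ::
    "('g, 'b) monoid_scheme \<Rightarrow> ('g set \<Rightarrow> nat multiset) \<Rightarrow> nat \<Rightarrow> 'g Q_tensor" where
  "monomial_poly G l n =
    (\<Oplus>\<^bsub>tensor_power (Q_ring G) n\<^esub>qs \<in>
       {qs. length qs = n \<and> set qs \<subseteq> Q_basis G \<and>
            (\<forall>c\<in>conj_classes G. \<forall>j\<ge>1. count_list qs (class_monom G c j) = count (l c) j)}.
       pure_tensor (Q_ring G) qs)"

definition monomial_sym ::
    "('g, 'b) monoid_scheme \<Rightarrow> ('g set \<Rightarrow> nat multiset) \<Rightarrow> nat \<Rightarrow> nat \<Rightarrow> 'g Q_tensor" where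
  "monomial_sym G l =
    (\<lambda>k n. if k = mp_size G l then monomial_poly G l n else \<zero>\<^bsub>tensor_power (Q_ring G) n\<^esub>)"

end

theory Submission
  imports Defs "HOL-Algebra.Subrings" "HOL-Library.Function_Algebras"
begin

text \<open>
  Call \<open>1\<close> and the elements \<open>c x\<^sup>j\<close> (\<open>c\<close> a conjugacy class, \<open>j \<ge> 1\<close>) letters.  They form a
  \<open>\<Z>\<close>-basis of \<open>Q\<close>, so the words of length \<open>n\<close> form a basis of the \<open>n\<close>-th tensor power of \<open>Q\<close>,
  and an element of \<open>\<Lambda>\<close> is given by an integer function \<open>F\<close> on all words.  That the element is
  symmetric means that \<open>F\<close> does not change when letters are permuted, and that it is compatible
  with setting variables to \<open>0\<close> means that \<open>F\<close> does not change when the letter \<open>1\<close> is appended.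
  Hence \<open>F w\<close> depends only on the weight of \<open>w\<close>, which is the multipartition that records the
  letters of \<open>w\<close> other than \<open>1\<close>.  Only finitely many weights occur with \<open>F w \<noteq> 0\<close>, and the
  values of \<open>F\<close> on the weights are the coordinates of the element in the basis of the \<open>m\<^sub>\<lambda>\<close>.

  In this description the comultiplication is \<open>(\<Delta> F) (u, v) = F (u v)\<close> with the concatenation of
  words.  The weight of a concatenation is the sum of the weights, so in coordinates
  \<open>\<Delta> F\<close> has the value of \<open>F\<close> at \<open>\<mu> + \<nu>\<close> in the place \<open>(\<mu>, \<nu>)\<close>; this is the formula for
  \<open>\<Delta> m\<^sub>\<lambda>\<close>.  Coassociativity and the counit laws become associativity of addition and the
  neutrality of the empty multipartition, where the counit is the coordinate at the empty
  multipartition.  The tensor powers of \<open>Q\<close> are multiplied letter by letter, so their structure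
  constants are multiplicative under concatenation of words, and this is exactly what makes
  \<open>\<Delta>\<close> a ring homomorphism (\<open>Lambda_coord_add_mult\<close>, \<open>comult_mult\<close>).

  The antipode is the inverse of the identity for convolution.  Convolution of additive maps is
  the product of power series with exponents in the monoid of multipartitions and with
  coefficients in \<open>\<Lambda>\<close>; the identity is the series whose coefficient at \<open>\<lambda>\<close> is \<open>m\<^sub>\<lambda>\<close>.  Its
  constant coefficient is \<open>1\<close> and every multipartition is a sum of two others in finitely many
  ways, so the series is invertible (\<open>conv_inverse\<close>).

  To compute with the tensor powers, which are quotients of free abelian groups, the proof uses
  coordinates throughout.  The locale \<open>ring_basis\<close> describes a ring with a basis and the dual
  functionals, \<open>tensor_power_basis\<close> transports this to the tensor powers, and equations between
  tensors are checked on coordinates.  The locale \<open>graded_monoid_basis\<close> derives the Hopf algebra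
  from the properties of the coordinates above, and the later sections establish these
  properties for \<open>\<Lambda>\<close>.
\<close>


section \<open>Additive maps\<close>

abbreviation add_hom :: "('a, 'b) ring_scheme \<Rightarrow> ('c, 'd) ring_scheme \<Rightarrow> ('a \<Rightarrow> 'c) set" where
  "add_hom A C \<equiv> hom (add_monoid A) (add_monoid C)"

lemma add_homI:
  assumes "\<And>x. x \<in> carrier A \<Longrightarrow> h x \<in> carrier C"
    and "\<And>x y. x \<in> carrier A \<Longrightarrow> y \<in> carrier A \<Longrightarrow> h (x \<oplus>\<^bsub>A\<^esub> y) = h x \<oplus>\<^bsub>C\<^esub> h y"
  shows "h \<in> add_hom A C"
  using assms by (auto simp: hom_def)

lemma add_hom_closed: "h \<in> add_hom A C \<Longrightarrow> x \<in> carrier A \<Longrightarrow> h x \<in> carrier C"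
  by (auto simp: hom_def)

lemma add_hom_add:
  "h \<in> add_hom A C \<Longrightarrow> x \<in> carrier A \<Longrightarrow> y \<in> carrier A \<Longrightarrow> h (x \<oplus>\<^bsub>A\<^esub> y) = h x \<oplus>\<^bsub>C\<^esub> h y"
  by (auto simp: hom_def)

lemma add_hom_compose: "g \<in> add_hom A B \<Longrightarrow> h \<in> add_hom B C \<Longrightarrow> (\<lambda>x. h (g x)) \<in> add_hom A C"
  by (auto simp: hom_def Pi_iff)

lemma ring_hom_add_hom: "h \<in> ring_hom A C \<Longrightarrow> h \<in> add_hom A C"
  by (auto simp: ring_hom_def hom_def)

context
  fixes A (structure) and C (structure) and h
  assumes A: "abelian_group A" and C: "abelian_group C" and h: "h \<in> add_hom A C"
begin

interpretation A: abelian_group A by (rule A)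
interpretation C: abelian_group C by (rule C)
interpretation h: group_hom "add_monoid A" "add_monoid C" h
  using h by (auto intro!: group_hom.intro group_hom_axioms.intro A.a_group C.a_group)

lemma add_hom_zero: "h \<zero>\<^bsub>A\<^esub> = \<zero>\<^bsub>C\<^esub>"
  using h.hom_one by simp

lemma add_hom_minus: "x \<in> carrier A \<Longrightarrow> h (\<ominus>\<^bsub>A\<^esub> x) = \<ominus>\<^bsub>C\<^esub> h x"
  using h.hom_inv[of x] by (simp add: a_inv_def)

lemma add_hom_pow: "x \<in> carrier A \<Longrightarrow> h ([(k::int)] \<cdot>\<^bsub>A\<^esub> x) = [k] \<cdot>\<^bsub>C\<^esub> h x"
  using h.hom_int_pow[of x k] by (simp add: add_pow_def)

lemma add_hom_finsum:
  assumes "f \<in> S \<rightarrow> carrier A"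
  shows "h (finsum A f S) = finsum C (\<lambda>s. h (f s)) S"
  using assms
proof (induction S rule: infinite_finite_induct)
  case (insert s S)
  have "(\<lambda>s. h (f s)) \<in> S \<rightarrow> carrier C"
    using insert add_hom_closed[OF h] by auto
  with insert show ?case
    by (subst A.finsum_insert C.finsum_insert,
        auto simp: add_hom_add[OF h] add_hom_closed[OF h] A.finsum_closed Pi_def C.finsum_insert)
qed (auto simp: add_hom_zero A.finsum_infinite C.finsum_infinite)

end

lemma abelian_group_int: "abelian_group \<Z>"
  using int_is_cring cring.axioms(1) ring.is_abelian_group by blast

lemma int_add_pow: "[(k::int)] \<cdot>\<^bsub>\<Z>\<^esub> x = k * x"
proof -
  have nat: "[(n::nat)] \<cdot>\<^bsub>\<Z>\<^esub> x = int n * x" for n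
    by (induction n) (auto simp: add_pow_def algebra_simps)
  show ?thesis
    using nat[of "nat k"] nat[of "nat (- k)"]
    by (cases "k \<ge> 0") (simp_all add: add_pow_int_ge add_pow_int_lt int_a_inv_eq)
qed

context
  fixes A (structure) and h :: "'a \<Rightarrow> int"
  assumes A: "abelian_group A" and h: "h \<in> add_hom A \<Z>"
begin

lemma int_hom_zero: "h \<zero> = 0"
  using add_hom_zero[OF A abelian_group_int h] by simp

lemma int_hom_add: "x \<in> carrier A \<Longrightarrow> y \<in> carrier A \<Longrightarrow> h (x \<oplus> y) = h x + h y"
  using add_hom_add[OF h] by simp

lemma int_hom_minus: "x \<in> carrier A \<Longrightarrow> h (\<ominus> x) = - h x"
  using add_hom_minus[OF A abelian_group_int h] int_a_inv_eq by simp

lemma int_hom_pow: "x \<in> carrier A \<Longrightarrow> h ([(k::int)] \<cdot> x) = k * h x"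
  using add_hom_pow[OF A abelian_group_int h] int_add_pow by simp

lemma int_hom_finsum: "f \<in> S \<rightarrow> carrier A \<Longrightarrow> h (finsum A f S) = (\<Sum>s\<in>S. h (f s))"
  using add_hom_finsum[OF A abelian_group_int h] int_finsum_eq by metis

end

lemma int_homI:
  assumes "\<And>x y. x \<in> carrier A \<Longrightarrow> y \<in> carrier A \<Longrightarrow> h (x \<oplus>\<^bsub>A\<^esub> y) = h x + h y"
  shows "h \<in> add_hom A \<Z>"
  using assms by (auto simp: hom_def)

section \<open>The integral monoid ring\<close>

lemma frag_extend_fun_add:
  "frag_extend (\<lambda>s. a s + b s) f = frag_extend a f + frag_extend b f"
  by (simp add: frag_extend_def frag_cmul_distrib2 sum.distrib)

lemma frag_extend_fun_diff:
  "frag_extend (\<lambda>s. a s - b s) f = frag_extend a f - frag_extend b f"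
  by (induction f rule: frag_induction[OF subset_refl]) (auto simp: frag_extend_diff)

lemma frag_induct [consumes 1, case_names zero one diff]:
  assumes "Poly_Mapping.keys c \<subseteq> S" "P 0" "\<And>x. x \<in> S \<Longrightarrow> P (frag_of x)"
    and "\<And>a b. \<lbrakk>Poly_Mapping.keys a \<subseteq> S; Poly_Mapping.keys b \<subseteq> S; P a; P b\<rbrakk> \<Longrightarrow> P (a - b)"
  shows "P c"
proof -
  have "Poly_Mapping.keys c \<subseteq> S \<and> P c"
    using assms(1)
  proof (induction c rule: frag_induction)
    case (diff a b)
    then show ?case
      using keys_diff[of a b] assms(4) by blast
  qed (use assms in auto)
  then show ?thesis by blast
qed

lemma monoid_ring_simps [simp]:
  "carrier (monoid_ring M) = {f. Poly_Mapping.keys f \<subseteq> carrier M}"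
  "\<one>\<^bsub>monoid_ring M\<^esub> = frag_of \<one>\<^bsub>M\<^esub>"
  "\<zero>\<^bsub>monoid_ring M\<^esub> = 0"
  "f \<oplus>\<^bsub>monoid_ring M\<^esub> g = f + g"
  by (simp_all add: monoid_ring_def)

lemma monoid_ring_mult:
  "f \<otimes>\<^bsub>monoid_ring M\<^esub> g = frag_extend (\<lambda>s. frag_extend (\<lambda>t. frag_of (s \<otimes>\<^bsub>M\<^esub> t)) g) f"
  by (simp add: monoid_ring_def)

lemma monoid_ring_mult_of [simp]:
  "frag_of s \<otimes>\<^bsub>monoid_ring M\<^esub> frag_of t = frag_of (s \<otimes>\<^bsub>M\<^esub> t)"
  by (simp add: monoid_ring_mult)

lemma monoid_ring_mult_simps:
  "(f + g) \<otimes>\<^bsub>monoid_ring M\<^esub> h = f \<otimes>\<^bsub>monoid_ring M\<^esub> h + g \<otimes>\<^bsub>monoid_ring M\<^esub> h"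
  "h \<otimes>\<^bsub>monoid_ring M\<^esub> (f + g) = h \<otimes>\<^bsub>monoid_ring M\<^esub> f + h \<otimes>\<^bsub>monoid_ring M\<^esub> g"
  "(f - g) \<otimes>\<^bsub>monoid_ring M\<^esub> h = f \<otimes>\<^bsub>monoid_ring M\<^esub> h - g \<otimes>\<^bsub>monoid_ring M\<^esub> h"
  "h \<otimes>\<^bsub>monoid_ring M\<^esub> (f - g) = h \<otimes>\<^bsub>monoid_ring M\<^esub> f - h \<otimes>\<^bsub>monoid_ring M\<^esub> g"
  "0 \<otimes>\<^bsub>monoid_ring M\<^esub> h = 0"
  "h \<otimes>\<^bsub>monoid_ring M\<^esub> 0 = 0"
  by (auto simp: monoid_ring_mult frag_extend_add frag_extend_diff frag_extend_fun_add
      frag_extend_fun_diff intro: frag_extend_eq_0)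

text \<open>
  Products are biadditive, so associativity and the unit laws only have to be seen on the
  generators, where they are the laws of the monoid.
\<close>

lemma (in monoid) monoid_ring_is_ring: "ring (monoid_ring G)"
proof (rule ringI)
  let ?R = "monoid_ring G"
  show "abelian_group ?R"
  proof (rule abelian_groupI)
    fix x assume "x \<in> carrier ?R"
    then show "\<exists>y\<in>carrier ?R. y \<oplus>\<^bsub>?R\<^esub> x = \<zero>\<^bsub>?R\<^esub>"
      by (intro bexI[of _ "- x"]) auto
  qed (use keys_add in \<open>fastforce simp: add_ac\<close>)+
  show "Group.monoid ?R"
  proof (rule monoidI)
    fix x y assume "x \<in> carrier ?R" "y \<in> carrier ?R"
    then show "x \<otimes>\<^bsub>?R\<^esub> y \<in> carrier ?R"
      unfolding monoid_ring_mult monoid_ring_simps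
      by (fastforce dest!: set_mp[OF keys_frag_extend])
  next
    fix x y z assume xyz: "x \<in> carrier ?R" "y \<in> carrier ?R" "z \<in> carrier ?R"
    then have "Poly_Mapping.keys x \<subseteq> carrier G" by simp
    then show "x \<otimes>\<^bsub>?R\<^esub> y \<otimes>\<^bsub>?R\<^esub> z = x \<otimes>\<^bsub>?R\<^esub> (y \<otimes>\<^bsub>?R\<^esub> z)"
    proof (induction x rule: frag_induct)
      case (one s)
      have "Poly_Mapping.keys y \<subseteq> carrier G" using xyz by simp
      then show ?case
      proof (induction y rule: frag_induct)
        case (one t)
        have "Poly_Mapping.keys z \<subseteq> carrier G" using xyz by simp
        then show ?case
          by (induction z rule: frag_induct)
            (use \<open>s \<in> carrier G\<close> one in \<open>auto simp: monoid_ring_mult_simps m_assoc\<close>)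
      qed (auto simp: monoid_ring_mult_simps)
    qed (auto simp: monoid_ring_mult_simps)
  next
    fix x assume "x \<in> carrier ?R"
    then have "Poly_Mapping.keys x \<subseteq> carrier G" by simp
    then have "\<one>\<^bsub>?R\<^esub> \<otimes>\<^bsub>?R\<^esub> x = x \<and> x \<otimes>\<^bsub>?R\<^esub> \<one>\<^bsub>?R\<^esub> = x"
      by (induction x rule: frag_induct) (auto simp: monoid_ring_mult_simps)
    then show "\<one>\<^bsub>?R\<^esub> \<otimes>\<^bsub>?R\<^esub> x = x" "x \<otimes>\<^bsub>?R\<^esub> \<one>\<^bsub>?R\<^esub> = x" by auto
  qed auto
qed (auto simp: monoid_ring_mult_simps)

lemma (in monoid) monoid_ring_minus:
  assumes "f \<in> carrier (monoid_ring G)"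
  shows "\<ominus>\<^bsub>monoid_ring G\<^esub> f = - f"
proof -
  interpret R: ring "monoid_ring G" by (rule monoid_ring_is_ring)
  show ?thesis
    using assms by (intro R.minus_equality) auto
qed

section \<open>Tensor powers\<close>

lemma map2_append:
  "length us = length us' \<Longrightarrow> map2 f (us @ vs) (us' @ vs') = map2 f us us' @ map2 f vs vs'"
  by simp

context ring
begin

lemma tuple_monoid_simps [simp]:
  "carrier (tuple_monoid R n) = {xs. length xs = n \<and> set xs \<subseteq> carrier R}"
  "xs \<otimes>\<^bsub>tuple_monoid R n\<^esub> ys = map2 (\<otimes>) xs ys"
  "\<one>\<^bsub>tuple_monoid R n\<^esub> = replicate n \<one>"
  by (simp_all add: tuple_monoid_def)

lemma set_map2_mult: "set xs \<subseteq> carrier R \<Longrightarrow> set ys \<subseteq> carrier R \<Longrightarrow> set (map2 (\<otimes>) xs ys) \<subseteq> carrier R"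
proof (induction xs arbitrary: ys)
  case (Cons x xs)
  then show ?case by (cases ys) auto
qed simp

lemma map2_mult_assoc:
  assumes "set xs \<subseteq> carrier R" "set ys \<subseteq> carrier R" "set zs \<subseteq> carrier R"
  shows "map2 (\<otimes>) (map2 (\<otimes>) xs ys) zs = map2 (\<otimes>) xs (map2 (\<otimes>) ys zs)"
  using assms
proof (induction xs arbitrary: ys zs)
  case (Cons x xs)
  then show ?case by (cases ys; cases zs) (auto simp: m_assoc)
qed simp

lemma map2_mult_one:
  assumes "set xs \<subseteq> carrier R"
  shows "map2 (\<otimes>) (replicate (length xs) \<one>) xs = xs" "map2 (\<otimes>) xs (replicate (length xs) \<one>) = xs"
  using assms by (induction xs) auto

lemma tuple_monoid_is_monoid: "monoid (tuple_monoid R n)"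
  by (rule monoidI) (use set_map2_mult map2_mult_assoc map2_mult_one in auto)

abbreviation TP :: "nat \<Rightarrow> ('a list \<Rightarrow>\<^sub>0 int) set ring" where
  "TP \<equiv> tensor_power R"

abbreviation tuple_ring :: "nat \<Rightarrow> ('a list \<Rightarrow>\<^sub>0 int) ring" where
  "tuple_ring n \<equiv> monoid_ring (tuple_monoid R n)"

lemma tuple_ring_is_ring: "ring (tuple_ring n)"
  using monoid.monoid_ring_is_ring tuple_monoid_is_monoid by blast

lemma multilinear_relations_closed: "multilinear_relations R n \<subseteq> carrier (tuple_ring n)"
proof -
  have "frag_of (us @ [a \<oplus> b] @ vs) - frag_of (us @ [a] @ vs) - frag_of (us @ [b] @ vs)
      \<in> carrier (tuple_ring n)"
    if "us @ [a] @ vs \<in> carrier (tuple_monoid R n)" "b \<in> carrier R" for us a b vs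
  proof -
    have "Poly_Mapping.keys (frag_of (us @ [a \<oplus> b] @ vs) - frag_of (us @ [a] @ vs) - frag_of (us @ [b] @ vs))
        \<subseteq> {us @ [a \<oplus> b] @ vs, us @ [a] @ vs, us @ [b] @ vs}"
      by (auto simp: in_keys_iff lookup_minus split: if_splits)
    also have "\<dots> \<subseteq> carrier (tuple_monoid R n)" using that by auto
    finally show ?thesis by simp
  qed
  then show ?thesis
    unfolding multilinear_relations_def by blast
qed

text \<open>
  Multiplying by a tuple acts in each component separately; in the component where the relation
  expresses additivity, the distributive law turns it into another relation of this kind.
\<close>

lemma multilinear_relations_mult:
  assumes s: "s \<in> carrier (tuple_monoid R n)" and r: "r \<in> multilinear_relations R n"
  shows "frag_of s \<otimes>\<^bsub>tuple_ring n\<^esub> r \<in> multilinear_relations R n"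
    and "r \<otimes>\<^bsub>tuple_ring n\<^esub> frag_of s \<in> multilinear_relations R n"
proof -
  obtain us a b vs where r_eq: "r = frag_of (us @ [a \<oplus> b] @ vs) - frag_of (us @ [a] @ vs) - frag_of (us @ [b] @ vs)"
    and cl: "us @ [a] @ vs \<in> carrier (tuple_monoid R n)" "b \<in> carrier R"
    using r unfolding multilinear_relations_def by blast
  define us' c vs' where "us' = take (length us) s" and "c = s ! length us" and "vs' = drop (Suc (length us)) s"
  have s_eq: "s = us' @ [c] @ vs'" and len: "length us' = length us" "length vs' = length vs"
    using s cl by (auto simp: us'_def c_def vs'_def id_take_nth_drop)
  have cl': "c \<in> carrier R" "set us' \<subseteq> carrier R" "set vs' \<subseteq> carrier R"
    using s s_eq by auto
  have m: "set (map2 (\<otimes>) xs ys) \<subseteq> carrier R" if "set xs \<subseteq> carrier R" "set ys \<subseteq> carrier R" for xs ys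
    using that by (rule set_map2_mult)
  show "frag_of s \<otimes>\<^bsub>tuple_ring n\<^esub> r \<in> multilinear_relations R n"
    unfolding r_eq s_eq multilinear_relations_def
    apply (rule CollectI)
    apply (rule exI[of _ "map2 (\<otimes>) us' us"], rule exI[of _ "c \<otimes> a"], rule exI[of _ "c \<otimes> b"],
        rule exI[of _ "map2 (\<otimes>) vs' vs"])
    using cl cl' len m by (auto simp: monoid_ring_mult_simps r_distr)
  show "r \<otimes>\<^bsub>tuple_ring n\<^esub> frag_of s \<in> multilinear_relations R n"
    unfolding r_eq s_eq multilinear_relations_def
    apply (rule CollectI)
    apply (rule exI[of _ "map2 (\<otimes>) us us'"], rule exI[of _ "a \<otimes> c"], rule exI[of _ "b \<otimes> c"],
        rule exI[of _ "map2 (\<otimes>) vs vs'"])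
    using cl cl' len m by (auto simp: monoid_ring_mult_simps l_distr)
qed

lemma tensor_relations_ideal: "ideal (tensor_relations R n) (tuple_ring n)"
proof -
  interpret M: ring "tuple_ring n" by (rule tuple_ring_is_ring)
  let ?I = "tensor_relations R n"
  have sub: "subgroup ?I (add_monoid (tuple_ring n))"
    unfolding tensor_relations_def
    using multilinear_relations_closed by (intro M.add.generate_is_subgroup) simp
  then interpret I: additive_subgroup ?I "tuple_ring n" by (rule additive_subgroup.intro)
  have sub_diff: "a - b \<in> ?I" if "a \<in> ?I" "b \<in> ?I" for a b
  proof -
    have "a \<ominus>\<^bsub>tuple_ring n\<^esub> b \<in> ?I"
      unfolding a_minus_def using that I.a_closed I.a_inv_closed by blast
    moreover have "\<ominus>\<^bsub>tuple_ring n\<^esub> b = - b"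
      using that I.a_Hcarr tuple_monoid_is_monoid
      by (intro monoid.monoid_ring_minus) auto
    ultimately show ?thesis by (simp add: a_minus_def)
  qed
  have gen: "r \<in> multilinear_relations R n \<Longrightarrow> r \<in> ?I" for r
    unfolding tensor_relations_def by (rule generate.incl)
  have rel: "x \<otimes>\<^bsub>tuple_ring n\<^esub> r \<in> ?I \<and> r \<otimes>\<^bsub>tuple_ring n\<^esub> x \<in> ?I"
    if "x \<in> carrier (tuple_ring n)" "r \<in> multilinear_relations R n" for x r
  proof -
    have "Poly_Mapping.keys x \<subseteq> carrier (tuple_monoid R n)" using that by simp
    then show ?thesis
    proof (induction x rule: frag_induct)
      case zero
      then show ?case using I.zero_closed by (simp add: monoid_ring_mult_simps)
    next
      case (one s)
      then show ?case using multilinear_relations_mult[OF one that(2)] gen by blast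
    next
      case (diff a b)
      then show ?case by (simp add: monoid_ring_mult_simps sub_diff)
    qed
  qed
  have I: "x \<otimes>\<^bsub>tuple_ring n\<^esub> a \<in> ?I \<and> a \<otimes>\<^bsub>tuple_ring n\<^esub> x \<in> ?I"
    if "a \<in> ?I" "x \<in> carrier (tuple_ring n)" for a x
  proof -
    have "a \<in> generate (add_monoid (tuple_ring n)) (multilinear_relations R n)"
      using that(1) by (simp only: tensor_relations_def)
    then show ?thesis
    proof (induction a rule: generate.induct)
      case one
      then show ?case
        using I.zero_closed by (simp add: monoid_ring_mult_simps)
    next
      case (incl h)
      then show ?case using rel that(2) by blast
    next
      case (inv h)
      have h: "h \<in> carrier (tuple_ring n)" using inv multilinear_relations_closed by blast
      have "inv\<^bsub>add_monoid (tuple_ring n)\<^esub> h = \<ominus>\<^bsub>tuple_ring n\<^esub> h" by (simp add: a_inv_def)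
      moreover have "x \<otimes>\<^bsub>tuple_ring n\<^esub> h \<in> ?I" "h \<otimes>\<^bsub>tuple_ring n\<^esub> x \<in> ?I" using rel inv that(2) by blast+
      ultimately show ?case
        using M.l_minus[OF h that(2)] M.r_minus[OF that(2) h] I.a_inv_closed by metis
    next
      case (eng h1 h2)
      then show ?case
        using I.a_closed by (simp add: monoid_ring_mult_simps)
    qed
  qed
  show ?thesis
    by (rule idealI[OF tuple_ring_is_ring sub]) (use I in blast)+
qed

lemma tensor_power_is_ring: "ring (TP n)"
  unfolding tensor_power_def using tensor_relations_ideal by (rule ideal.quotient_is_ring)

abbreviation tensor_class :: "nat \<Rightarrow> ('a list \<Rightarrow>\<^sub>0 int) \<Rightarrow> ('a list \<Rightarrow>\<^sub>0 int) set" where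
  "tensor_class n r \<equiv> tensor_relations R n +>\<^bsub>tuple_ring n\<^esub> r"

lemma tensor_class_hom: "tensor_class n \<in> ring_hom (tuple_ring n) (TP n)"
  unfolding tensor_power_def using tensor_relations_ideal by (rule ideal.rcos_ring_hom)

text \<open>
  Every tensor is represented by an integral combination of tuples; this reduces statements about
  tensors to pure tensors.
\<close>

lemma tensor_class_surj:
  assumes "t \<in> carrier (TP n)"
  obtains r where "r \<in> carrier (tuple_ring n)" "t = tensor_class n r"
  using assms that unfolding tensor_power_def by (auto simp: FactRing_def A_RCOSETS_def' simp del: monoid_ring_simps)

lemma pure_tensor_class: "length xs = n \<Longrightarrow> pure_tensor R xs = tensor_class n (frag_of xs)"
  by (auto simp: pure_tensor_def)

lemma pure_tensor_closed [intro, simp]: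
  assumes "length xs = n" "set xs \<subseteq> carrier R"
  shows "pure_tensor R xs \<in> carrier (TP n)"
  using ring_hom_closed[OF tensor_class_hom, of "frag_of xs" n] assms
  by (simp add: pure_tensor_class)

lemma pure_tensor_mult:
  assumes "length xs = n" "set xs \<subseteq> carrier R" "length ys = n" "set ys \<subseteq> carrier R"
  shows "pure_tensor R xs \<otimes>\<^bsub>TP n\<^esub> pure_tensor R ys = pure_tensor R (map2 (\<otimes>) xs ys)"
  using ring_hom_mult[OF tensor_class_hom, of "frag_of xs" n "frag_of ys"] assms
  by (simp add: pure_tensor_class)

lemma one_tensor_power: "\<one>\<^bsub>TP n\<^esub> = pure_tensor R (replicate n \<one>)"
  using ring_hom_one[OF tensor_class_hom, of n] by (simp add: pure_tensor_class)

lemma zero_tensor_power: "\<zero>\<^bsub>TP n\<^esub> = tensor_class n 0"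
  using add_hom_zero[OF _ _ ring_hom_add_hom[OF tensor_class_hom], of n] tuple_ring_is_ring
    tensor_power_is_ring ring.is_abelian_group by (metis monoid_ring_simps(3))

lemma tensor_class_diff:
  assumes "r \<in> carrier (tuple_ring n)" "s \<in> carrier (tuple_ring n)"
  shows "tensor_class n (r - s) = tensor_class n r \<ominus>\<^bsub>TP n\<^esub> tensor_class n s"
proof -
  have ag: "abelian_group (tuple_ring n)" "abelian_group (TP n)"
    using tuple_ring_is_ring tensor_power_is_ring ring.is_abelian_group by blast+
  interpret M: abelian_group "tuple_ring n" by (rule ag)
  have "r - s = r \<oplus>\<^bsub>tuple_ring n\<^esub> (\<ominus>\<^bsub>tuple_ring n\<^esub> s)"
    using monoid.monoid_ring_minus[OF tuple_monoid_is_monoid assms(2)] by simp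
  then show ?thesis
    using add_hom_add[OF ring_hom_add_hom[OF tensor_class_hom] assms(1) M.a_inv_closed[OF assms(2)]]
      add_hom_minus[OF ag ring_hom_add_hom[OF tensor_class_hom] assms(2)]
    unfolding a_minus_def by metis
qed

lemma tensor_induct [consumes 1, case_names pure zero diff]:
  assumes t: "t \<in> carrier (TP n)"
    and pure: "\<And>xs. length xs = n \<Longrightarrow> set xs \<subseteq> carrier R \<Longrightarrow> P (pure_tensor R xs)"
    and zero: "P \<zero>\<^bsub>TP n\<^esub>"
    and diff: "\<And>s t. \<lbrakk>s \<in> carrier (TP n); t \<in> carrier (TP n); P s; P t\<rbrakk>
      \<Longrightarrow> P (s \<ominus>\<^bsub>TP n\<^esub> t)"
  shows "P t"
proof -
  obtain r where r: "r \<in> carrier (tuple_ring n)" "t = tensor_class n r"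
    using t by (rule tensor_class_surj)
  have "Poly_Mapping.keys r \<subseteq> carrier (tuple_monoid R n)" using r by simp
  then have "P (tensor_class n r)"
  proof (induction r rule: frag_induct)
    case zero
    then show ?case using assms(3) zero_tensor_power by simp
  next
    case (one xs)
    then show ?case using pure[of xs] by (simp add: pure_tensor_class)
  next
    case (diff a b)
    then have ab: "a \<in> carrier (tuple_ring n)" "b \<in> carrier (tuple_ring n)" by auto
    show ?case
      unfolding tensor_class_diff[OF ab]
      using assms(4) diff ring_hom_closed[OF tensor_class_hom] ab by blast
  qed
  then show ?thesis using r by simp
qed

text \<open>
  The uniqueness half of the universal property of the tensor power.  The existence half is
  \<open>tensor_lift_hom\<close> and \<open>tensor_lift_pure\<close> below.
\<close>

lemma tensor_hom_eqI:
  assumes "abelian_group C" "g \<in> add_hom (TP n) C" "h \<in> add_hom (TP n) C"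
    and "\<And>xs. length xs = n \<Longrightarrow> set xs \<subseteq> carrier R \<Longrightarrow> g (pure_tensor R xs) = h (pure_tensor R xs)"
    and "t \<in> carrier (TP n)"
  shows "g t = h t"
proof -
  have ag: "abelian_group (TP n)"
    using tensor_power_is_ring ring.is_abelian_group by blast
  interpret T: abelian_group "TP n" by (rule ag)
  show ?thesis
    using assms(5)
    by (induction t rule: tensor_induct)
      (simp_all add: assms(4) a_minus_def add_hom_zero[OF ag assms(1,2)] add_hom_zero[OF ag assms(1,3)]
        add_hom_minus[OF ag assms(1,2)] add_hom_minus[OF ag assms(1,3)]
        add_hom_add[OF assms(2)] add_hom_add[OF assms(3)])
qed

definition multilinear :: "nat \<Rightarrow> ('c, 'd) ring_scheme \<Rightarrow> ('a list \<Rightarrow> 'c) \<Rightarrow> bool" where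
  "multilinear n C \<phi> \<longleftrightarrow>
    (\<forall>xs. length xs = n \<longrightarrow> set xs \<subseteq> carrier R \<longrightarrow> \<phi> xs \<in> carrier C) \<and>
    (\<forall>us a b vs. length us + length vs + 1 = n \<longrightarrow> set us \<subseteq> carrier R \<longrightarrow> set vs \<subseteq> carrier R \<longrightarrow>
       a \<in> carrier R \<longrightarrow> b \<in> carrier R \<longrightarrow>
       \<phi> (us @ [a \<oplus> b] @ vs) = \<phi> (us @ [a] @ vs) \<oplus>\<^bsub>C\<^esub> \<phi> (us @ [b] @ vs))"

lemma multilinearI:
  assumes "\<And>xs. length xs = n \<Longrightarrow> set xs \<subseteq> carrier R \<Longrightarrow> \<phi> xs \<in> carrier C"
    and "\<And>us a b vs. length us + length vs + 1 = n \<Longrightarrow> set us \<subseteq> carrier R \<Longrightarrow> set vs \<subseteq> carrier R \<Longrightarrow>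
       a \<in> carrier R \<Longrightarrow> b \<in> carrier R \<Longrightarrow>
       \<phi> (us @ [a \<oplus> b] @ vs) = \<phi> (us @ [a] @ vs) \<oplus>\<^bsub>C\<^esub> \<phi> (us @ [b] @ vs)"
  shows "multilinear n C \<phi>"
  using assms unfolding multilinear_def by blast

lemma multilinear_pure_tensor: "multilinear n (TP n) (pure_tensor R)"
proof (rule multilinearI)
  fix us a b vs
  assume *: "length us + length vs + 1 = n" "set us \<subseteq> carrier R" "set vs \<subseteq> carrier R"
       "a \<in> carrier R" "b \<in> carrier R"
  let ?r = "\<lambda>c. frag_of (us @ [c] @ vs)"
  let ?D = "?r (a \<oplus> b) - ?r a - ?r b"
  interpret I: ideal "tensor_relations R n" "tuple_ring n" by (rule tensor_relations_ideal)
  interpret T: ring "TP n" by (rule tensor_power_is_ring)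
  have "?D \<in> multilinear_relations R n"
    unfolding multilinear_relations_def using * by auto
  then have D: "?D \<in> tensor_relations R n"
    unfolding tensor_relations_def by (rule generate.incl)
  have Dc: "?D \<in> carrier (tuple_ring n)" using D by (rule I.a_Hcarr)
  have rc: "?r (a \<oplus> b) \<in> carrier (tuple_ring n)" "?r a \<in> carrier (tuple_ring n)" "?r b \<in> carrier (tuple_ring n)"
    using * by auto
  have "?r (a \<oplus> b) = ?D \<oplus>\<^bsub>tuple_ring n\<^esub> (?r a \<oplus>\<^bsub>tuple_ring n\<^esub> ?r b)" by simp
  then have "tensor_class n (?r (a \<oplus> b)) = tensor_class n ?D \<oplus>\<^bsub>TP n\<^esub>
      (tensor_class n (?r a) \<oplus>\<^bsub>TP n\<^esub> tensor_class n (?r b))"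
    using ring_hom_add[OF tensor_class_hom] Dc rc I.a_closed
    by (metis I.add.m_closed)
  moreover have "tensor_class n ?D = \<zero>\<^bsub>TP n\<^esub>"
    using D I.a_rcos_const by (simp add: tensor_power_def FactRing_def)
  moreover have "tensor_class n (?r a) \<oplus>\<^bsub>TP n\<^esub> tensor_class n (?r b) \<in> carrier (TP n)"
    using ring_hom_closed[OF tensor_class_hom] rc by blast
  ultimately show "pure_tensor R (us @ [a \<oplus> b] @ vs) = pure_tensor R (us @ [a] @ vs)
      \<oplus>\<^bsub>TP n\<^esub> pure_tensor R (us @ [b] @ vs)"
    using * by (simp add: pure_tensor_class)
qed auto

context
  fixes C :: "('c, 'd) ring_scheme" and n :: nat and \<phi> :: "'a list \<Rightarrow> 'c"
  assumes C: "abelian_group C" and \<phi>: "multilinear n C \<phi>"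
begin

interpretation C: abelian_group C by (rule C)

text \<open>
  The extension of \<open>\<phi>\<close> to the free abelian group on the tuples.  It is the expression that
  \<^const>\<open>tensor_lift\<close> evaluates on all representatives of a class.
\<close>

definition frag_value :: "('a list \<Rightarrow>\<^sub>0 int) \<Rightarrow> 'c" where
  "frag_value r = (\<Oplus>\<^bsub>C\<^esub>xs \<in> Poly_Mapping.keys r. [Poly_Mapping.lookup r xs] \<cdot>\<^bsub>C\<^esub> \<phi> xs)"

private lemma \<phi>_closed: "length xs = n \<Longrightarrow> set xs \<subseteq> carrier R \<Longrightarrow> \<phi> xs \<in> carrier C"
  using \<phi> unfolding multilinear_def by blast

lemma frag_value_superset:
  assumes "finite K" "Poly_Mapping.keys r \<subseteq> K" "K \<subseteq> carrier (tuple_monoid R n)"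
  shows "frag_value r = (\<Oplus>\<^bsub>C\<^esub>xs \<in> K. [Poly_Mapping.lookup r xs] \<cdot>\<^bsub>C\<^esub> \<phi> xs)"
proof -
  have "[(0::int)] \<cdot>\<^bsub>C\<^esub> x = \<zero>\<^bsub>C\<^esub>" for x by (simp add: add_pow_def)
  then show ?thesis
    unfolding frag_value_def
    by (intro C.add.finprod_mono_neutral_cong_left)
      (use assms \<phi>_closed in \<open>auto simp: in_keys_iff\<close>)
qed

lemma frag_value_hom: "frag_value \<in> add_hom (tuple_ring n) C"
proof (rule add_homI)
  fix r assume "r \<in> carrier (tuple_ring n)"
  then show "frag_value r \<in> carrier C"
    unfolding frag_value_def using \<phi>_closed by (auto intro!: C.finsum_closed)
next
  fix r s assume rs: "r \<in> carrier (tuple_ring n)" "s \<in> carrier (tuple_ring n)"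
  let ?K = "Poly_Mapping.keys r \<union> Poly_Mapping.keys s"
  have K: "finite ?K" "?K \<subseteq> carrier (tuple_monoid R n)" using rs by auto
  have "frag_value (r + s) = (\<Oplus>\<^bsub>C\<^esub>xs \<in> ?K. [Poly_Mapping.lookup (r + s) xs] \<cdot>\<^bsub>C\<^esub> \<phi> xs)"
    using keys_add[of r s] by (intro frag_value_superset K) 
  also have "\<dots> = (\<Oplus>\<^bsub>C\<^esub>xs \<in> ?K. [Poly_Mapping.lookup r xs] \<cdot>\<^bsub>C\<^esub> \<phi> xs \<oplus>\<^bsub>C\<^esub> [Poly_Mapping.lookup s xs] \<cdot>\<^bsub>C\<^esub> \<phi> xs)"
    using K \<phi>_closed by (intro C.finsum_cong') (auto simp: lookup_add C.add.int_pow_mult)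
  also have "\<dots> = frag_value r \<oplus>\<^bsub>C\<^esub> frag_value s"
    using K \<phi>_closed by (subst C.finsum_addf) (auto simp: frag_value_superset[OF K(1) _ K(2)])
  finally show "frag_value (r \<oplus>\<^bsub>tuple_ring n\<^esub> s) = frag_value r \<oplus>\<^bsub>C\<^esub> frag_value s" by simp
qed

lemma frag_value_of: "length xs = n \<Longrightarrow> set xs \<subseteq> carrier R \<Longrightarrow> frag_value (frag_of xs) = \<phi> xs"
  unfolding frag_value_def using \<phi>_closed
  by (simp add: C.finsum_insert C.add.int_pow_1)

lemma frag_value_relations:
  assumes "r \<in> tensor_relations R n"
  shows "frag_value r = \<zero>\<^bsub>C\<^esub>"
proof -
  interpret M: ring "tuple_ring n" by (rule tuple_ring_is_ring)
  note hom = M.is_abelian_group C frag_value_hom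
  have rel: "r \<in> carrier (tuple_ring n) \<and> frag_value r = \<zero>\<^bsub>C\<^esub>" if r: "r \<in> multilinear_relations R n" for r
  proof -
    obtain us a b vs where
      r_eq: "r = frag_of (us @ [a \<oplus> b] @ vs) - frag_of (us @ [a] @ vs) - frag_of (us @ [b] @ vs)"
      and cl: "us @ [a] @ vs \<in> carrier (tuple_monoid R n)" "b \<in> carrier R"
      using r unfolding multilinear_relations_def by blast
    have rc: "r \<in> carrier (tuple_ring n)" using r multilinear_relations_closed by blast
    have c: "frag_of (us @ [a \<oplus> b] @ vs) \<in> carrier (tuple_ring n)"
      "frag_of (us @ [a] @ vs) \<in> carrier (tuple_ring n)"
      "frag_of (us @ [b] @ vs) \<in> carrier (tuple_ring n)"
      using cl by auto
    have "frag_of (us @ [a \<oplus> b] @ vs) = r \<oplus>\<^bsub>tuple_ring n\<^esub> (frag_of (us @ [a] @ vs)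
       \<oplus>\<^bsub>tuple_ring n\<^esub> frag_of (us @ [b] @ vs))"
      by (simp add: r_eq)
    then have "frag_value (frag_of (us @ [a \<oplus> b] @ vs)) = frag_value r \<oplus>\<^bsub>C\<^esub>
      (frag_value (frag_of (us @ [a] @ vs)) \<oplus>\<^bsub>C\<^esub> frag_value (frag_of (us @ [b] @ vs)))"
      using add_hom_add[OF frag_value_hom] c rc M.add.m_closed by metis
    moreover have "\<phi> (us @ [a \<oplus> b] @ vs) = \<phi> (us @ [a] @ vs) \<oplus>\<^bsub>C\<^esub> \<phi> (us @ [b] @ vs)"
      using \<phi> cl unfolding multilinear_def by auto
    moreover have "frag_value r \<in> carrier C" using add_hom_closed[OF frag_value_hom rc] .
    ultimately show ?thesis
      using cl rc \<phi>_closed frag_value_of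
      by (auto simp: C.add.l_cancel_one')
  qed
  have "r \<in> carrier (tuple_ring n) \<and> frag_value r = \<zero>\<^bsub>C\<^esub>"
    using assms unfolding tensor_relations_def
  proof (induction r rule: generate.induct)
    case one
    then show ?case using add_hom_zero[OF hom] by simp
  next
    case (incl h)
    then show ?case using rel by blast
  next
    case (inv h)
    then have h: "h \<in> carrier (tuple_ring n)" "frag_value h = \<zero>\<^bsub>C\<^esub>" using rel by blast+
    have "inv\<^bsub>add_monoid (tuple_ring n)\<^esub> h = \<ominus>\<^bsub>tuple_ring n\<^esub> h" by (simp add: a_inv_def)
    moreover have "\<ominus>\<^bsub>C\<^esub> \<zero>\<^bsub>C\<^esub> = \<zero>\<^bsub>C\<^esub>" using C.add.inv_one by (simp add: a_inv_def)
    ultimately show ?case using add_hom_minus[OF hom h(1)] h M.a_inv_closed by metis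
  next
    case (eng h1 h2)
    then show ?case
      using add_hom_add[OF frag_value_hom] M.add.m_closed
      by (metis C.add.l_one C.add.one_closed monoid.simps(1) )
  qed
  then show ?thesis by blast
qed

text \<open>
  The image in the definition of \<^const>\<open>tensor_lift\<close> is a singleton, because the extension of
  \<open>\<phi>\<close> vanishes on the relations.
\<close>

lemma tensor_lift_class:
  assumes r: "r \<in> carrier (tuple_ring n)"
  shows "tensor_lift C \<phi> (tensor_class n r) = frag_value r"
proof -
  interpret I: ideal "tensor_relations R n" "tuple_ring n" by (rule tensor_relations_ideal)
  have "frag_value s = frag_value r" if s: "s \<in> tensor_class n r" for s
  proof -
    obtain i where i: "i \<in> tensor_relations R n" "s = i \<oplus>\<^bsub>tuple_ring n\<^esub> r"
      using s by (auto simp: a_r_coset_def')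
    then show ?thesis
      using add_hom_add[OF frag_value_hom I.a_Hcarr[OF i(1)] r] frag_value_relations
        add_hom_closed[OF frag_value_hom r] by simp
  qed
  moreover have "r \<in> tensor_class n r" using r by (rule I.a_rcos_self)
  ultimately have "frag_value ` tensor_class n r = {frag_value r}" by blast
  then show ?thesis
    unfolding tensor_lift_def frag_value_def[symmetric] by simp
qed

lemma tensor_lift_hom: "tensor_lift C \<phi> \<in> add_hom (TP n) C"
proof (rule add_homI)
  fix s assume "s \<in> carrier (TP n)"
  then show "tensor_lift C \<phi> s \<in> carrier C"
    using tensor_class_surj tensor_lift_class add_hom_closed[OF frag_value_hom] by metis
next
  fix s t assume "s \<in> carrier (TP n)" "t \<in> carrier (TP n)"
  then obtain p q where p: "p \<in> carrier (tuple_ring n)" "s = tensor_class n p"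
    and q: "q \<in> carrier (tuple_ring n)" "t = tensor_class n q"
    using tensor_class_surj by metis
  interpret M: ring "tuple_ring n" by (rule tuple_ring_is_ring)
  have "s \<oplus>\<^bsub>TP n\<^esub> t = tensor_class n (p \<oplus>\<^bsub>tuple_ring n\<^esub> q)"
    using ring_hom_add[OF tensor_class_hom p(1) q(1)] p q by simp
  then show "tensor_lift C \<phi> (s \<oplus>\<^bsub>TP n\<^esub> t) = tensor_lift C \<phi> s \<oplus>\<^bsub>C\<^esub> tensor_lift C \<phi> t"
    using tensor_lift_class p q add_hom_add[OF frag_value_hom p(1) q(1)] M.a_closed by metis
qed

lemma tensor_lift_pure:
  "length xs = n \<Longrightarrow> set xs \<subseteq> carrier R \<Longrightarrow> tensor_lift C \<phi> (pure_tensor R xs) = \<phi> xs"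
  using tensor_lift_class[of "frag_of xs"] frag_value_of by (simp add: pure_tensor_class)

end

end

lemma additive_subgroup_finsum:
  assumes "abelian_group A" "additive_subgroup H A" "f \<in> S \<rightarrow> H"
  shows "finsum A f S \<in> H"
proof -
  interpret A: abelian_group A by fact
  interpret H: additive_subgroup H A by fact
  show ?thesis
    using assms(3)
  proof (induction S rule: infinite_finite_induct)
    case (insert s S)
    have "finsum A f (insert s S) = f s \<oplus>\<^bsub>A\<^esub> finsum A f S"
      using insert by (intro A.finsum_insert) (auto intro: H.a_Hcarr)
    then show ?case using insert H.a_closed by auto
  qed (auto simp: H.zero_closed A.finsum_infinite)
qed

section \<open>Rings with a \<open>\<Z>\<close>-basis\<close>

text \<open>
  A basis is given together with its dual functionals.  In this form linear independence is the
  duality, spanning is that the functionals separate the elements, and both are easy to transport.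
\<close>

locale ring_basis = ring A for A (structure) +
  fixes I :: "'i set" and \<beta> :: "'i \<Rightarrow> 'a" and \<kappa> :: "'i \<Rightarrow> 'a \<Rightarrow> int"
  assumes basis_closed [intro, simp]: "i \<in> I \<Longrightarrow> \<beta> i \<in> carrier A"
    and coord_hom: "i \<in> I \<Longrightarrow> \<kappa> i \<in> add_hom A \<Z>"
    and coord_finite: "a \<in> carrier A \<Longrightarrow> finite {i \<in> I. \<kappa> i a \<noteq> 0}"
    and coord_separates: "a \<in> carrier A \<Longrightarrow> (\<And>i. i \<in> I \<Longrightarrow> \<kappa> i a = 0) \<Longrightarrow> a = \<zero>"
    and coord_basis: "i \<in> I \<Longrightarrow> j \<in> I \<Longrightarrow> \<kappa> i (\<beta> j) = (if i = j then 1 else 0)"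
begin

lemmas coord_simps =
  int_hom_zero[OF abelian_group_axioms coord_hom]
  int_hom_add[OF abelian_group_axioms coord_hom]
  int_hom_minus[OF abelian_group_axioms coord_hom]
  int_hom_pow[OF abelian_group_axioms coord_hom]
  int_hom_finsum[OF abelian_group_axioms coord_hom]

lemma coord_eqI:
  assumes "a \<in> carrier A" "b \<in> carrier A" "\<And>i. i \<in> I \<Longrightarrow> \<kappa> i a = \<kappa> i b"
  shows "a = b"
proof -
  have "a \<ominus> b = \<zero>"
    using assms by (intro coord_separates) (auto simp: a_minus_def coord_simps)
  then show ?thesis using assms by (simp add: r_right_minus_eq)
qed

definition support :: "'a \<Rightarrow> 'i set" where
  "support a = {i \<in> I. \<kappa> i a \<noteq> 0}"

lemma finite_support [simp]: "a \<in> carrier A \<Longrightarrow> finite (support a)"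
  unfolding support_def by (rule coord_finite)

lemma support_subset: "support a \<subseteq> I"
  by (auto simp: support_def)

lemma basis_expansion:
  assumes a: "a \<in> carrier A" and K: "finite K" "support a \<subseteq> K" "K \<subseteq> I"
  shows "a = (\<Oplus>i\<in>K. [\<kappa> i a] \<cdot> \<beta> i)"
proof (rule coord_eqI)
  show cl: "(\<Oplus>i\<in>K. [\<kappa> i a] \<cdot> \<beta> i) \<in> carrier A"
    using K by (intro finsum_closed) auto
  fix i assume i: "i \<in> I"
  have "\<kappa> i (\<Oplus>i\<in>K. [\<kappa> i a] \<cdot> \<beta> i) = (\<Sum>j\<in>K. \<kappa> i ([\<kappa> j a] \<cdot> \<beta> j))"
    using K i by (subst coord_simps) auto
  also have "\<dots> = (\<Sum>j\<in>K. if j = i then \<kappa> i a else 0)"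
    using K i by (intro sum.cong) (auto simp: coord_simps coord_basis subset_iff)
  also have "\<dots> = \<kappa> i a"
    using K i by (auto simp: support_def)
  finally show "\<kappa> i a = \<kappa> i (\<Oplus>i\<in>K. [\<kappa> i a] \<cdot> \<beta> i)" by simp
qed (rule a)

lemma hom_expansion:
  assumes h: "h \<in> add_hom A \<Z>" and a: "a \<in> carrier A" and K: "finite K" "support a \<subseteq> K" "K \<subseteq> I"
  shows "h a = (\<Sum>i\<in>K. \<kappa> i a * h (\<beta> i))"
proof -
  have "h a = h (\<Oplus>i\<in>K. [\<kappa> i a] \<cdot> \<beta> i)"
    using basis_expansion[OF a K] by simp
  also have "\<dots> = (\<Sum>i\<in>K. h ([\<kappa> i a] \<cdot> \<beta> i))"
    using K by (intro int_hom_finsum[OF abelian_group_axioms h]) auto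
  also have "\<dots> = (\<Sum>i\<in>K. \<kappa> i a * h (\<beta> i))"
    using K by (intro sum.cong) (auto simp: int_hom_pow[OF abelian_group_axioms h])
  finally show ?thesis .
qed

lemma hom_eqI_basis:
  assumes C: "abelian_group C" and g: "g \<in> add_hom A C" and h: "h \<in> add_hom A C"
    and eq: "\<And>i. i \<in> I \<Longrightarrow> g (\<beta> i) = h (\<beta> i)" and a: "a \<in> carrier A"
  shows "g a = h a"
proof -
  interpret C: abelian_group C by (rule C)
  let ?S = "support a"
  have f: "(\<lambda>i. [\<kappa> i a] \<cdot> \<beta> i) \<in> ?S \<rightarrow> carrier A" using support_subset by auto
  have "g a = g (\<Oplus>i\<in>?S. [\<kappa> i a] \<cdot> \<beta> i)" "h a = h (\<Oplus>i\<in>?S. [\<kappa> i a] \<cdot> \<beta> i)"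
    using basis_expansion[OF a _ subset_refl support_subset] a by auto
  moreover have "g (\<Oplus>i\<in>?S. [\<kappa> i a] \<cdot> \<beta> i) = (\<Oplus>\<^bsub>C\<^esub>i\<in>?S. [\<kappa> i a] \<cdot>\<^bsub>C\<^esub> g (\<beta> i))"
    unfolding add_hom_finsum[OF abelian_group_axioms C g f]
    using support_subset add_hom_closed[OF g]
    by (intro C.finsum_cong') (auto simp: add_hom_pow[OF abelian_group_axioms C g] subset_iff)
  moreover have "h (\<Oplus>i\<in>?S. [\<kappa> i a] \<cdot> \<beta> i) = (\<Oplus>\<^bsub>C\<^esub>i\<in>?S. [\<kappa> i a] \<cdot>\<^bsub>C\<^esub> g (\<beta> i))"
    unfolding add_hom_finsum[OF abelian_group_axioms C h f]
    using support_subset add_hom_closed[OF g] add_hom_closed[OF h] eq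
    by (intro C.finsum_cong') (auto simp: add_hom_pow[OF abelian_group_axioms C h] subset_iff)
  ultimately show ?thesis by simp
qed

definition basis_lift :: "('c, 'd) ring_scheme \<Rightarrow> ('i \<Rightarrow> 'c) \<Rightarrow> 'a \<Rightarrow> 'c" where
  "basis_lift C s a = (\<Oplus>\<^bsub>C\<^esub>i\<in>support a. [\<kappa> i a] \<cdot>\<^bsub>C\<^esub> s i)"

context
  fixes C :: "('c, 'd) ring_scheme" and s :: "'i \<Rightarrow> 'c"
  assumes C: "abelian_group C" and s: "\<And>i. i \<in> I \<Longrightarrow> s i \<in> carrier C"
begin

interpretation C: abelian_group C by (rule C)

lemma basis_lift_superset:
  assumes "finite K" "support a \<subseteq> K" "K \<subseteq> I"
  shows "basis_lift C s a = (\<Oplus>\<^bsub>C\<^esub>i\<in>K. [\<kappa> i a] \<cdot>\<^bsub>C\<^esub> s i)"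
proof -
  have "[(0::int)] \<cdot>\<^bsub>C\<^esub> x = \<zero>\<^bsub>C\<^esub>" for x by (simp add: add_pow_def)
  then show ?thesis
    unfolding basis_lift_def
    by (intro C.add.finprod_mono_neutral_cong_left) (use assms s in \<open>auto simp: support_def\<close>)
qed

lemma basis_lift_hom: "basis_lift C s \<in> add_hom A C"
proof (rule add_homI)
  fix a assume "a \<in> carrier A"
  then show "basis_lift C s a \<in> carrier C"
    unfolding basis_lift_def using s support_subset by (intro C.finsum_closed) auto
next
  fix a b assume ab: "a \<in> carrier A" "b \<in> carrier A"
  let ?K = "support a \<union> support b"
  have K: "finite ?K" "?K \<subseteq> I" using ab support_subset by auto
  have "support (a \<oplus> b) \<subseteq> ?K" using ab by (auto simp: support_def coord_simps)
  then have "basis_lift C s (a \<oplus> b) = (\<Oplus>\<^bsub>C\<^esub>i\<in>?K. [\<kappa> i (a \<oplus> b)] \<cdot>\<^bsub>C\<^esub> s i)"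
    by (intro basis_lift_superset K)
  also have "\<dots> = (\<Oplus>\<^bsub>C\<^esub>i\<in>?K. [\<kappa> i a] \<cdot>\<^bsub>C\<^esub> s i \<oplus>\<^bsub>C\<^esub> [\<kappa> i b] \<cdot>\<^bsub>C\<^esub> s i)"
    using K s ab by (intro C.finsum_cong') (auto simp: coord_simps C.add.int_pow_mult subset_iff support_def)
  also have "\<dots> = basis_lift C s a \<oplus>\<^bsub>C\<^esub> basis_lift C s b"
    using K s by (subst C.finsum_addf) (auto simp: basis_lift_superset[OF K(1) _ K(2)] subset_iff support_def)
  finally show "basis_lift C s (a \<oplus> b) = basis_lift C s a \<oplus>\<^bsub>C\<^esub> basis_lift C s b" .
qed

lemma basis_lift_basis:
  assumes i: "i \<in> I"
  shows "basis_lift C s (\<beta> i) = s i"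
proof -
  have "support (\<beta> i) \<subseteq> {i}" using i by (auto simp: support_def coord_basis split: if_splits)
  then have "basis_lift C s (\<beta> i) = (\<Oplus>\<^bsub>C\<^esub>j\<in>{i}. [\<kappa> j (\<beta> i)] \<cdot>\<^bsub>C\<^esub> s j)"
    using i by (intro basis_lift_superset) auto
  also have "\<dots> = s i"
    using i s by (simp add: coord_basis C.finsum_insert C.add.int_pow_1)
  finally show ?thesis .
qed

end

lemma coord_mult:
  assumes a: "a \<in> carrier A" "finite K" "support a \<subseteq> K" "K \<subseteq> I"
    and b: "b \<in> carrier A" "finite L" "support b \<subseteq> L" "L \<subseteq> I"
    and k: "k \<in> I"
  shows "\<kappa> k (a \<otimes> b) = (\<Sum>i\<in>K. \<Sum>j\<in>L. \<kappa> i a * \<kappa> j b * \<kappa> k (\<beta> i \<otimes> \<beta> j))"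
proof -
  have left: "(\<lambda>x. \<kappa> k (x \<otimes> b)) \<in> add_hom A \<Z>"
    using b(1) k by (intro int_homI) (simp add: l_distr coord_simps)
  have right: "(\<lambda>y. \<kappa> k (\<beta> i \<otimes> y)) \<in> add_hom A \<Z>" if "i \<in> I" for i
    using that k by (intro int_homI) (simp add: r_distr coord_simps)
  have "\<kappa> k (a \<otimes> b) = (\<Sum>i\<in>K. \<kappa> i a * \<kappa> k (\<beta> i \<otimes> b))"
    using hom_expansion[OF left a] .
  also have "\<dots> = (\<Sum>i\<in>K. \<kappa> i a * (\<Sum>j\<in>L. \<kappa> j b * \<kappa> k (\<beta> i \<otimes> \<beta> j)))"
    using hom_expansion[OF right b] a(4) by (intro sum.cong) auto
  finally show ?thesis by (simp add: sum_distrib_left mult.assoc)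
qed

end

text \<open>
  Duality makes a family independent.  If the family also generates the additive group, then the
  property of being the sum of its coordinates times the basis elements passes from the generators
  to sums and inverses, and so the coordinates separate.
\<close>

lemma ring_basisI_generate:
  fixes A (structure)
  assumes "ring A"
    and basis: "\<And>i. i \<in> I \<Longrightarrow> \<beta> i \<in> carrier A"
    and hom: "\<And>i. i \<in> I \<Longrightarrow> \<kappa> i \<in> add_hom A \<Z>"
    and dual: "\<And>i j. i \<in> I \<Longrightarrow> j \<in> I \<Longrightarrow> \<kappa> i (\<beta> j) = (if i = j then 1 else 0)"
    and gen: "carrier A \<subseteq> generate (add_monoid A) (\<beta> ` I)"
  shows "ring_basis A I \<beta> \<kappa>"
proof -
  interpret ring A by fact
  note simps = int_hom_zero[OF abelian_group_axioms hom] int_hom_add[OF abelian_group_axioms hom]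
    int_hom_minus[OF abelian_group_axioms hom] int_hom_pow[OF abelian_group_axioms hom]
  \<comment> \<open>\<open>e K a\<close> is the part of the expansion of \<open>a\<close> over the index set \<open>K\<close>; it is complete once \<open>K\<close> contains \<open>s a\<close>\<close>
  define s where "s a = {i \<in> I. \<kappa> i a \<noteq> 0}" for a
  define e where "e K a = (\<Oplus>i\<in>K. [\<kappa> i a] \<cdot> \<beta> i)" for K a
  have zero_pow: "[(0::int)] \<cdot> x = \<zero>" for x by (simp add: add_pow_def)
  have e_mono: "e K a = e (s a) a" if "finite K" "s a \<subseteq> K" "K \<subseteq> I" for K a
    unfolding e_def using that basis zero_pow
    by (intro add.finprod_mono_neutral_cong_right) (auto simp: s_def)
  have e_add: "e K (a \<oplus> b) = e K a \<oplus> e K b" if "a \<in> carrier A" "b \<in> carrier A" "K \<subseteq> I" for K a b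
  proof -
    have "e K (a \<oplus> b) = (\<Oplus>i\<in>K. [\<kappa> i a] \<cdot> \<beta> i \<oplus> [\<kappa> i b] \<cdot> \<beta> i)"
      unfolding e_def using that basis
      by (intro finsum_cong') (auto simp: simps add.int_pow_mult subset_iff)
    then show ?thesis
      unfolding e_def using that basis by (subst (asm) finsum_addf) auto
  qed
  have main: "a \<in> carrier A \<and> finite (s a) \<and> a = e (s a) a"
    if "a \<in> generate (add_monoid A) (\<beta> ` I)" for a
    using that
  proof (induction a rule: generate.induct)
    case one
    have "s \<zero> = {}" by (auto simp: s_def simps)
    then show ?case by (simp add: e_def)
  next
    case (incl h)
    then obtain j where j: "j \<in> I" "h = \<beta> j" by blast
    then have "s h = {j}" by (auto simp: s_def dual)
    then show ?case using j basis by (simp add: e_def dual add.int_pow_1)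
  next
    case (inv h)
    then obtain j where j: "j \<in> I" "h = \<beta> j" by blast
    have "inv\<^bsub>add_monoid A\<^esub> h = \<ominus> h" by (simp add: a_inv_def)
    moreover have "s (\<ominus> h) = {j}" using j basis by (auto simp: s_def simps dual)
    moreover have "\<ominus> h = [(-1::int)] \<cdot> h" using j basis by (simp add: add.int_pow_neg add.int_pow_1)
    ultimately show ?case using j basis by (simp add: e_def simps dual)
  next
    case (eng a b)
    let ?K = "s a \<union> s b"
    have K: "finite ?K" "?K \<subseteq> I" using eng by (auto simp: s_def)
    have ab: "a \<in> carrier A" "b \<in> carrier A" using eng by auto
    have sub: "s (a \<oplus> b) \<subseteq> ?K" using ab by (auto simp: s_def simps)
    have "a \<oplus> b = e ?K a \<oplus> e ?K b" using eng e_mono[of ?K a] e_mono[of ?K b] K by simp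
    also have "\<dots> = e (s (a \<oplus> b)) (a \<oplus> b)"
      using e_add ab K e_mono[OF K(1) sub K(2)] by simp
    finally show ?case using ab finite_subset[OF sub K(1)] by simp
  qed
  show ?thesis
  proof unfold_locales
    fix a assume a: "a \<in> carrier A"
    then have *: "finite (s a)" "a = e (s a) a" using main gen by auto
    then show "finite {i \<in> I. \<kappa> i a \<noteq> 0}" by (simp add: s_def)
    assume "\<And>i. i \<in> I \<Longrightarrow> \<kappa> i a = 0"
    then have "s a = {}" by (auto simp: s_def)
    then show "a = \<zero>" using * by (simp add: e_def)
  qed (use basis hom dual in auto)
qed

subsection \<open>The tensor powers\<close>

lemma (in ring) pure_tensor_hom:
  assumes "length us + length vs + 1 = n" "set us \<subseteq> carrier R" "set vs \<subseteq> carrier R"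
  shows "(\<lambda>y. pure_tensor R (us @ [y] @ vs)) \<in> add_hom R (TP n)"
proof (rule add_homI)
  fix a b assume "a \<in> carrier R" "b \<in> carrier R"
  then show "pure_tensor R (us @ [a \<oplus> b] @ vs) = pure_tensor R (us @ [a] @ vs)
      \<oplus>\<^bsub>TP n\<^esub> pure_tensor R (us @ [b] @ vs)"
    using multilinear_pure_tensor[of n] assms unfolding multilinear_def by blast
qed (use assms in auto)

context ring_basis
begin

definition words :: "nat \<Rightarrow> 'i list set" where
  "words n = {w. length w = n \<and> set w \<subseteq> I}"

definition word_tensor :: "'i list \<Rightarrow> ('a list \<Rightarrow>\<^sub>0 int) set" where
  "word_tensor w = pure_tensor A (map \<beta> w)"

definition word_coord :: "'i list \<Rightarrow> ('a list \<Rightarrow>\<^sub>0 int) set \<Rightarrow> int" where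
  "word_coord w = tensor_lift \<Z> (\<lambda>xs. prod_list (map2 \<kappa> w xs))"

lemma words_append:
  "w \<in> words m \<Longrightarrow> v \<in> words n \<Longrightarrow> w @ v \<in> words (m + n)"
  by (auto simp: words_def)

lemma multilinear_coord:
  assumes "w \<in> words n"
  shows "multilinear n \<Z> (\<lambda>xs. prod_list (map2 \<kappa> w xs))"
proof (rule multilinearI)
  fix us a b vs
  assume *: "length us + length vs + 1 = n" "set us \<subseteq> carrier A" "set vs \<subseteq> carrier A"
    "a \<in> carrier A" "b \<in> carrier A"
  obtain w1 i w2 where w: "w = w1 @ [i] @ w2" "length w1 = length us" "length w2 = length vs"
  proof
    show "w = take (length us) w @ [w ! length us] @ drop (Suc (length us)) w"
      using assms * by (simp add: words_def id_take_nth_drop)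
  qed (use assms * in \<open>auto simp: words_def\<close>)
  have "i \<in> I" using w assms by (auto simp: words_def)
  then show "prod_list (map2 \<kappa> w (us @ [a \<oplus> b] @ vs)) = prod_list (map2 \<kappa> w (us @ [a] @ vs))
      \<oplus>\<^bsub>\<Z>\<^esub> prod_list (map2 \<kappa> w (us @ [b] @ vs))"
    using * w by (simp add: coord_simps algebra_simps)
qed simp

lemma word_coord_hom: "w \<in> words n \<Longrightarrow> word_coord w \<in> add_hom (TP n) \<Z>"
  unfolding word_coord_def by (intro tensor_lift_hom abelian_group_int multilinear_coord)

lemma word_coord_pure:
  "w \<in> words n \<Longrightarrow> length xs = n \<Longrightarrow> set xs \<subseteq> carrier A \<Longrightarrow>
    word_coord w (pure_tensor A xs) = prod_list (map2 \<kappa> w xs)"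
  unfolding word_coord_def by (rule tensor_lift_pure[OF abelian_group_int multilinear_coord])

lemma word_tensor_closed: "w \<in> words n \<Longrightarrow> word_tensor w \<in> carrier (TP n)"
  unfolding word_tensor_def by (rule pure_tensor_closed) (auto simp: words_def)

lemma word_coord_word_tensor:
  assumes "w \<in> words n" "v \<in> words n"
  shows "word_coord w (word_tensor v) = (if w = v then 1 else 0)"
proof -
  have "word_coord w (word_tensor v) = prod_list (map2 \<kappa> w (map \<beta> v))"
    unfolding word_tensor_def using assms by (intro word_coord_pure) (auto simp: words_def)
  also have "\<dots> = (if w = v then 1 else 0)"
    using assms unfolding words_def
  proof (induction w arbitrary: v n)
    case (Cons i w)
    then obtain j v' where v: "v = j # v'" by (cases v) auto
    have "prod_list (map2 \<kappa> w (map \<beta> v')) = (if w = v' then 1 else 0)"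
      using Cons v by (intro Cons.IH[of "length w"]) auto
    then show ?case using Cons v by (auto simp: coord_basis)
  qed auto
  finally show ?thesis .
qed

text \<open>
  The factors are expanded in the basis from left to right, \<open>w\<close> being the part that is done.
\<close>

lemma pure_tensor_generated:
  assumes "length w + length ys = n" "set w \<subseteq> I" "set ys \<subseteq> carrier A"
  shows "pure_tensor A (map \<beta> w @ ys) \<in> generate (add_monoid (TP n)) (word_tensor ` words n)"
  using assms
proof (induction ys arbitrary: w)
  case Nil
  then show ?case by (auto intro!: generate.incl simp: word_tensor_def words_def)
next
  case (Cons y ys)
  let ?T = "TP n"
  let ?H = "generate (add_monoid ?T) (word_tensor ` words n)"
  interpret T: ring ?T by (rule tensor_power_is_ring)
  have sub: "subgroup ?H (add_monoid ?T)"
    using word_tensor_closed by (intro T.add.generate_is_subgroup) auto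
  interpret H: additive_subgroup ?H ?T by (rule additive_subgroup.intro) (rule sub)
  let ?h = "\<lambda>y. pure_tensor A (map \<beta> w @ [y] @ ys)"
  have h: "?h \<in> add_hom A ?T"
    using Cons by (intro pure_tensor_hom) auto
  have basis: "?h (\<beta> i) \<in> ?H" if "i \<in> I" for i
    using Cons.IH[of "w @ [i]"] Cons.prems that by simp
  have y: "y \<in> carrier A" using Cons by simp
  have "?h y = ?h (\<Oplus>i\<in>support y. [\<kappa> i y] \<cdot> \<beta> i)"
    using basis_expansion[OF y _ subset_refl support_subset] y by simp
  also have "\<dots> = (\<Oplus>\<^bsub>?T\<^esub>i\<in>support y. ?h ([\<kappa> i y] \<cdot> \<beta> i))"
    using support_subset by (intro add_hom_finsum[OF abelian_group_axioms T.is_abelian_group h]) auto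
  also have "\<dots> \<in> ?H"
  proof (rule additive_subgroup_finsum[OF T.is_abelian_group H.additive_subgroup_axioms], rule funcsetI)
    fix i assume "i \<in> support y"
    then have i: "i \<in> I" using support_subset by auto
    then have "?h ([\<kappa> i y] \<cdot> \<beta> i) = [\<kappa> i y] \<cdot>\<^bsub>?T\<^esub> ?h (\<beta> i)"
      by (intro add_hom_pow[OF abelian_group_axioms T.is_abelian_group h]) auto
    also have "\<dots> \<in> ?H"
      using T.add.subgroup_int_pow_closed[OF sub basis[OF i]] by (simp add: add_pow_def)
    finally show "?h ([\<kappa> i y] \<cdot> \<beta> i) \<in> ?H" .
  qed
  finally show ?case by simp
qed

theorem tensor_power_basis: "ring_basis (TP n) (words n) word_tensor word_coord"
proof (rule ring_basisI_generate)
  let ?T = "TP n"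
  let ?H = "generate (add_monoid ?T) (word_tensor ` words n)"
  show "ring ?T" by (rule tensor_power_is_ring)
  interpret T: ring ?T by (rule tensor_power_is_ring)
  have sub: "subgroup ?H (add_monoid ?T)"
    using word_tensor_closed by (intro T.add.generate_is_subgroup) auto
  interpret H: additive_subgroup ?H ?T by (rule additive_subgroup.intro) (rule sub)
  show "carrier ?T \<subseteq> ?H"
  proof
    fix t assume "t \<in> carrier ?T"
    then show "t \<in> ?H"
    proof (induction t rule: tensor_induct)
      case (pure xs)
      then show ?case using pure_tensor_generated[of "[]" xs n] by simp
    next
      case (diff s t)
      then show ?case unfolding a_minus_def using H.a_closed H.a_inv_closed by blast
    qed (rule H.zero_closed)
  qed
qed (use word_tensor_closed word_coord_hom word_coord_word_tensor in auto)

lemma word_coord_mult: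
  assumes "w \<in> words n" "u \<in> words n" "v \<in> words n"
  shows "word_coord w (word_tensor u \<otimes>\<^bsub>TP n\<^esub> word_tensor v)
    = prod_list (map2 \<kappa> w (map2 (\<otimes>) (map \<beta> u) (map \<beta> v)))"
proof -
  have "set (map \<beta> u) \<subseteq> carrier A" "set (map \<beta> v) \<subseteq> carrier A"
    using assms by (auto simp: words_def)
  note cl = this set_map2_mult[OF this]
  then show ?thesis
    unfolding word_tensor_def using assms
    by (subst pure_tensor_mult, auto simp: words_def) (subst word_coord_pure, auto simp: words_def)
qed

end

section \<open>Convolution inverses\<close>

text \<open>
  Used to compare the two iterated sums in \<open>conv_assoc\<close>.
\<close>

lemma (in abelian_monoid) finsum_Sigma:
  assumes "finite S" "\<And>p. p \<in> S \<Longrightarrow> finite (B p)"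
    and "\<And>p q. p \<in> S \<Longrightarrow> q \<in> B p \<Longrightarrow> f p q \<in> carrier G"
  shows "(\<Oplus>p\<in>S. \<Oplus>q\<in>B p. f p q) = (\<Oplus>x\<in>Sigma S B. f (fst x) (snd x))"
  using assms
proof (induction S rule: finite_induct)
  case (insert p S)
  have *: "(\<Oplus>x\<in>Pair p ` B p. f (fst x) (snd x)) = (\<Oplus>q\<in>B p. f p q)"
    using insert by (subst finsum_reindex) (auto simp: inj_on_def)
  have "Sigma (insert p S) B = Pair p ` B p \<union> Sigma S B" by auto
  then have "(\<Oplus>x\<in>Sigma (insert p S) B. f (fst x) (snd x))
      = (\<Oplus>x\<in>Pair p ` B p. f (fst x) (snd x)) \<oplus> (\<Oplus>x\<in>Sigma S B. f (fst x) (snd x))"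
    using insert by (simp only:) (intro finsum_Un_disjoint; auto)
  then show ?case
    using insert * by (subst finsum_insert) (auto intro!: finsum_closed)
qed simp

text \<open>
  The model is the monoid of multipartitions.  Finiteness in each size makes all decompositions finite,
  and the size allows recursion over proper summands.
\<close>

locale graded_index =
  fixes I :: "'i::comm_monoid_add set" and sz :: "'i \<Rightarrow> nat"
  assumes zero_index [simp]: "0 \<in> I"
    and add_index [simp]: "i \<in> I \<Longrightarrow> j \<in> I \<Longrightarrow> i + j \<in> I"
    and size_add [simp]: "i \<in> I \<Longrightarrow> j \<in> I \<Longrightarrow> sz (i + j) = sz i + sz j"
    and size_eq_0: "i \<in> I \<Longrightarrow> sz i = 0 \<Longrightarrow> i = 0"
    and finite_size: "finite {i \<in> I. sz i \<le> n}"
begin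

lemma size_zero [simp]: "sz 0 = 0"
  using size_add[of 0 0] by simp

definition splits :: "'i \<Rightarrow> ('i \<times> 'i) set" where
  "splits k = {(i, j). i \<in> I \<and> j \<in> I \<and> i + j = k}"

lemma splits_index: "p \<in> splits k \<Longrightarrow> fst p \<in> I" "p \<in> splits k \<Longrightarrow> snd p \<in> I"
  by (auto simp: splits_def)

lemma splitsE:
  assumes "p \<in> splits k"
  obtains i j where "p = (i, j)" "i \<in> I" "j \<in> I" "i + j = k"
  using assms by (auto simp: splits_def)

lemma finite_splits [simp]: "finite (splits k)"
proof -
  have "splits k \<subseteq> {i \<in> I. sz i \<le> sz k} \<times> {i \<in> I. sz i \<le> sz k}"
    by (auto simp: splits_def)
  then show ?thesis using finite_size finite_subset by blast
qed

lemma splits_zero: "splits 0 = {(0, 0)}"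
proof -
  have "i = 0 \<and> j = 0" if "i \<in> I" "j \<in> I" "i + j = 0" for i j
  proof -
    have "sz i + sz j = 0" using size_add[OF that(1,2)] that(3) by simp
    then show ?thesis using size_eq_0 that by simp
  qed
  then show ?thesis by (auto simp: splits_def)
qed

end

locale convolution = graded_index I sz + ring A
  for I :: "'i::comm_monoid_add set" and sz and A (structure)
begin

text \<open>
  The product of formal power series with exponents in \<open>I\<close> and coefficients in \<open>A\<close>.  For additive
  maps given by their values on a basis whose comultiplication runs over the decompositions of the
  index, it is the convolution product.
\<close>

definition conv :: "('i \<Rightarrow> 'a) \<Rightarrow> ('i \<Rightarrow> 'a) \<Rightarrow> 'i \<Rightarrow> 'a" where
  "conv f g k = (\<Oplus>p\<in>splits k. f (fst p) \<otimes> g (snd p))"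

definition conv_one :: "'i \<Rightarrow> 'a" where
  "conv_one k = (if k = 0 then \<one> else \<zero>)"

lemma conv_closed:
  "f \<in> I \<rightarrow> carrier A \<Longrightarrow> g \<in> I \<rightarrow> carrier A \<Longrightarrow> conv f g k \<in> carrier A"
  unfolding conv_def by (intro finsum_closed) (auto simp: Pi_iff elim!: splitsE)

lemma conv_cong:
  assumes "\<And>i. i \<in> I \<Longrightarrow> f i = f' i" "\<And>i. i \<in> I \<Longrightarrow> g i = g' i"
    and "f' \<in> I \<rightarrow> carrier A" "g' \<in> I \<rightarrow> carrier A"
  shows "conv f g k = conv f' g' k"
  unfolding conv_def using assms by (intro finsum_cong') (auto simp: Pi_iff elim!: splitsE)

lemma conv_one_closed: "conv_one \<in> I \<rightarrow> carrier A"
  by (auto simp: conv_one_def)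

lemma conv_one_left:
  assumes f: "f \<in> I \<rightarrow> carrier A" and k: "k \<in> I"
  shows "conv conv_one f k = f k"
proof -
  have "conv conv_one f k = (\<Oplus>p\<in>{(0, k)}. conv_one (fst p) \<otimes> f (snd p))"
    unfolding conv_def using f k
    by (intro add.finprod_mono_neutral_cong_right)
      (auto simp: conv_one_def splits_def[of k, THEN eqset_imp_iff] Pi_iff elim!: splitsE)
  also have "\<dots> = f k"
    using f k by (subst finsum_insert) (auto simp: conv_one_def Pi_iff)
  finally show ?thesis .
qed

lemma conv_one_right:
  assumes f: "f \<in> I \<rightarrow> carrier A" and k: "k \<in> I"
  shows "conv f conv_one k = f k"
proof -
  have "conv f conv_one k = (\<Oplus>p\<in>{(k, 0)}. f (fst p) \<otimes> conv_one (snd p))"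
    unfolding conv_def using f k
    by (intro add.finprod_mono_neutral_cong_right)
      (auto simp: conv_one_def splits_def[of k, THEN eqset_imp_iff] Pi_iff elim!: splitsE)
  also have "\<dots> = f k"
    using f k by (subst finsum_insert) (auto simp: conv_one_def Pi_iff)
  finally show ?thesis .
qed

text \<open>
  Both sides are the sum over the decompositions of \<open>k\<close> into three summands.
\<close>

lemma conv_assoc:
  assumes f: "f \<in> I \<rightarrow> carrier A" and g: "g \<in> I \<rightarrow> carrier A" and h: "h \<in> I \<rightarrow> carrier A"
  shows "conv (conv f g) h k = conv f (conv g h) k"
proof -
  define X where "X = {(i, j, l). i \<in> I \<and> j \<in> I \<and> l \<in> I \<and> i + j + l = k}"
  define F where "F = (\<lambda>(i, j, l). f i \<otimes> g j \<otimes> h l)"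
  have F: "F \<in> X \<rightarrow> carrier A" using f g h by (auto simp: X_def F_def)
  have closed: "\<And>i. i \<in> I \<Longrightarrow> f i \<in> carrier A" "\<And>i. i \<in> I \<Longrightarrow> g i \<in> carrier A"
    "\<And>i. i \<in> I \<Longrightarrow> h i \<in> carrier A"
    using f g h by auto
  have "conv (conv f g) h k
      = (\<Oplus>p\<in>splits k. \<Oplus>q\<in>splits (fst p). f (fst q) \<otimes> g (snd q) \<otimes> h (snd p))"
    unfolding conv_def using closed
    by (intro finsum_cong' finsum_ldistr) (auto elim!: splitsE intro!: finsum_closed)
  also have "\<dots> = (\<Oplus>x\<in>Sigma (splits k) (\<lambda>p. splits (fst p)).
      f (fst (snd x)) \<otimes> g (snd (snd x)) \<otimes> h (snd (fst x)))"
    using closed by (intro finsum_Sigma) (auto elim!: splitsE)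
  also have "Sigma (splits k) (\<lambda>p. splits (fst p)) = (\<lambda>(i, j, l). ((i + j, l), (i, j))) ` X"
    by (auto simp: X_def splits_def image_iff)
  also have "(\<Oplus>x\<in>\<dots>. f (fst (snd x)) \<otimes> g (snd (snd x)) \<otimes> h (snd (fst x))) = finsum A F X"
    using closed
    by (subst finsum_reindex) (auto simp: inj_on_def F_def X_def intro!: finsum_cong')
  finally have left: "conv (conv f g) h k = finsum A F X" .
  have "conv f (conv g h) k
      = (\<Oplus>p\<in>splits k. \<Oplus>q\<in>splits (snd p). f (fst p) \<otimes> (g (fst q) \<otimes> h (snd q)))"
    unfolding conv_def using closed
    by (intro finsum_cong' finsum_rdistr) (auto elim!: splitsE intro!: finsum_closed)
  also have "\<dots> = (\<Oplus>x\<in>Sigma (splits k) (\<lambda>p. splits (snd p)).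
      f (fst (fst x)) \<otimes> (g (fst (snd x)) \<otimes> h (snd (snd x))))"
    using closed by (intro finsum_Sigma) (auto elim!: splitsE)
  also have "Sigma (splits k) (\<lambda>p. splits (snd p)) = (\<lambda>(i, j, l). ((i, j + l), (j, l))) ` X"
    by (auto simp: X_def splits_def image_iff add.assoc)
  also have "(\<Oplus>x\<in>\<dots>. f (fst (fst x)) \<otimes> (g (fst (snd x)) \<otimes> h (snd (snd x)))) = finsum A F X"
    using closed
    by (subst finsum_reindex) (auto simp: inj_on_def F_def X_def m_assoc intro!: finsum_cong')
  finally show ?thesis using left by simp
qed

text \<open>
  The summand with \<open>j = 0\<close> in the equation for \<open>k = i + j\<close> is \<open>s k\<close> itself, and all others involve
  \<open>s i\<close> with \<open>i\<close> of smaller size.  So the equation defines \<open>s\<close> by recursion on the size.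
\<close>

lemma conv_left_inverse:
  assumes f: "f \<in> I \<rightarrow> carrier A" and f0: "f 0 = \<one>"
  obtains s where "s \<in> I \<rightarrow> carrier A" "s 0 = \<one>" "\<And>k. k \<in> I \<Longrightarrow> conv s f k = conv_one k"
proof -
  define D where "D k = splits k - {(k, 0)}" for k
  define H where "H s k = conv_one k \<ominus> (\<Oplus>p\<in>D k. s (fst p) \<otimes> f (snd p))" for s k
  define s where "s = wfrec (measure sz) H"
  have D_size: "sz (fst p) < sz k" if "p \<in> D k" "k \<in> I" for p k
  proof -
    have p: "fst p \<in> I" "snd p \<in> I" "fst p + snd p = k" "p \<noteq> (k, 0)"
      using that by (auto simp: D_def splits_def)
    then have "snd p \<noteq> 0" by (cases p) auto
    then have "sz (snd p) \<noteq> 0" using size_eq_0 p by auto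
    then show ?thesis using size_add[OF p(1,2)] p(3) by simp
  qed
  have s_eq: "s k = H (cut s (measure sz) k) k" for k
    unfolding s_def by (rule wfrec) simp
  have main: "s k \<in> carrier A \<and> s k = H s k" if "k \<in> I" for k
    using that
  proof (induction "sz k" arbitrary: k rule: less_induct)
    case less
    have IH: "s (fst p) \<in> carrier A" "f (snd p) \<in> carrier A" if "p \<in> D k" for p
    proof -
      have "fst p \<in> I" "snd p \<in> I" using that by (auto simp: D_def elim!: splitsE)
      then show "s (fst p) \<in> carrier A" "f (snd p) \<in> carrier A"
        using less.hyps[OF D_size[OF that less.prems]] f by auto
    qed
    have "(\<Oplus>p\<in>D k. cut s (measure sz) k (fst p) \<otimes> f (snd p)) = (\<Oplus>p\<in>D k. s (fst p) \<otimes> f (snd p))"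
      using IH D_size[OF _ less.prems] by (intro finsum_cong') (auto simp: cut_def)
    then have "s k = H s k" using s_eq by (simp add: H_def)
    moreover have "H s k \<in> carrier A"
      unfolding H_def using IH by (auto simp: conv_one_def intro!: finsum_closed minus_closed)
    ultimately show ?case by simp
  qed
  then have s: "s \<in> I \<rightarrow> carrier A" by blast
  have inv: "conv s f k = conv_one k" if k: "k \<in> I" for k
  proof -
    have "(k, 0) \<in> splits k" using k by (simp add: splits_def)
    then have insert: "splits k = insert (k, 0) (D k)" by (auto simp: D_def)
    have cl: "(\<lambda>p. s (fst p) \<otimes> f (snd p)) \<in> D k \<rightarrow> carrier A"
      using s f by (auto simp: D_def Pi_iff elim!: splitsE)
    have "conv s f k = s (fst (k, 0)) \<otimes> f (snd (k, 0)) \<oplus> (\<Oplus>p\<in>D k. s (fst p) \<otimes> f (snd p))"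
      unfolding conv_def insert using s f k cl
      by (subst finsum_insert) (auto simp: D_def Pi_iff)
    then have "conv s f k = s k \<otimes> f 0 \<oplus> (\<Oplus>p\<in>D k. s (fst p) \<otimes> f (snd p))" by simp
    also have "s k \<otimes> f 0 = H s k"
      using f0 r_one[OF conjunct1[OF main[OF k]]] conjunct2[OF main[OF k]] by (simp only:)
    also have "H s k \<oplus> (\<Oplus>p\<in>D k. s (fst p) \<otimes> f (snd p)) = conv_one k"
      unfolding H_def a_minus_def using finsum_closed[OF cl] funcset_mem[OF conv_one_closed k]
      by (simp only: a_assoc a_inv_closed l_neg r_zero)
    finally show ?thesis .
  qed
  have "conv s f 0 = s 0" unfolding conv_def splits_zero using s f0 by (subst finsum_insert) (auto simp: Pi_iff)
  then have "s 0 = \<one>" using inv[of 0] by (simp add: conv_one_def)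
  with s inv show ?thesis using that by blast
qed

text \<open>
  Left inverses suffice: a left inverse \<open>s\<close> has constant coefficient \<open>1\<close> again and hence a left
  inverse \<open>t\<close>, and then \<open>t = t s f = f\<close>.
\<close>

lemma conv_inverse:
  assumes f: "f \<in> I \<rightarrow> carrier A" and f0: "f 0 = \<one>"
  obtains s where "s \<in> I \<rightarrow> carrier A" "\<And>k. k \<in> I \<Longrightarrow> conv s f k = conv_one k"
    "\<And>k. k \<in> I \<Longrightarrow> conv f s k = conv_one k"
proof -
  obtain s where s: "s \<in> I \<rightarrow> carrier A" "s 0 = \<one>" "\<And>k. k \<in> I \<Longrightarrow> conv s f k = conv_one k"
    using conv_left_inverse[OF f f0] by blast
  obtain t where t: "t \<in> I \<rightarrow> carrier A" "\<And>k. k \<in> I \<Longrightarrow> conv t s k = conv_one k"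
    using conv_left_inverse[OF s(1,2)] by blast
  have "f k = t k" if k: "k \<in> I" for k
  proof -
    have "f k = conv conv_one f k" using conv_one_left f k by simp
    also have "\<dots> = conv (conv t s) f k"
      using t s f conv_closed conv_one_closed by (intro conv_cong) auto
    also have "\<dots> = conv t (conv s f) k" using t s f by (intro conv_assoc)
    also have "\<dots> = conv t conv_one k"
      using t s f conv_one_closed by (intro conv_cong) auto
    also have "\<dots> = t k" using conv_one_right t k by simp
    finally show ?thesis .
  qed
  then have "conv f s k = conv_one k" if "k \<in> I" for k
    using t s that conv_cong[of f t s s k] by auto
  then show ?thesis using that s by blast
qed

end

section \<open>The Hopf algebra of a basis indexed by a graded monoid\<close>

lemma (in ring) multilinear_2I:
  assumes closed: "\<And>x y. x \<in> carrier R \<Longrightarrow> y \<in> carrier R \<Longrightarrow> F x y \<in> carrier C"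
    and left: "\<And>x x' y. x \<in> carrier R \<Longrightarrow> x' \<in> carrier R \<Longrightarrow> y \<in> carrier R
      \<Longrightarrow> F (x \<oplus> x') y = F x y \<oplus>\<^bsub>C\<^esub> F x' y"
    and right: "\<And>x y y'. x \<in> carrier R \<Longrightarrow> y \<in> carrier R \<Longrightarrow> y' \<in> carrier R
      \<Longrightarrow> F x (y \<oplus> y') = F x y \<oplus>\<^bsub>C\<^esub> F x y'"
  shows "multilinear 2 C (\<lambda>xs. F (xs ! 0) (xs ! 1))"
proof (rule multilinearI)
  fix xs :: "'a list" assume "length xs = 2" "set xs \<subseteq> carrier R"
  then show "F (xs ! 0) (xs ! 1) \<in> carrier C"
    by (intro closed) (auto simp: subset_iff)
next
  fix us a b vs
  assume *: "length us + length vs + 1 = 2" "set us \<subseteq> carrier R" "set vs \<subseteq> carrier R"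
    "a \<in> carrier R" "b \<in> carrier R"
  then consider c where "us = []" "vs = [c]" | c where "us = [c]" "vs = []"
    by (cases us; cases vs) auto
  then show "F ((us @ [a \<oplus> b] @ vs) ! 0) ((us @ [a \<oplus> b] @ vs) ! 1) =
      F ((us @ [a] @ vs) ! 0) ((us @ [a] @ vs) ! 1) \<oplus>\<^bsub>C\<^esub> F ((us @ [b] @ vs) ! 0) ((us @ [b] @ vs) ! 1)"
    by cases (use * left right in auto)
qed

lemma length_2E: "length xs = 2 \<Longrightarrow> (\<And>x y. xs = [x, y] \<Longrightarrow> P) \<Longrightarrow> P"
  by (auto simp: length_Suc_conv numeral_2_eq_2)

lemma length_3E: "length xs = 3 \<Longrightarrow> (\<And>x y z. xs = [x, y, z] \<Longrightarrow> P) \<Longrightarrow> P"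
  by (auto simp: length_Suc_conv numeral_3_eq_3)

text \<open>
  The assumption \<open>coord_add_mult\<close> says that the bilinear forms giving the coordinates of a product
  are multiplicative in the index: the form for \<open>i + j\<close> is obtained from the forms for \<open>i\<close> and \<open>j\<close>
  by multiplying their coefficients and adding the indices of the coordinates.  It is the dual
  formulation of the comultiplication being multiplicative.  The forms are kept as finite sums with
  unspecified coefficients because the coefficients found later are indexed by words.
\<close>

locale graded_monoid_basis = ring_basis A I \<beta> \<kappa> + graded_index I sz
  for A (structure) and I :: "'i::comm_monoid_add set" and \<beta> \<kappa> sz +
  assumes basis_zero: "\<beta> 0 = \<one>"
    and coord_zero_mult: "a \<in> carrier A \<Longrightarrow> b \<in> carrier A \<Longrightarrow> \<kappa> 0 (a \<otimes> b) = \<kappa> 0 a * \<kappa> 0 b"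
    and coord_add_mult: "i \<in> I \<Longrightarrow> j \<in> I \<Longrightarrow>
      \<exists>U V c d. finite U \<and> finite V \<and> U \<subseteq> I \<times> I \<and> V \<subseteq> I \<times> I \<and> (\<forall>a\<in>carrier A. \<forall>b\<in>carrier A.
        \<kappa> i (a \<otimes> b) = (\<Sum>u\<in>U. c u * (\<kappa> (fst u) a * \<kappa> (snd u) b)) \<and>
        \<kappa> j (a \<otimes> b) = (\<Sum>v\<in>V. d v * (\<kappa> (fst v) a * \<kappa> (snd v) b)) \<and>
        \<kappa> (i + j) (a \<otimes> b) = (\<Sum>u\<in>U. \<Sum>v\<in>V. c u * d v * (\<kappa> (fst u + fst v) a * \<kappa> (snd u + snd v) b)))"
begin

abbreviation "T2 \<equiv> tensor_power A 2"
abbreviation "T3 \<equiv> tensor_power A 3"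

sublocale T2: ring_basis T2 "words 2" word_tensor word_coord by (rule tensor_power_basis)
sublocale T3: ring_basis T3 "words 3" word_tensor word_coord by (rule tensor_power_basis)

lemma words_2 [simp]: "i \<in> I \<Longrightarrow> j \<in> I \<Longrightarrow> [i, j] \<in> words 2"
  by (simp add: words_def)

lemma words_3 [simp]: "i \<in> I \<Longrightarrow> j \<in> I \<Longrightarrow> k \<in> I \<Longrightarrow> [i, j, k] \<in> words 3"
  by (simp add: words_def)

lemma T2_eqI:
  assumes "s \<in> carrier T2" "t \<in> carrier T2"
    and "\<And>i j. i \<in> I \<Longrightarrow> j \<in> I \<Longrightarrow> word_coord [i, j] s = word_coord [i, j] t"
  shows "s = t"
  by (rule T2.coord_eqI[OF assms(1,2)]) (use assms(3) in \<open>auto simp: words_def elim!: length_2E\<close>)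

lemma T3_eqI:
  assumes "s \<in> carrier T3" "t \<in> carrier T3"
    and "\<And>i j k. i \<in> I \<Longrightarrow> j \<in> I \<Longrightarrow> k \<in> I \<Longrightarrow> word_coord [i, j, k] s = word_coord [i, j, k] t"
  shows "s = t"
  by (rule T3.coord_eqI[OF assms(1,2)]) (use assms(3) in \<open>auto simp: words_def elim!: length_3E\<close>)

definition comult_basis :: "'i \<Rightarrow> ('a list \<Rightarrow>\<^sub>0 int) set" where
  "comult_basis k = (\<Oplus>\<^bsub>T2\<^esub>p\<in>splits k. word_tensor [fst p, snd p])"

definition comult :: "'a \<Rightarrow> ('a list \<Rightarrow>\<^sub>0 int) set" where
  "comult = basis_lift T2 comult_basis"

lemma comult_basis_closed: "comult_basis k \<in> carrier T2"
  unfolding comult_basis_def by (intro T2.finsum_closed) (auto elim!: splitsE)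

lemma comult_hom: "comult \<in> add_hom A T2"
  unfolding comult_def by (rule basis_lift_hom[OF T2.abelian_group_axioms comult_basis_closed])

lemma comult_closed [simp]: "a \<in> carrier A \<Longrightarrow> comult a \<in> carrier T2"
  using add_hom_closed[OF comult_hom] .

lemma comult_basis: "k \<in> I \<Longrightarrow> comult (\<beta> k) = comult_basis k"
  unfolding comult_def by (rule basis_lift_basis[OF T2.abelian_group_axioms comult_basis_closed])

text \<open>
  This determines \<^term>\<open>comult\<close>, and all further properties are read off from it.
\<close>

lemma coord_comult:
  assumes "i \<in> I" "j \<in> I" "a \<in> carrier A"
  shows "word_coord [i, j] (comult a) = \<kappa> (i + j) a"
proof (rule hom_eqI_basis[OF abelian_group_int _ _ _ assms(3)])
  show "(\<lambda>a. word_coord [i, j] (comult a)) \<in> add_hom A \<Z>"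
    using assms by (intro add_hom_compose[OF comult_hom word_coord_hom]) simp
  show "\<kappa> (i + j) \<in> add_hom A \<Z>" using assms by (intro coord_hom) simp
  fix k assume k: "k \<in> I"
  have "word_coord [i, j] (comult (\<beta> k)) = (\<Sum>p\<in>splits k. word_coord [i, j] (word_tensor [fst p, snd p]))"
    unfolding comult_basis[OF k] comult_basis_def using assms
    by (intro T2.coord_simps) (auto elim!: splitsE)
  also have "\<dots> = (\<Sum>p\<in>splits k. if p = (i, j) then 1 else 0)"
    using assms by (intro sum.cong) (auto simp: T2.coord_basis elim!: splitsE)
  also have "\<dots> = (if (i, j) \<in> splits k then 1 else 0)" by simp
  also have "\<dots> = \<kappa> (i + j) (\<beta> k)"
    using assms k by (auto simp: coord_basis splits_def)
  finally show "word_coord [i, j] (comult (\<beta> k)) = \<kappa> (i + j) (\<beta> k)" .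
qed

lemma coord_pure_2:
  "i \<in> I \<Longrightarrow> j \<in> I \<Longrightarrow> x \<in> carrier A \<Longrightarrow> y \<in> carrier A \<Longrightarrow>
    word_coord [i, j] (pure_tensor A [x, y]) = \<kappa> i x * \<kappa> j y"
  by (subst word_coord_pure[of _ 2]) auto

lemma coord_pure_3:
  "i \<in> I \<Longrightarrow> j \<in> I \<Longrightarrow> k \<in> I \<Longrightarrow> x \<in> carrier A \<Longrightarrow> y \<in> carrier A \<Longrightarrow> z \<in> carrier A \<Longrightarrow>
    word_coord [i, j, k] (pure_tensor A [x, y, z]) = \<kappa> i x * \<kappa> j y * \<kappa> k z"
  by (subst word_coord_pure[of _ 3]) auto

text \<open>
  In the coordinates of \<open>A \<otimes> A\<close>, the product of two tensors is given by the form \<open>B\<close> built from the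
  coefficients of the forms for \<open>i\<close> and \<open>j\<close>: both sides are biadditive and agree on pure tensors.
  At \<open>comult a\<close> and \<open>comult b\<close> this form is the one for \<open>i + j\<close>, evaluated at \<open>a\<close> and \<open>b\<close>.
\<close>

lemma comult_mult:
  assumes a: "a \<in> carrier A" and b: "b \<in> carrier A"
  shows "comult (a \<otimes> b) = comult a \<otimes>\<^bsub>T2\<^esub> comult b"
proof (rule T2_eqI)
  fix i j assume ij: "i \<in> I" "j \<in> I"
  obtain U V c d where UV: "finite U" "finite V" "U \<subseteq> I \<times> I" "V \<subseteq> I \<times> I"
    and eq: "\<forall>a\<in>carrier A. \<forall>b\<in>carrier A.
        \<kappa> i (a \<otimes> b) = (\<Sum>u\<in>U. c u * (\<kappa> (fst u) a * \<kappa> (snd u) b)) \<and>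
        \<kappa> j (a \<otimes> b) = (\<Sum>v\<in>V. d v * (\<kappa> (fst v) a * \<kappa> (snd v) b)) \<and>
        \<kappa> (i + j) (a \<otimes> b) = (\<Sum>u\<in>U. \<Sum>v\<in>V. c u * d v * (\<kappa> (fst u + fst v) a * \<kappa> (snd u + snd v) b))"
    using coord_add_mult[OF ij] by (elim exE conjE) (rule that)
  define B where "B s t = (\<Sum>u\<in>U. \<Sum>v\<in>V. c u * d v *
      (word_coord [fst u, fst v] s * word_coord [snd u, snd v] t))" for s t
  have UVI: "u \<in> U \<Longrightarrow> fst u \<in> I" "u \<in> U \<Longrightarrow> snd u \<in> I"
    "v \<in> V \<Longrightarrow> fst v \<in> I" "v \<in> V \<Longrightarrow> snd v \<in> I" for u v
    using UV by (auto simp: mem_Times_iff)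
  have pure: "word_coord [i, j] (pure_tensor A xs \<otimes>\<^bsub>T2\<^esub> pure_tensor A ys)
      = B (pure_tensor A xs) (pure_tensor A ys)"
    if xs: "length xs = 2" "set xs \<subseteq> carrier A" and ys: "length ys = 2" "set ys \<subseteq> carrier A" for xs ys
  proof -
    obtain x x' y y' where xy: "xs = [x, x']" "ys = [y, y']"
      using xs(1) ys(1) by (auto elim!: length_2E)
    then have cl: "x \<in> carrier A" "x' \<in> carrier A" "y \<in> carrier A" "y' \<in> carrier A" using xs ys by auto
    have "word_coord [i, j] (pure_tensor A xs \<otimes>\<^bsub>T2\<^esub> pure_tensor A ys) = \<kappa> i (x \<otimes> y) * \<kappa> j (x' \<otimes> y')"
      using xs ys ij cl by (subst pure_tensor_mult) (auto simp: xy coord_pure_2)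
    also have "\<dots> = (\<Sum>u\<in>U. c u * (\<kappa> (fst u) x * \<kappa> (snd u) y)) * (\<Sum>v\<in>V. d v * (\<kappa> (fst v) x' * \<kappa> (snd v) y'))"
      using eq cl by simp
    also have "\<dots> = B (pure_tensor A xs) (pure_tensor A ys)"
      unfolding sum_product B_def xy using cl UVI
      by (intro sum.cong refl) (simp add: coord_pure_2 mult_ac)
    finally show ?thesis .
  qed
  have half: "word_coord [i, j] (pure_tensor A xs \<otimes>\<^bsub>T2\<^esub> t) = B (pure_tensor A xs) t"
    if xs: "length xs = 2" "set xs \<subseteq> carrier A" and t: "t \<in> carrier T2" for xs t
  proof (rule tensor_hom_eqI[OF abelian_group_int _ _ _ t])
    show "(\<lambda>t. word_coord [i, j] (pure_tensor A xs \<otimes>\<^bsub>T2\<^esub> t)) \<in> add_hom T2 \<Z>"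
      using xs ij by (intro int_homI) (simp add: T2.r_distr T2.coord_simps)
    show "B (pure_tensor A xs) \<in> add_hom T2 \<Z>"
      unfolding B_def using UVI
      by (intro int_homI, unfold sum.distrib[symmetric], intro sum.cong refl)
        (simp add: T2.coord_simps distrib_left distrib_right)
  qed (use xs pure in auto)
  have full: "word_coord [i, j] (s \<otimes>\<^bsub>T2\<^esub> t) = B s t" if s: "s \<in> carrier T2" and t: "t \<in> carrier T2" for s t
  proof (rule tensor_hom_eqI[OF abelian_group_int _ _ _ s])
    show "(\<lambda>s. word_coord [i, j] (s \<otimes>\<^bsub>T2\<^esub> t)) \<in> add_hom T2 \<Z>"
      using t ij by (intro int_homI) (simp add: T2.l_distr T2.coord_simps)
    show "(\<lambda>s. B s t) \<in> add_hom T2 \<Z>"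
      unfolding B_def using UVI
      by (intro int_homI, unfold sum.distrib[symmetric], intro sum.cong refl)
        (simp add: T2.coord_simps distrib_left distrib_right)
  qed (use t half in auto)
  have "word_coord [i, j] (comult (a \<otimes> b)) = \<kappa> (i + j) (a \<otimes> b)"
    using a b ij by (simp add: coord_comult)
  also have "\<dots> = B (comult a) (comult b)"
    unfolding B_def using eq[rule_format, OF a b] a b UVI by (simp add: coord_comult)
  finally show "word_coord [i, j] (comult (a \<otimes> b)) = word_coord [i, j] (comult a \<otimes>\<^bsub>T2\<^esub> comult b)"
    using full a b by simp
qed (use a b in auto)

lemma comult_ring_hom: "comult \<in> ring_hom A T2"
proof (rule ring_hom_memI)
  have "comult \<one> = comult_basis 0" using comult_basis[of 0] basis_zero by simp
  also have "\<dots> = word_tensor [0, 0]"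
    unfolding comult_basis_def splits_zero by (simp add: T2.finsum_insert)
  also have "\<dots> = \<one>\<^bsub>T2\<^esub>"
    by (simp add: word_tensor_def basis_zero one_tensor_power numeral_2_eq_2)
  finally show "comult \<one> = \<one>\<^bsub>T2\<^esub>" .
qed (use comult_mult add_hom_add[OF comult_hom] in auto)

lemma multilinear_append:
  assumes b: "b \<in> carrier A"
  shows "multilinear 2 T3 (\<lambda>ys. pure_tensor A (ys @ [b]))"
    and "multilinear 2 T3 (\<lambda>ys. pure_tensor A ([b] @ ys))"
proof -
  show "multilinear 2 T3 (\<lambda>ys. pure_tensor A (ys @ [b]))"
  proof (rule multilinearI)
    fix us x y vs
    assume "length us + length vs + 1 = 2" "set us \<subseteq> carrier A" "set vs \<subseteq> carrier A"
      "x \<in> carrier A" "y \<in> carrier A"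
    then show "pure_tensor A ((us @ [x \<oplus> y] @ vs) @ [b])
      = pure_tensor A ((us @ [x] @ vs) @ [b]) \<oplus>\<^bsub>T3\<^esub> pure_tensor A ((us @ [y] @ vs) @ [b])"
      using add_hom_add[OF pure_tensor_hom[of us "vs @ [b]" 3], of x y] b by simp
  qed (use b in auto)
  show "multilinear 2 T3 (\<lambda>ys. pure_tensor A ([b] @ ys))"
  proof (rule multilinearI)
    fix us x y vs
    assume "length us + length vs + 1 = 2" "set us \<subseteq> carrier A" "set vs \<subseteq> carrier A"
      "x \<in> carrier A" "y \<in> carrier A"
    then show "pure_tensor A ([b] @ (us @ [x \<oplus> y] @ vs))
      = pure_tensor A ([b] @ (us @ [x] @ vs)) \<oplus>\<^bsub>T3\<^esub> pure_tensor A ([b] @ (us @ [y] @ vs))"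
      using add_hom_add[OF pure_tensor_hom[of "b # us" "vs" 3], of x y] b by simp
  qed (use b in auto)
qed

lemmas lift_right_hom = tensor_lift_hom[OF T3.abelian_group_axioms multilinear_append(1)]
lemmas lift_left_hom = tensor_lift_hom[OF T3.abelian_group_axioms multilinear_append(2)]

lemma lift_closed [simp]:
  "b \<in> carrier A \<Longrightarrow> t \<in> carrier T2 \<Longrightarrow> tensor_lift T3 (\<lambda>ys. pure_tensor A (ys @ [b])) t \<in> carrier T3"
  "b \<in> carrier A \<Longrightarrow> t \<in> carrier T2 \<Longrightarrow> tensor_lift T3 (\<lambda>ys. pure_tensor A (b # ys)) t \<in> carrier T3"
  using add_hom_closed[OF lift_right_hom] add_hom_closed[OF lift_left_hom] by auto

text \<open>
  Lifting \<open>ys \<mapsto> ys @ [b]\<close> amounts to tensoring with \<open>b\<close>, so coordinates multiply.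
\<close>

lemma coord_lift_right:
  assumes "i \<in> I" "j \<in> I" "k \<in> I" "b \<in> carrier A" "t \<in> carrier T2"
  shows "word_coord [i, j, k] (tensor_lift T3 (\<lambda>ys. pure_tensor A (ys @ [b])) t) = word_coord [i, j] t * \<kappa> k b"
proof (rule tensor_hom_eqI[OF abelian_group_int _ _ _ assms(5)])
  show "(\<lambda>t. word_coord [i, j, k] (tensor_lift T3 (\<lambda>ys. pure_tensor A (ys @ [b])) t)) \<in> add_hom T2 \<Z>"
    using assms by (intro add_hom_compose[OF lift_right_hom word_coord_hom]) auto
  show "(\<lambda>t. word_coord [i, j] t * \<kappa> k b) \<in> add_hom T2 \<Z>"
    using assms by (intro int_homI) (simp add: T2.coord_simps distrib_right)
  fix xs assume "length xs = 2" "set xs \<subseteq> carrier A"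
  then show "word_coord [i, j, k] (tensor_lift T3 (\<lambda>ys. pure_tensor A (ys @ [b])) (pure_tensor A xs))
      = word_coord [i, j] (pure_tensor A xs) * \<kappa> k b"
    using assms tensor_lift_pure[OF T3.abelian_group_axioms multilinear_append(1)]
    by (auto simp: coord_pure_2 coord_pure_3 elim!: length_2E)
qed

lemma coord_lift_left:
  assumes "i \<in> I" "j \<in> I" "k \<in> I" "b \<in> carrier A" "t \<in> carrier T2"
  shows "word_coord [i, j, k] (tensor_lift T3 (\<lambda>ys. pure_tensor A ([b] @ ys)) t) = \<kappa> i b * word_coord [j, k] t"
proof (rule tensor_hom_eqI[OF abelian_group_int _ _ _ assms(5)])
  show "(\<lambda>t. word_coord [i, j, k] (tensor_lift T3 (\<lambda>ys. pure_tensor A ([b] @ ys)) t)) \<in> add_hom T2 \<Z>"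
    using assms by (intro add_hom_compose[OF lift_left_hom word_coord_hom]) auto
  show "(\<lambda>t. \<kappa> i b * word_coord [j, k] t) \<in> add_hom T2 \<Z>"
    using assms by (intro int_homI) (simp add: T2.coord_simps distrib_left)
  fix xs assume "length xs = 2" "set xs \<subseteq> carrier A"
  then show "word_coord [i, j, k] (tensor_lift T3 (\<lambda>ys. pure_tensor A ([b] @ ys)) (pure_tensor A xs))
      = \<kappa> i b * word_coord [j, k] (pure_tensor A xs)"
    using assms tensor_lift_pure[OF T3.abelian_group_axioms multilinear_append(2)]
    by (auto simp: coord_pure_2 coord_pure_3 elim!: length_2E)
qed

text \<open>
  The coordinate at \<open>(i, j, k)\<close> is the coordinate of \<open>a\<close> at \<open>(i + j) + k\<close> on the left and at
  \<open>i + (j + k)\<close> on the right.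
\<close>

lemma coassociative:
  assumes a: "a \<in> carrier A"
  shows "tensor_lift T3
        (\<lambda>xs. tensor_lift T3 (\<lambda>ys. pure_tensor A (ys @ [xs ! 1])) (comult (xs ! 0))) (comult a) =
      tensor_lift T3
        (\<lambda>xs. tensor_lift T3 (\<lambda>ys. pure_tensor A ([xs ! 0] @ ys)) (comult (xs ! 1))) (comult a)"
    (is "tensor_lift T3 ?l _ = tensor_lift T3 ?r _")
proof -
  have l: "multilinear 2 T3 ?l"
  proof (rule multilinear_2I)
    fix x y assume xy: "x \<in> carrier A" "y \<in> carrier A"
    show "tensor_lift T3 (\<lambda>ys. pure_tensor A (ys @ [y])) (comult x) \<in> carrier T3"
      using xy add_hom_closed[OF lift_right_hom] by simp
    fix z assume z: "z \<in> carrier A"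
    show "tensor_lift T3 (\<lambda>ys. pure_tensor A (ys @ [z])) (comult (x \<oplus> y)) =
        tensor_lift T3 (\<lambda>ys. pure_tensor A (ys @ [z])) (comult x) \<oplus>\<^bsub>T3\<^esub>
        tensor_lift T3 (\<lambda>ys. pure_tensor A (ys @ [z])) (comult y)"
      using xy z by (simp add: add_hom_add[OF comult_hom] add_hom_add[OF lift_right_hom])
    show "tensor_lift T3 (\<lambda>ys. pure_tensor A (ys @ [y \<oplus> z])) (comult x) =
        tensor_lift T3 (\<lambda>ys. pure_tensor A (ys @ [y])) (comult x) \<oplus>\<^bsub>T3\<^esub>
        tensor_lift T3 (\<lambda>ys. pure_tensor A (ys @ [z])) (comult x)"
      using xy z
      by (intro T3_eqI) (auto simp: T3.coord_simps coord_lift_right coord_simps distrib_left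
          intro!: add_hom_closed[OF lift_right_hom])
  qed
  have r: "multilinear 2 T3 ?r"
  proof (rule multilinear_2I)
    fix x y assume xy: "x \<in> carrier A" "y \<in> carrier A"
    show "tensor_lift T3 (\<lambda>ys. pure_tensor A ([x] @ ys)) (comult y) \<in> carrier T3"
      using xy by (intro add_hom_closed[OF lift_left_hom]) auto
    fix z assume z: "z \<in> carrier A"
    show "tensor_lift T3 (\<lambda>ys. pure_tensor A ([x] @ ys)) (comult (y \<oplus> z)) =
        tensor_lift T3 (\<lambda>ys. pure_tensor A ([x] @ ys)) (comult y) \<oplus>\<^bsub>T3\<^esub>
        tensor_lift T3 (\<lambda>ys. pure_tensor A ([x] @ ys)) (comult z)"
      using xy z by (subst add_hom_add[OF comult_hom], simp_all only:)
        (rule add_hom_add[OF lift_left_hom]; simp)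
    show "tensor_lift T3 (\<lambda>ys. pure_tensor A ([x \<oplus> y] @ ys)) (comult z) =
        tensor_lift T3 (\<lambda>ys. pure_tensor A ([x] @ ys)) (comult z) \<oplus>\<^bsub>T3\<^esub>
        tensor_lift T3 (\<lambda>ys. pure_tensor A ([y] @ ys)) (comult z)"
      using xy z add_hom_closed[OF lift_left_hom]
      by (intro T3_eqI) (auto simp: T3.coord_simps coord_lift_left[simplified] coord_simps distrib_right
          intro!: add_hom_closed[OF lift_left_hom, simplified])
  qed
  note lhom = tensor_lift_hom[OF T3.abelian_group_axioms l]
  note rhom = tensor_lift_hom[OF T3.abelian_group_axioms r]
  show ?thesis
  proof (rule T3_eqI)
    fix i j k assume ijk: "i \<in> I" "j \<in> I" "k \<in> I"
    have "word_coord [i, j, k] (tensor_lift T3 ?l (comult a)) = word_coord [i + j, k] (comult a)"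
    proof (rule tensor_hom_eqI[OF abelian_group_int _ _ _ comult_closed[OF a]])
      show "(\<lambda>t. word_coord [i, j, k] (tensor_lift T3 ?l t)) \<in> add_hom T2 \<Z>"
        using ijk by (intro add_hom_compose[OF lhom word_coord_hom]) auto
      show "word_coord [i + j, k] \<in> add_hom T2 \<Z>"
        using ijk by (intro word_coord_hom) auto
      fix xs assume xs: "length xs = 2" "set xs \<subseteq> carrier A"
      then show "word_coord [i, j, k] (tensor_lift T3 ?l (pure_tensor A xs)) = word_coord [i + j, k] (pure_tensor A xs)"
        using ijk tensor_lift_pure[OF T3.abelian_group_axioms l xs]
        by (auto simp: coord_pure_2 coord_lift_right coord_comult elim!: length_2E)
    qed
    moreover have "word_coord [i, j, k] (tensor_lift T3 ?r (comult a)) = word_coord [i, j + k] (comult a)"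
    proof (rule tensor_hom_eqI[OF abelian_group_int _ _ _ comult_closed[OF a]])
      show "(\<lambda>t. word_coord [i, j, k] (tensor_lift T3 ?r t)) \<in> add_hom T2 \<Z>"
        using ijk by (intro add_hom_compose[OF rhom word_coord_hom]) auto
      show "word_coord [i, j + k] \<in> add_hom T2 \<Z>"
        using ijk by (intro word_coord_hom) auto
      fix xs assume xs: "length xs = 2" "set xs \<subseteq> carrier A"
      then show "word_coord [i, j, k] (tensor_lift T3 ?r (pure_tensor A xs)) = word_coord [i, j + k] (pure_tensor A xs)"
        using ijk tensor_lift_pure[OF T3.abelian_group_axioms r xs]
        by (auto simp: coord_pure_2 coord_lift_left[simplified] coord_comult elim!: length_2E)
    qed
    ultimately show "word_coord [i, j, k] (tensor_lift T3 ?l (comult a))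
        = word_coord [i, j, k] (tensor_lift T3 ?r (comult a))"
      using ijk a by (simp add: coord_comult add.assoc)
  qed (use a add_hom_closed[OF lhom] add_hom_closed[OF rhom] in auto)
qed

text \<open>
  The two counit laws are the instances in which one of \<open>f\<close> and \<open>g\<close> is constantly \<open>0\<close>.
\<close>

lemma lift_comult_eq_self:
  assumes \<phi>: "multilinear 2 A \<phi>" and a: "a \<in> carrier A"
    and fg: "\<And>k. k \<in> I \<Longrightarrow> f k \<in> I \<and> g k \<in> I \<and> f k + g k = k"
    and coord: "\<And>k x y. k \<in> I \<Longrightarrow> x \<in> carrier A \<Longrightarrow> y \<in> carrier A \<Longrightarrow>
      \<kappa> k (\<phi> [x, y]) = \<kappa> (f k) x * \<kappa> (g k) y"
  shows "tensor_lift A \<phi> (comult a) = a"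
proof (rule coord_eqI)
  note hom = tensor_lift_hom[OF abelian_group_axioms \<phi>]
  show "tensor_lift A \<phi> (comult a) \<in> carrier A" using add_hom_closed[OF hom] a by simp
  fix k assume k: "k \<in> I"
  have "\<kappa> k (tensor_lift A \<phi> (comult a)) = word_coord [f k, g k] (comult a)"
  proof (rule tensor_hom_eqI[OF abelian_group_int _ _ _ comult_closed[OF a]])
    show "(\<lambda>t. \<kappa> k (tensor_lift A \<phi> t)) \<in> add_hom T2 \<Z>"
      using k by (intro add_hom_compose[OF hom coord_hom])
    show "word_coord [f k, g k] \<in> add_hom T2 \<Z>" using fg[OF k] by (intro word_coord_hom) auto
    fix xs assume xs: "length xs = 2" "set xs \<subseteq> carrier A"
    then show "\<kappa> k (tensor_lift A \<phi> (pure_tensor A xs)) = word_coord [f k, g k] (pure_tensor A xs)"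
      using k fg[OF k] tensor_lift_pure[OF abelian_group_axioms \<phi> xs]
      by (auto simp: coord_pure_2 coord elim!: length_2E)
  qed
  then show "\<kappa> k (tensor_lift A \<phi> (comult a)) = \<kappa> k a" using fg[OF k] a by (simp add: coord_comult)
qed (rule a)

lemma counit_laws:
  assumes a: "a \<in> carrier A"
  shows "tensor_lift A (\<lambda>xs. [\<kappa> 0 (xs ! 0)] \<cdot> (xs ! 1)) (comult a) = a"
    and "tensor_lift A (\<lambda>xs. [\<kappa> 0 (xs ! 1)] \<cdot> (xs ! 0)) (comult a) = a"
proof -
  have "multilinear 2 A (\<lambda>xs. [\<kappa> 0 (xs ! 0)] \<cdot> (xs ! 1))"
    by (rule multilinear_2I) (auto simp: coord_simps add.int_pow_mult add.int_pow_distrib)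
  then show "tensor_lift A (\<lambda>xs. [\<kappa> 0 (xs ! 0)] \<cdot> (xs ! 1)) (comult a) = a"
    by (rule lift_comult_eq_self[OF _ a, where f = "\<lambda>_. 0" and g = "\<lambda>k. k"]) (auto simp: coord_simps)
  have "multilinear 2 A (\<lambda>xs. [\<kappa> 0 (xs ! 1)] \<cdot> (xs ! 0))"
    by (rule multilinear_2I) (auto simp: coord_simps add.int_pow_mult add.int_pow_distrib)
  then show "tensor_lift A (\<lambda>xs. [\<kappa> 0 (xs ! 1)] \<cdot> (xs ! 0)) (comult a) = a"
    by (rule lift_comult_eq_self[OF _ a, where f = "\<lambda>k. k" and g = "\<lambda>_. 0"]) (auto simp: coord_simps)
qed

lemma counit_ring_hom: "\<kappa> 0 \<in> ring_hom A \<Z>"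
proof (rule ring_hom_memI)
  show "\<kappa> 0 \<one> = \<one>\<^bsub>\<Z>\<^esub>" using coord_basis[of 0 0] basis_zero by simp
qed (auto simp: coord_zero_mult coord_simps)

sublocale convolution I sz A ..

text \<open>
  On the basis, the antipode laws say that the values of the antipode form a two-sided inverse of the
  power series with coefficients \<open>\<beta>\<close>.
\<close>

lemma antipode_exists:
  "\<exists>S. S \<in> add_hom A A \<and> (\<forall>a\<in>carrier A.
    tensor_lift A (\<lambda>xs. S (xs ! 0) \<otimes> (xs ! 1)) (comult a) = [\<kappa> 0 a] \<cdot> \<one> \<and>
    tensor_lift A (\<lambda>xs. (xs ! 0) \<otimes> S (xs ! 1)) (comult a) = [\<kappa> 0 a] \<cdot> \<one>)"
proof -
  have \<beta>: "\<beta> \<in> I \<rightarrow> carrier A" by auto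
  obtain s where s: "s \<in> I \<rightarrow> carrier A" "\<And>k. k \<in> I \<Longrightarrow> conv s \<beta> k = conv_one k"
    "\<And>k. k \<in> I \<Longrightarrow> conv \<beta> s k = conv_one k"
    using conv_inverse[OF \<beta> basis_zero] by blast
  define S where "S = basis_lift A s"
  have S: "S \<in> add_hom A A"
    unfolding S_def using s by (intro basis_lift_hom abelian_group_axioms) auto
  have S_basis: "S (\<beta> i) = s i" if "i \<in> I" for i
    unfolding S_def using s that by (intro basis_lift_basis abelian_group_axioms) auto
  have S_closed: "S x \<in> carrier A" if "x \<in> carrier A" for x
    using add_hom_closed[OF S that] .
  have unit: "(\<lambda>a. [\<kappa> 0 a] \<cdot> \<one>) \<in> add_hom A A"
    by (rule add_homI) (auto simp: coord_simps add.int_pow_mult)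
  have unit_basis: "[\<kappa> 0 (\<beta> k)] \<cdot> \<one> = conv_one k" if "k \<in> I" for k
    using that by (auto simp: coord_basis conv_one_def add.int_pow_1) (simp add: add_pow_def)
  have main: "tensor_lift A \<phi> (comult a) = [\<kappa> 0 a] \<cdot> \<one>"
    if \<phi>: "multilinear 2 A \<phi>" and conv: "\<And>k. k \<in> I \<Longrightarrow> (\<Oplus>p\<in>splits k. \<phi> [\<beta> (fst p), \<beta> (snd p)]) = conv_one k"
      and a: "a \<in> carrier A" for \<phi> a
  proof (rule hom_eqI_basis[OF abelian_group_axioms _ unit _ a])
    note hom = tensor_lift_hom[OF abelian_group_axioms \<phi>]
    show "(\<lambda>a. tensor_lift A \<phi> (comult a)) \<in> add_hom A A"
      by (rule add_hom_compose[OF comult_hom hom])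
    fix k assume k: "k \<in> I"
    have \<phi>_closed: "\<phi> [\<beta> (fst p), \<beta> (snd p)] \<in> carrier A" if "p \<in> splits k" for p
      using \<phi> splits_index[OF that] unfolding multilinear_def by auto
    have "tensor_lift A \<phi> (comult (\<beta> k)) = (\<Oplus>p\<in>splits k. tensor_lift A \<phi> (word_tensor [fst p, snd p]))"
      unfolding comult_basis[OF k] comult_basis_def
      by (intro add_hom_finsum[OF T2.abelian_group_axioms abelian_group_axioms hom]) (auto elim!: splitsE)
    also have "\<dots> = (\<Oplus>p\<in>splits k. \<phi> [\<beta> (fst p), \<beta> (snd p)])"
      using \<phi>_closed tensor_lift_pure[OF abelian_group_axioms \<phi>]
      by (intro finsum_cong') (auto simp: word_tensor_def splits_index)
    finally show "tensor_lift A \<phi> (comult (\<beta> k)) = [\<kappa> 0 (\<beta> k)] \<cdot> \<one>"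
      using conv[OF k] unit_basis[OF k] by simp
  qed
  show ?thesis
  proof (intro exI[of _ S] conjI ballI)
    show "S \<in> add_hom A A" by (rule S)
    fix a assume a: "a \<in> carrier A"
    show "tensor_lift A (\<lambda>xs. S (xs ! 0) \<otimes> (xs ! 1)) (comult a) = [\<kappa> 0 a] \<cdot> \<one>"
    proof (rule main[OF _ _ a])
      show "multilinear 2 A (\<lambda>xs. S (xs ! 0) \<otimes> (xs ! 1))"
        by (rule multilinear_2I) (auto simp: S_closed add_hom_add[OF S] l_distr r_distr)
      fix k assume k: "k \<in> I"
      have "(\<Oplus>p\<in>splits k. S ([\<beta> (fst p), \<beta> (snd p)] ! 0) \<otimes> [\<beta> (fst p), \<beta> (snd p)] ! 1) = conv s \<beta> k"
        unfolding conv_def using s(1)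
        by (intro finsum_cong') (auto simp: S_basis Pi_iff elim!: splitsE)
      then show "(\<Oplus>p\<in>splits k. S ([\<beta> (fst p), \<beta> (snd p)] ! 0) \<otimes> [\<beta> (fst p), \<beta> (snd p)] ! 1) = conv_one k"
        using s(2)[OF k] by simp
    qed
    show "tensor_lift A (\<lambda>xs. (xs ! 0) \<otimes> S (xs ! 1)) (comult a) = [\<kappa> 0 a] \<cdot> \<one>"
    proof (rule main[OF _ _ a])
      show "multilinear 2 A (\<lambda>xs. (xs ! 0) \<otimes> S (xs ! 1))"
        by (rule multilinear_2I) (auto simp: S_closed add_hom_add[OF S] l_distr r_distr)
      fix k assume k: "k \<in> I"
      have "(\<Oplus>p\<in>splits k. [\<beta> (fst p), \<beta> (snd p)] ! 0 \<otimes> S ([\<beta> (fst p), \<beta> (snd p)] ! 1)) = conv \<beta> s k"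
        unfolding conv_def using s(1)
        by (intro finsum_cong') (auto simp: S_basis Pi_iff elim!: splitsE)
      then show "(\<Oplus>p\<in>splits k. [\<beta> (fst p), \<beta> (snd p)] ! 0 \<otimes> S ([\<beta> (fst p), \<beta> (snd p)] ! 1)) = conv_one k"
        using s(3)[OF k] by simp
    qed
  qed
qed

theorem hopf_algebra_exists: "\<exists>S. hopf_algebra A comult (\<kappa> 0) S"
proof -
  obtain S where S: "S \<in> add_hom A A"
    "\<And>a. a \<in> carrier A \<Longrightarrow> tensor_lift A (\<lambda>xs. S (xs ! 0) \<otimes> (xs ! 1)) (comult a) = [\<kappa> 0 a] \<cdot> \<one>"
    "\<And>a. a \<in> carrier A \<Longrightarrow> tensor_lift A (\<lambda>xs. (xs ! 0) \<otimes> S (xs ! 1)) (comult a) = [\<kappa> 0 a] \<cdot> \<one>"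
    using antipode_exists by blast
  have "hopf_algebra A comult (\<kappa> 0) S"
    by (intro hopf_algebra.intro hopf_algebra_axioms.intro)
      (fact ring_axioms comult_ring_hom counit_ring_hom coassociative counit_laws S)+
  then show ?thesis by blast
qed

end

section \<open>The centre of the group ring\<close>

locale finite_group = group G for G (structure) +
  assumes finite_carrier: "finite (carrier G)"
begin

abbreviation "ZG \<equiv> monoid_ring G"
abbreviation "Z \<equiv> class_ring G"

sublocale ZG: ring ZG by (rule monoid_ring_is_ring)

lemma lookup_mult_of:
  assumes g: "g \<in> carrier G" and x: "x \<in> carrier G" and z: "z \<in> carrier ZG"
  shows "Poly_Mapping.lookup (frag_of g \<otimes>\<^bsub>ZG\<^esub> z) x = Poly_Mapping.lookup z (inv g \<otimes> x)"
    and "Poly_Mapping.lookup (z \<otimes>\<^bsub>ZG\<^esub> frag_of g) x = Poly_Mapping.lookup z (x \<otimes> inv g)"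
proof -
  have "Poly_Mapping.keys z \<subseteq> carrier G" using z by simp
  then have "Poly_Mapping.lookup (frag_of g \<otimes>\<^bsub>ZG\<^esub> z) x = Poly_Mapping.lookup z (inv g \<otimes> x) \<and>
    Poly_Mapping.lookup (z \<otimes>\<^bsub>ZG\<^esub> frag_of g) x = Poly_Mapping.lookup z (x \<otimes> inv g)"
  proof (induction z rule: frag_induct)
    case (one h)
    have "x = g \<otimes> h \<longleftrightarrow> inv g \<otimes> x = h" "x = h \<otimes> g \<longleftrightarrow> x \<otimes> inv g = h"
      using inv_solve_left[of h g x] inv_solve_right[of h x g] g x one by auto
    then show ?case using g x one by simp
  qed (auto simp: monoid_ring_mult_simps lookup_minus)
  then show "Poly_Mapping.lookup (frag_of g \<otimes>\<^bsub>ZG\<^esub> z) x = Poly_Mapping.lookup z (inv g \<otimes> x)"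
    "Poly_Mapping.lookup (z \<otimes>\<^bsub>ZG\<^esub> frag_of g) x = Poly_Mapping.lookup z (x \<otimes> inv g)" by auto
qed

lemma class_ring_simps [simp]:
  "carrier Z = {z \<in> carrier ZG. \<forall>y\<in>carrier ZG. z \<otimes>\<^bsub>ZG\<^esub> y = y \<otimes>\<^bsub>ZG\<^esub> z}"
  "x \<otimes>\<^bsub>Z\<^esub> y = x \<otimes>\<^bsub>ZG\<^esub> y"
  "\<one>\<^bsub>Z\<^esub> = frag_of \<one>"
  "\<zero>\<^bsub>Z\<^esub> = 0"
  "x \<oplus>\<^bsub>Z\<^esub> y = x + y"
  unfolding class_ring_def by (simp_all add: monoid_ring_def)

lemma class_ring_is_ring: "ring Z"
  unfolding class_ring_def
proof (rule ZG.subring_is_ring, rule ZG.subringI)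
  let ?C = "{z \<in> carrier ZG. \<forall>y\<in>carrier ZG. z \<otimes>\<^bsub>ZG\<^esub> y = y \<otimes>\<^bsub>ZG\<^esub> z}"
  show "\<one>\<^bsub>ZG\<^esub> \<in> ?C" using ZG.l_one ZG.r_one by simp
  show "\<ominus>\<^bsub>ZG\<^esub> h \<in> ?C" if "h \<in> ?C" for h
    using that by (auto simp: ZG.l_minus ZG.r_minus simp del: monoid_ring_simps)
  show "h1 \<otimes>\<^bsub>ZG\<^esub> h2 \<in> ?C" if "h1 \<in> ?C" "h2 \<in> ?C" for h1 h2
  proof -
    have h: "h1 \<in> carrier ZG" "h2 \<in> carrier ZG" using that by auto
    have "h1 \<otimes>\<^bsub>ZG\<^esub> h2 \<otimes>\<^bsub>ZG\<^esub> y = y \<otimes>\<^bsub>ZG\<^esub> (h1 \<otimes>\<^bsub>ZG\<^esub> h2)" if y: "y \<in> carrier ZG" for y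
    proof -
      have "h1 \<otimes>\<^bsub>ZG\<^esub> h2 \<otimes>\<^bsub>ZG\<^esub> y = h1 \<otimes>\<^bsub>ZG\<^esub> (y \<otimes>\<^bsub>ZG\<^esub> h2)"
        using \<open>h2 \<in> ?C\<close> y by (simp add: ZG.m_assoc[OF h y] del: monoid_ring_simps)
      also have "\<dots> = y \<otimes>\<^bsub>ZG\<^esub> h1 \<otimes>\<^bsub>ZG\<^esub> h2"
        using \<open>h1 \<in> ?C\<close> y by (simp add: ZG.m_assoc[OF h(1) y h(2), symmetric] del: monoid_ring_simps)
      finally show ?thesis using ZG.m_assoc[OF y h] by simp
    qed
    then show ?thesis using ZG.m_closed[OF h] by blast
  qed
  show "h1 \<oplus>\<^bsub>ZG\<^esub> h2 \<in> ?C" if "h1 \<in> ?C" "h2 \<in> ?C" for h1 h2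
    using that by (auto simp: ZG.l_distr ZG.r_distr simp del: monoid_ring_simps)
qed auto

sublocale Z: ring Z by (rule class_ring_is_ring)

lemma lookup_hom: "(\<lambda>z. Poly_Mapping.lookup z g) \<in> add_hom Z \<Z>"
  by (rule int_homI) (simp add: lookup_add)

text \<open>
  Compare the coefficients of \<open>g z = z g\<close> at \<open>g h\<close>.
\<close>

lemma lookup_conj:
  assumes z: "z \<in> carrier Z" and g: "g \<in> carrier G" and h: "h \<in> carrier G"
  shows "Poly_Mapping.lookup z (g \<otimes> h \<otimes> inv g) = Poly_Mapping.lookup z h"
proof -
  have "Poly_Mapping.lookup (frag_of g \<otimes>\<^bsub>ZG\<^esub> z) (g \<otimes> h) = Poly_Mapping.lookup (z \<otimes>\<^bsub>ZG\<^esub> frag_of g) (g \<otimes> h)"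
    using z g by simp
  then show ?thesis
    using lookup_mult_of[of g "g \<otimes> h" z] z g h by (simp add: m_assoc[symmetric])
qed

definition conj_class :: "'a \<Rightarrow> 'a set" where
  "conj_class h = (\<lambda>g. g \<otimes> h \<otimes> inv g) ` carrier G"

lemma conj_classes_eq: "conj_classes G = conj_class ` carrier G"
  by (simp add: conj_classes_def conj_class_def)

lemma finite_conj_classes: "finite (conj_classes G)"
  by (simp add: conj_classes_eq finite_carrier)

lemma conj_class_self: "h \<in> carrier G \<Longrightarrow> h \<in> conj_class h"
  unfolding conj_class_def by (rule image_eqI[of _ _ \<one>]) auto

lemma conj_class_mem:
  assumes c: "c \<in> conj_classes G" and x: "x \<in> c"
  shows "x \<in> carrier G" "c = conj_class x"
proof -
  obtain h g where h: "h \<in> carrier G" "c = conj_class h" and g: "g \<in> carrier G" "x = g \<otimes> h \<otimes> inv g"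
    using c x by (auto simp: conj_classes_eq conj_class_def)
  show xG: "x \<in> carrier G" using h g by simp
  have h_eq: "h = inv g \<otimes> x \<otimes> g"
    using h g by (simp add: m_assoc[symmetric]) (simp add: m_assoc)
  have "\<exists>k'\<in>carrier G. k \<otimes> h \<otimes> inv k = k' \<otimes> x \<otimes> inv k'" if k: "k \<in> carrier G" for k
    by (rule bexI[of _ "k \<otimes> inv g"])
      (use k g xG in \<open>auto simp: h_eq m_assoc inv_mult_group\<close>)
  moreover have "\<exists>k'\<in>carrier G. k \<otimes> x \<otimes> inv k = k' \<otimes> h \<otimes> inv k'" if k: "k \<in> carrier G" for k
    by (rule bexI[of _ "k \<otimes> g"])
      (use k g h in \<open>auto simp: m_assoc inv_mult_group\<close>)
  ultimately show "c = conj_class x"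
    unfolding h(2) conj_class_def by blast
qed

lemma conj_closed:
  assumes "c \<in> conj_classes G" "x \<in> c" "g \<in> carrier G"
  shows "g \<otimes> x \<otimes> inv g \<in> c"
  using conj_class_mem[OF assms(1,2)] assms(3) by (auto simp: conj_class_def)

definition rep :: "'a set \<Rightarrow> 'a" where
  "rep c = (SOME x. x \<in> c)"

lemma rep_mem:
  assumes "c \<in> conj_classes G"
  shows "rep c \<in> c"
proof -
  obtain h where "h \<in> carrier G" "c = conj_class h" using assms by (auto simp: conj_classes_eq)
  then have "h \<in> c" using conj_class_self by simp
  then show ?thesis unfolding rep_def by (rule someI)
qed

lemma rep_mem_iff: "c \<in> conj_classes G \<Longrightarrow> d \<in> conj_classes G \<Longrightarrow> rep c \<in> d \<longleftrightarrow> c = d"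
  using rep_mem conj_class_mem(2) by metis

text \<open>
  A central element is constant on each class, so one coefficient per class determines it.
\<close>

lemma central_eq_0:
  assumes z: "z \<in> carrier Z" and 0: "\<And>c. c \<in> conj_classes G \<Longrightarrow> Poly_Mapping.lookup z (rep c) = 0"
  shows "z = 0"
proof (rule poly_mapping_eqI)
  fix h
  show "Poly_Mapping.lookup z h = Poly_Mapping.lookup 0 h"
  proof (cases "h \<in> carrier G")
    case True
    let ?c = "conj_class h"
    have c: "?c \<in> conj_classes G" using True by (simp add: conj_classes_eq)
    obtain g where g: "g \<in> carrier G" "rep ?c = g \<otimes> h \<otimes> inv g"
      using rep_mem[OF c] by (auto simp: conj_class_def)
    then show ?thesis using 0[OF c] lookup_conj[OF z g(1) True] by simp
  next
    case False
    then show ?thesis using z by (auto simp: in_keys_iff)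
  qed
qed

lemma lookup_class_sum:
  assumes c: "c \<in> conj_classes G"
  shows "Poly_Mapping.lookup (class_sum c) x = (if x \<in> c then 1 else 0)"
proof -
  have "c \<subseteq> carrier G" using conj_class_mem(1)[OF c] by blast
  then have "finite c" using finite_carrier finite_subset by blast
  then show ?thesis unfolding class_sum_def by (simp add: lookup_sum)
qed

lemma class_sum_closed:
  assumes c: "c \<in> conj_classes G"
  shows "class_sum c \<in> carrier Z"
proof -
  have cs: "class_sum c \<in> carrier ZG"
    using conj_class_mem(1)[OF c] by (auto simp: in_keys_iff lookup_class_sum[OF c] split: if_splits)
  have of: "class_sum c \<otimes>\<^bsub>ZG\<^esub> frag_of g = frag_of g \<otimes>\<^bsub>ZG\<^esub> class_sum c" if g: "g \<in> carrier G" for g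
  proof (rule poly_mapping_eqI)
    fix x
    show "Poly_Mapping.lookup (class_sum c \<otimes>\<^bsub>ZG\<^esub> frag_of g) x
        = Poly_Mapping.lookup (frag_of g \<otimes>\<^bsub>ZG\<^esub> class_sum c) x"
    proof (cases "x \<in> carrier G")
      case True
      have "x \<otimes> inv g = g \<otimes> (inv g \<otimes> x) \<otimes> inv g" "inv g \<otimes> x = inv g \<otimes> (x \<otimes> inv g) \<otimes> inv (inv g)"
        using g True by (simp_all add: m_assoc[symmetric]) (simp add: m_assoc)
      then have "x \<otimes> inv g \<in> c \<longleftrightarrow> inv g \<otimes> x \<in> c"
        using conj_closed[OF c] g by (metis inv_closed)
      then show ?thesis using lookup_mult_of[OF g True cs] by (simp add: lookup_class_sum[OF c])
    next
      case False
      have "frag_of g \<in> carrier ZG" using g by simp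
      then have "class_sum c \<otimes>\<^bsub>ZG\<^esub> frag_of g \<in> carrier ZG" "frag_of g \<otimes>\<^bsub>ZG\<^esub> class_sum c \<in> carrier ZG"
        using cs ZG.m_closed by blast+
      then have "x \<notin> Poly_Mapping.keys (class_sum c \<otimes>\<^bsub>ZG\<^esub> frag_of g)"
        "x \<notin> Poly_Mapping.keys (frag_of g \<otimes>\<^bsub>ZG\<^esub> class_sum c)"
        using False by auto
      then show ?thesis by (simp add: in_keys_iff)
    qed
  qed
  have "class_sum c \<otimes>\<^bsub>ZG\<^esub> y = y \<otimes>\<^bsub>ZG\<^esub> class_sum c" if "y \<in> carrier ZG" for y
  proof -
    have "Poly_Mapping.keys y \<subseteq> carrier G" using that by simp
    then show ?thesis
      by (induction y rule: frag_induct) (auto simp: of monoid_ring_mult_simps)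
  qed
  then show ?thesis using cs by simp
qed

section \<open>The basis of \<open>Q\<close>\<close>

abbreviation "P \<equiv> UP Z"
abbreviation "Q \<equiv> Q_ring G"

sublocale P: UP_ring Z P by unfold_locales

lemma coeff_apply: "q \<in> carrier P \<Longrightarrow> up_ring.coeff P q n = q n"
  by (simp add: UP_def)

lemma Q_ring_simps [simp]:
  "carrier Q = {q \<in> carrier P. \<exists>k::int. up_ring.coeff P q 0 = [k] \<cdot>\<^bsub>Z\<^esub> \<one>\<^bsub>Z\<^esub>}"
  "x \<otimes>\<^bsub>Q\<^esub> y = x \<otimes>\<^bsub>P\<^esub> y"
  "\<one>\<^bsub>Q\<^esub> = \<one>\<^bsub>P\<^esub>"
  "\<zero>\<^bsub>Q\<^esub> = \<zero>\<^bsub>P\<^esub>"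
  "x \<oplus>\<^bsub>Q\<^esub> y = x \<oplus>\<^bsub>P\<^esub> y"
  unfolding Q_ring_def by simp_all

lemma Q_ring_is_ring: "ring Q"
  unfolding Q_ring_def
proof (rule P.subring_is_ring, rule P.subringI)
  let ?C = "{q \<in> carrier P. \<exists>k::int. up_ring.coeff P q 0 = [k] \<cdot>\<^bsub>Z\<^esub> \<one>\<^bsub>Z\<^esub>}"
  have one: "\<one>\<^bsub>Z\<^esub> \<in> carrier Z" by (rule Z.one_closed)
  note [simp del] = class_ring_simps
  show "\<one>\<^bsub>P\<^esub> \<in> ?C"
    using Z.add.int_pow_1[OF one] by (auto intro!: exI[of _ 1])
  show "\<ominus>\<^bsub>P\<^esub> h \<in> ?C" if h: "h \<in> ?C" for h
  proof -
    obtain k :: int where "up_ring.coeff P h 0 = [k] \<cdot>\<^bsub>Z\<^esub> \<one>\<^bsub>Z\<^esub>" using h by blast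
    then have "up_ring.coeff P (\<ominus>\<^bsub>P\<^esub> h) 0 = [(- k)] \<cdot>\<^bsub>Z\<^esub> \<one>\<^bsub>Z\<^esub>"
      using h Z.add.int_pow_neg[OF one] by simp
    then show ?thesis using h by auto
  qed
  show "h1 \<otimes>\<^bsub>P\<^esub> h2 \<in> ?C" if h: "h1 \<in> ?C" "h2 \<in> ?C" for h1 h2
  proof -
    obtain k l :: int where "up_ring.coeff P h1 0 = [k] \<cdot>\<^bsub>Z\<^esub> \<one>\<^bsub>Z\<^esub>" "up_ring.coeff P h2 0 = [l] \<cdot>\<^bsub>Z\<^esub> \<one>\<^bsub>Z\<^esub>"
      using h by blast
    then have "up_ring.coeff P (h1 \<otimes>\<^bsub>P\<^esub> h2) 0 = [(l * k)] \<cdot>\<^bsub>Z\<^esub> \<one>\<^bsub>Z\<^esub>"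
      using h Z.add.int_pow_pow[OF one] by (simp add: Z.add_pow_ldistr_int)
    then show ?thesis using h by auto
  qed
  show "h1 \<oplus>\<^bsub>P\<^esub> h2 \<in> ?C" if h: "h1 \<in> ?C" "h2 \<in> ?C" for h1 h2
  proof -
    obtain k l :: int where "up_ring.coeff P h1 0 = [k] \<cdot>\<^bsub>Z\<^esub> \<one>\<^bsub>Z\<^esub>" "up_ring.coeff P h2 0 = [l] \<cdot>\<^bsub>Z\<^esub> \<one>\<^bsub>Z\<^esub>"
      using h by blast
    then have "up_ring.coeff P (h1 \<oplus>\<^bsub>P\<^esub> h2) 0 = [(k + l)] \<cdot>\<^bsub>Z\<^esub> \<one>\<^bsub>Z\<^esub>"
      using h Z.add.int_pow_mult[OF one] by simp
    then show ?thesis using h by auto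
  qed
qed auto

sublocale Q: ring Q by (rule Q_ring_is_ring)

lemma lookup_scalar: "Poly_Mapping.lookup ([(k::int)] \<cdot>\<^bsub>Z\<^esub> frag_of \<one>) g = (if g = \<one> then k else 0)"
  using int_hom_pow[OF Z.abelian_group_axioms lookup_hom[of g], of "frag_of \<one>" k] Z.one_closed by simp

lemma Q_coeff_0:
  assumes "q \<in> carrier Q"
  shows "q 0 = [Poly_Mapping.lookup (q 0) \<one>] \<cdot>\<^bsub>Z\<^esub> frag_of \<one>"
proof -
  obtain k :: int where "up_ring.coeff P q 0 = [k] \<cdot>\<^bsub>Z\<^esub> \<one>\<^bsub>Z\<^esub>" using assms by auto
  then have "q 0 = [k] \<cdot>\<^bsub>Z\<^esub> frag_of \<one>" using assms coeff_apply by simp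
  then show ?thesis by (simp add: lookup_scalar)
qed

lemma Q_eval0_eq: "q \<in> carrier Q \<Longrightarrow> Q_eval0 G q = Poly_Mapping.lookup (q 0) \<one>"
  unfolding Q_eval0_def
proof (rule the_equality)
  assume q: "q \<in> carrier Q"
  then have c: "up_ring.coeff P q 0 = q 0" using coeff_apply by simp
  show "up_ring.coeff P q 0 = [Poly_Mapping.lookup (q 0) \<one>] \<cdot>\<^bsub>Z\<^esub> \<one>\<^bsub>Z\<^esub>"
    using Q_coeff_0[OF q] c by simp
  fix k :: int assume "up_ring.coeff P q 0 = [k] \<cdot>\<^bsub>Z\<^esub> \<one>\<^bsub>Z\<^esub>"
  then have "q 0 = [k] \<cdot>\<^bsub>Z\<^esub> frag_of \<one>" using c by simp
  then show "k = Poly_Mapping.lookup (q 0) \<one>" by (simp add: lookup_scalar)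
qed

lemma Q_eval0_hom: "Q_eval0 G \<in> ring_hom Q \<Z>"
proof (rule ring_hom_memI)
  fix p q assume pq: "p \<in> carrier Q" "q \<in> carrier Q"
  then have P: "p \<in> carrier P" "q \<in> carrier P" by auto
  have one: "frag_of \<one> \<in> carrier Z" using Z.one_closed by simp
  obtain k l :: int where kl: "p 0 = [k] \<cdot>\<^bsub>Z\<^esub> frag_of \<one>" "q 0 = [l] \<cdot>\<^bsub>Z\<^esub> frag_of \<one>"
    using Q_coeff_0 pq by blast
  have "(p \<otimes>\<^bsub>P\<^esub> q) 0 = up_ring.coeff P (p \<otimes>\<^bsub>P\<^esub> q) 0" using P by (simp add: coeff_apply del: P.coeff_mult)
  also have "\<dots> = up_ring.coeff P p 0 \<otimes>\<^bsub>Z\<^esub> up_ring.coeff P q 0"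
    unfolding P.coeff_mult[OF P] using P.coeff_closed[OF P(1), of 0] P.coeff_closed[OF P(2), of 0]
    by (simp del: class_ring_simps)
  also have "\<dots> = p 0 \<otimes>\<^bsub>Z\<^esub> q 0" using P by (simp add: coeff_apply)
  also have "\<dots> = [k] \<cdot>\<^bsub>Z\<^esub> ([l] \<cdot>\<^bsub>Z\<^esub> frag_of \<one>)"
    unfolding kl using Z.add_pow_ldistr_int[OF one, of "[l] \<cdot>\<^bsub>Z\<^esub> frag_of \<one>" k]
      Z.add.int_pow_closed[OF one, of l] Z.l_one[of "[l] \<cdot>\<^bsub>Z\<^esub> frag_of \<one>"] by simp
  also have "\<dots> = [(l * k)] \<cdot>\<^bsub>Z\<^esub> frag_of \<one>"
    using Z.add.int_pow_pow[OF one] by simp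
  finally have "(p \<otimes>\<^bsub>P\<^esub> q) 0 = [(l * k)] \<cdot>\<^bsub>Z\<^esub> frag_of \<one>" .
  then show "Q_eval0 G (p \<otimes>\<^bsub>Q\<^esub> q) = Q_eval0 G p \<otimes>\<^bsub>\<Z>\<^esub> Q_eval0 G q"
    using Q_eval0_eq Q.m_closed[OF pq] pq kl by (simp add: lookup_scalar)
  have "(p \<oplus>\<^bsub>P\<^esub> q) 0 = p 0 + q 0"
    using P.coeff_add[OF P, of 0] coeff_apply P P.UP_a_closed[OF P] by simp
  then show "Q_eval0 G (p \<oplus>\<^bsub>Q\<^esub> q) = Q_eval0 G p \<oplus>\<^bsub>\<Z>\<^esub> Q_eval0 G q"
    using Q_eval0_eq Q.a_closed[OF pq] pq by (simp add: lookup_add)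
next
  have "\<one>\<^bsub>P\<^esub> 0 = frag_of \<one>" by (simp add: UP_def)
  then show "Q_eval0 G \<one>\<^bsub>Q\<^esub> = \<one>\<^bsub>\<Z>\<^esub>" using Q_eval0_eq[OF Q.one_closed] by simp
qed simp

text \<open>
  The basis of \<open>Q\<close> is indexed by letters: \<^const>\<open>None\<close> stands for \<open>1\<close> and \<open>Some (c, j)\<close> for
  \<open>c x\<^sup>j\<close>.  The class sum \<open>c\<close> in degree \<open>0\<close> is excluded, since the constant term of an element of \<open>Q\<close>
  is an integer.
\<close>

definition letters :: "('a set \<times> nat) option set" where
  "letters = insert None (Some ` (conj_classes G \<times> {1..}))"

fun letter :: "('a set \<times> nat) option \<Rightarrow> 'a class_poly" where
  "letter None = \<one>\<^bsub>Q\<^esub>"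
| "letter (Some (c, j)) = class_monom G c j"

fun letter_coord :: "('a set \<times> nat) option \<Rightarrow> 'a class_poly \<Rightarrow> int" where
  "letter_coord None q = Poly_Mapping.lookup (q 0) \<one>"
| "letter_coord (Some (c, j)) q = Poly_Mapping.lookup (q j) (rep c)"

fun letter_deg :: "('a set \<times> nat) option \<Rightarrow> nat" where
  "letter_deg None = 0"
| "letter_deg (Some (c, j)) = j"

lemma letter_coord_None: "q \<in> carrier Q \<Longrightarrow> letter_coord None q = Q_eval0 G q"
  by (simp add: Q_eval0_eq del: Q_ring_simps)

lemma letter_cases:
  assumes "l \<in> letters"
  obtains "l = None" | c j where "l = Some (c, j)" "c \<in> conj_classes G" "j \<ge> 1"
  using assms by (auto simp: letters_def)

lemma letter_monom:
  assumes "l \<in> letters"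
  obtains x where "x \<in> carrier Z" "letter l = up_ring.monom P x (letter_deg l)"
proof (cases rule: letter_cases[OF assms])
  case 1
  have "up_ring.monom P \<one>\<^bsub>Z\<^esub> 0 = \<one>\<^bsub>P\<^esub>" by (rule P.monom_one)
  then show ?thesis using 1 that[OF Z.one_closed] by simp
next
  case (2 c j)
  then show ?thesis using that[OF class_sum_closed] by (simp add: class_monom_def)
qed

lemma monom_apply: "x \<in> carrier Z \<Longrightarrow> up_ring.monom P x n i = (if i = n then x else 0)"
  using coeff_apply[OF P.monom_closed, of x n i] by auto

lemma letter_closed:
  assumes l: "l \<in> letters"
  shows "letter l \<in> carrier Q"
proof (cases rule: letter_cases[OF l])
  case 1
  then show ?thesis using Q.one_closed by simp
next
  case (2 c j)
  have "[(0::int)] \<cdot>\<^bsub>Z\<^esub> \<one>\<^bsub>Z\<^esub> = \<zero>\<^bsub>Z\<^esub>" by (simp add: add_pow_def)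
  then show ?thesis
    using 2 class_sum_closed[OF 2(2)] by (auto simp: class_monom_def simp del: class_ring_simps intro!: exI[of _ 0])
qed

lemma letter_coord_monom:
  assumes "x \<in> carrier Z" "letter_coord l (up_ring.monom P x n) \<noteq> 0"
  shows "letter_deg l = n"
  using assms by (cases l) (auto simp: monom_apply simp del: class_ring_simps split: if_splits)

sublocale Q: ring_basis Q letters letter letter_coord
proof unfold_locales
  show "letter l \<in> carrier Q" if "l \<in> letters" for l
    using that by (rule letter_closed)
  show "letter_coord l \<in> add_hom Q \<Z>" if "l \<in> letters" for l
  proof (rule int_homI)
    fix p q assume "p \<in> carrier Q" "q \<in> carrier Q"
    then have P: "p \<in> carrier P" "q \<in> carrier P" by auto
    have "(p \<oplus>\<^bsub>P\<^esub> q) n = p n + q n" for n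
      using P.coeff_add[OF P, of n] coeff_apply P P.UP_a_closed[OF P] by simp
    then show "letter_coord l (p \<oplus>\<^bsub>Q\<^esub> q) = letter_coord l p + letter_coord l q"
      by (cases l) (auto simp: lookup_add)
  qed
  show "finite {l \<in> letters. letter_coord l q \<noteq> 0}" if "q \<in> carrier Q" for q
  proof -
    have "q \<in> up Z" using that by (simp add: UP_def)
    then obtain n where n: "bound \<zero>\<^bsub>Z\<^esub> n q" by blast
    have "{l \<in> letters. letter_coord l q \<noteq> 0} \<subseteq> insert None (Some ` (conj_classes G \<times> {..n}))"
    proof clarify
      fix l assume l: "l \<in> letters" "letter_coord l q \<noteq> 0" "l \<notin> Some ` (conj_classes G \<times> {..n})"
      show "l = None"
      proof (cases rule: letter_cases[OF l(1)])
        case (2 c j)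
        then have "n < j" using l(3) by auto
        then have "q j = 0" using n bound.bound[of "\<zero>\<^bsub>Z\<^esub>" n q] by simp
        then show ?thesis using 2 l(2) by simp
      qed
    qed
    then show ?thesis by (rule finite_subset) (simp add: finite_conj_classes)
  qed
  show "q = \<zero>\<^bsub>Q\<^esub>" if q: "q \<in> carrier Q" and 0: "\<And>l. l \<in> letters \<Longrightarrow> letter_coord l q = 0" for q
  proof -
    have "q j = 0" for j
    proof (cases "j = 0")
      case True
      have "Poly_Mapping.lookup (q 0) \<one> = 0" using 0[of None] by (simp add: letters_def)
      then have "q 0 = [(0::int)] \<cdot>\<^bsub>Z\<^esub> frag_of \<one>" using Q_coeff_0[OF q] by simp
      then show ?thesis using True by (simp add: add_pow_def)
    next
      case False
      have "q j \<in> carrier Z" using q P.coeff_closed[of q j] coeff_apply[of q] by simp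
      then show ?thesis
        using 0[of "Some (c, j)" for c] False by (intro central_eq_0) (auto simp: letters_def)
    qed
    then show ?thesis by (auto simp: UP_def)
  qed
  show "letter_coord i (letter j) = (if i = j then 1 else 0)" if i: "i \<in> letters" and j: "j \<in> letters" for i j
  proof (cases rule: letter_cases[OF j])
    case 1
    have "\<one>\<^bsub>P\<^esub> n = (if n = 0 then frag_of \<one> else 0)" for n by (simp add: UP_def)
    then show ?thesis using 1 by (cases rule: letter_cases[OF i]) auto
  next
    case (2 c m)
    have m: "class_monom G c m n = (if n = m then class_sum c else 0)" for n
      unfolding class_monom_def using class_sum_closed[OF 2(2)] by (rule monom_apply)
    show ?thesis
      using 2 by (cases rule: letter_cases[OF i]) (auto simp: m lookup_class_sum rep_mem_iff)
  qed
qed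

lemma letter_mult_degree:
  assumes "i \<in> letters" "j \<in> letters" "letter_coord l (letter i \<otimes>\<^bsub>Q\<^esub> letter j) \<noteq> 0"
  shows "letter_deg l = letter_deg i + letter_deg j"
proof -
  obtain x y where x: "x \<in> carrier Z" "letter i = up_ring.monom P x (letter_deg i)"
    and y: "y \<in> carrier Z" "letter j = up_ring.monom P y (letter_deg j)"
    using letter_monom assms(1,2) by metis
  have "letter i \<otimes>\<^bsub>Q\<^esub> letter j = up_ring.monom P (x \<otimes>\<^bsub>Z\<^esub> y) (letter_deg i + letter_deg j)"
    unfolding x(2) y(2) Q_ring_simps using P.monom_mult[OF x(1) y(1)] by simp
  then show ?thesis
    using assms(3) letter_coord_monom[OF Z.m_closed[OF x(1) y(1)]] by simp
qed

end

section \<open>Permutation and truncation of tensors\<close>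

lemma permute_list_map2:
  assumes "p permutes {..<n}" "length xs = n" "length ys = n"
  shows "permute_list p (map2 f xs ys) = map2 f (permute_list p xs) (permute_list p ys)"
  using assms by (simp add: permute_list_map permute_list_zip[of p "{..<n}"])

lemma prod_list_permute:
  fixes xs :: "'b::comm_monoid_mult list"
  assumes "p permutes {..<length xs}"
  shows "prod_list (permute_list p xs) = prod_list xs"
  using mset_permute_list[OF assms] by (metis prod_mset_prod_list)

lemma permute_list_replicate:
  assumes p: "p permutes {..<n}"
  shows "permute_list p (replicate n x) = replicate n x"
proof (rule nth_equalityI)
  fix i assume "i < length (permute_list p (replicate n x))"
  then show "permute_list p (replicate n x) ! i = replicate n x ! i"
    using p permutes_in_image[OF p, of i] by (simp add: permute_list_nth)
qed simp

context ring
begin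

text \<open>
  Multiplicativity is biadditive in the two arguments and can therefore be checked on pure tensors.
\<close>

lemma tensor_lift_ring_hom:
  assumes C: "ring C" and \<phi>: "multilinear n C \<phi>"
    and mult: "\<And>xs ys. length xs = n \<Longrightarrow> length ys = n \<Longrightarrow> set xs \<subseteq> carrier R \<Longrightarrow> set ys \<subseteq> carrier R \<Longrightarrow>
      \<phi> (map2 (\<otimes>) xs ys) = \<phi> xs \<otimes>\<^bsub>C\<^esub> \<phi> ys"
    and one: "\<phi> (replicate n \<one>) = \<one>\<^bsub>C\<^esub>"
  shows "tensor_lift C \<phi> \<in> ring_hom (TP n) C"
proof -
  interpret C: ring C by (rule C)
  interpret T: ring "TP n" by (rule tensor_power_is_ring)
  let ?L = "tensor_lift C \<phi>"
  note hom = tensor_lift_hom[OF C.abelian_group_axioms \<phi>]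
  note pure = tensor_lift_pure[OF C.abelian_group_axioms \<phi>]
  note closed = add_hom_closed[OF hom]
  have half: "?L (pure_tensor R xs \<otimes>\<^bsub>TP n\<^esub> t) = ?L (pure_tensor R xs) \<otimes>\<^bsub>C\<^esub> ?L t"
    if xs: "length xs = n" "set xs \<subseteq> carrier R" and t: "t \<in> carrier (TP n)" for xs t
  proof (rule tensor_hom_eqI[OF C.abelian_group_axioms _ _ _ t])
    show "(\<lambda>t. ?L (pure_tensor R xs \<otimes>\<^bsub>TP n\<^esub> t)) \<in> add_hom (TP n) C"
      using xs closed by (intro add_homI) (auto simp: T.r_distr add_hom_add[OF hom])
    show "(\<lambda>t. ?L (pure_tensor R xs) \<otimes>\<^bsub>C\<^esub> ?L t) \<in> add_hom (TP n) C"
      using xs closed by (intro add_homI) (auto simp: C.r_distr add_hom_add[OF hom])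
    fix ys assume ys: "length ys = n" "set ys \<subseteq> carrier R"
    show "?L (pure_tensor R xs \<otimes>\<^bsub>TP n\<^esub> pure_tensor R ys)
        = ?L (pure_tensor R xs) \<otimes>\<^bsub>C\<^esub> ?L (pure_tensor R ys)"
      using xs ys mult set_map2_mult[OF xs(2) ys(2)] by (simp add: pure_tensor_mult pure)
  qed
  show ?thesis
  proof (rule ring_hom_memI)
    fix s t assume s: "s \<in> carrier (TP n)" and t: "t \<in> carrier (TP n)"
    show "?L (s \<otimes>\<^bsub>TP n\<^esub> t) = ?L s \<otimes>\<^bsub>C\<^esub> ?L t"
    proof (rule tensor_hom_eqI[OF C.abelian_group_axioms _ _ _ s])
      show "(\<lambda>s. ?L (s \<otimes>\<^bsub>TP n\<^esub> t)) \<in> add_hom (TP n) C"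
        using t closed by (intro add_homI) (auto simp: T.l_distr add_hom_add[OF hom])
      show "(\<lambda>s. ?L s \<otimes>\<^bsub>C\<^esub> ?L t) \<in> add_hom (TP n) C"
        using t closed by (intro add_homI) (auto simp: C.l_distr add_hom_add[OF hom])
    qed (use half t in auto)
    show "?L (s \<oplus>\<^bsub>TP n\<^esub> t) = ?L s \<oplus>\<^bsub>C\<^esub> ?L t"
      using add_hom_add[OF hom s t] .
  next
    have "set (replicate n \<one>) \<subseteq> carrier R" by auto
    then show "?L \<one>\<^bsub>TP n\<^esub> = \<one>\<^bsub>C\<^esub>"
      unfolding one_tensor_power using pure one by simp
  qed (rule closed)
qed

text \<open>
  The entry in position \<open>length us\<close> moves to position \<open>k\<close> and the other entries of the permuted
  tuple do not depend on it.
\<close>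

lemma multilinear_permute:
  assumes p: "p permutes {..<n}"
  shows "multilinear n (TP n) (\<lambda>xs. pure_tensor R (permute_list p xs))"
proof (rule multilinearI)
  show "pure_tensor R (permute_list p xs) \<in> carrier (TP n)"
    if "length xs = n" "set xs \<subseteq> carrier R" for xs
    using that p by (intro pure_tensor_closed) auto
  fix us a b vs
  assume *: "length us + length vs + 1 = n" "set us \<subseteq> carrier R" "set vs \<subseteq> carrier R"
    "a \<in> carrier R" "b \<in> carrier R"
  define k where "k = inv_into UNIV p (length us)"
  define ys where "ys = permute_list p (us @ [a] @ vs)"
  have k: "k < n" "p k = length us"
    using p * permutes_in_image[OF permutes_inv[OF p], of "length us"]
    by (auto simp: k_def permutes_inverses)
  have ys: "length ys = n" "set ys \<subseteq> carrier R"
    using p * by (auto simp: ys_def)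
  have perm: "permute_list p (us @ [c] @ vs) = take k ys @ [c] @ drop (Suc k) ys" for c
  proof -
    have "permute_list p (us @ [c] @ vs) = ys[k := c]"
    proof (rule nth_equalityI)
      fix i assume "i < length (permute_list p (us @ [c] @ vs))"
      then have i: "i < n" using * by simp
      have nth: "permute_list p (us @ [d] @ vs) ! i = (us @ [d] @ vs) ! p i" for d
        using p * i by (intro permute_list_nth) auto
      show "permute_list p (us @ [c] @ vs) ! i = ys[k := c] ! i"
      proof (cases "i = k")
        case True
        then show ?thesis using nth k ys by simp
      next
        case False
        then have "p i \<noteq> length us" using inj_eq[OF permutes_inj[OF p], of i k] k(2) by simp
        then have "(us @ [c] @ vs) ! p i = (us @ [a] @ vs) ! p i" by (simp add: nth_append nth_Cons')
        then show ?thesis using False nth by (simp add: ys_def)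
      qed
    qed (use * ys in simp)
    then show ?thesis using k(1) ys by (simp add: upd_conv_take_nth_drop)
  qed
  have "set (take k ys) \<subseteq> carrier R" "set (drop (Suc k) ys) \<subseteq> carrier R"
    using ys(2) set_take_subset set_drop_subset by fast+
  then show "pure_tensor R (permute_list p (us @ [a \<oplus> b] @ vs)) =
      pure_tensor R (permute_list p (us @ [a] @ vs)) \<oplus>\<^bsub>TP n\<^esub>
      pure_tensor R (permute_list p (us @ [b] @ vs))"
    unfolding perm using k(1) ys * by (intro add_hom_add[OF pure_tensor_hom]) auto
qed

lemma permute_ring_hom:
  assumes p: "p permutes {..<n}"
  shows "tensor_lift (TP n) (\<lambda>xs. pure_tensor R (permute_list p xs))
    \<in> ring_hom (TP n) (TP n)"
proof (rule tensor_lift_ring_hom[OF tensor_power_is_ring multilinear_permute[OF p]])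
  fix xs ys assume "length xs = n" "length ys = n" "set xs \<subseteq> carrier R" "set ys \<subseteq> carrier R"
  then show "pure_tensor R (permute_list p (map2 (\<otimes>) xs ys))
      = pure_tensor R (permute_list p xs) \<otimes>\<^bsub>TP n\<^esub> pure_tensor R (permute_list p ys)"
    using p by (subst pure_tensor_mult) (auto simp: permute_list_map2)
qed (simp add: permute_list_replicate[OF p] one_tensor_power)

context
  fixes e :: "'a \<Rightarrow> int" and m n :: nat
  assumes e: "e \<in> ring_hom R \<Z>" and le: "n \<le> m"
begin

private abbreviation (input) "tr \<equiv> \<lambda>xs. [prod_list (map e (drop n xs))] \<cdot>\<^bsub>TP n\<^esub> pure_tensor R (take n xs)"

text \<open>
  Additivity in a position before \<open>n\<close> comes from the pure tensor, and in a later position from the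
  scalar.
\<close>

lemma multilinear_truncate: "multilinear m (TP n) tr"
proof -
  interpret T: ring "TP n" by (rule tensor_power_is_ring)
  have take: "pure_tensor R (take n xs) \<in> carrier (TP n)"
    if "length xs = m" "set xs \<subseteq> carrier R" for xs
    using that le set_take_subset[of n xs] by (intro pure_tensor_closed) auto
  show ?thesis
  proof (rule multilinearI)
    fix us a b vs
    assume *: "length us + length vs + 1 = m" "set us \<subseteq> carrier R" "set vs \<subseteq> carrier R"
      "a \<in> carrier R" "b \<in> carrier R"
    show "tr (us @ [a \<oplus> b] @ vs) = tr (us @ [a] @ vs) \<oplus>\<^bsub>TP n\<^esub> tr (us @ [b] @ vs)"
    proof (cases "length us < n")
      case True
      let ?vs = "take (n - length us - 1) vs"
      have tk: "take n (us @ [c] @ vs) = us @ [c] @ ?vs"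
        and dr: "drop n (us @ [c] @ vs) = drop (n - length us - 1) vs" for c
        using True by (simp_all add: take_Cons' drop_Cons')
      have "set ?vs \<subseteq> carrier R" using * set_take_subset by fast
      then have "pure_tensor R (us @ [a \<oplus> b] @ ?vs) = pure_tensor R (us @ [a] @ ?vs) \<oplus>\<^bsub>TP n\<^esub>
          pure_tensor R (us @ [b] @ ?vs)"
        and "pure_tensor R (us @ [a] @ ?vs) \<in> carrier (TP n)"
        and "pure_tensor R (us @ [b] @ ?vs) \<in> carrier (TP n)"
        using * True le by (intro add_hom_add[OF pure_tensor_hom] pure_tensor_closed; simp)+
      then show ?thesis unfolding tk dr by (simp only: T.add.int_pow_distrib)
    next
      case False
      have tk: "take n (us @ [c] @ vs) = take n us"
        and dr: "drop n (us @ [c] @ vs) = drop n us @ [c] @ vs" for c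
        using False by simp_all
      have "e (a \<oplus> b) = e a + e b" using ring_hom_add[OF e] * by simp
      then have "prod_list (map e (drop n us @ [a \<oplus> b] @ vs))
          = prod_list (map e (drop n us @ [a] @ vs)) + prod_list (map e (drop n us @ [b] @ vs))"
        by (simp add: algebra_simps)
      moreover have "pure_tensor R (take n us) \<in> carrier (TP n)"
        using False * set_take_subset[of n us] by (intro pure_tensor_closed) auto
      ultimately show ?thesis unfolding tk dr by (simp only: T.add.int_pow_mult)
    qed
  qed (use take in auto)
qed

lemma truncate_ring_hom: "tensor_lift (TP n) tr \<in> ring_hom (tensor_power R m) (TP n)"
proof (rule tensor_lift_ring_hom[OF tensor_power_is_ring multilinear_truncate])
  interpret T: ring "TP n" by (rule tensor_power_is_ring)
  fix xs ys assume xs: "length xs = m" "set xs \<subseteq> carrier R" and ys: "length ys = m" "set ys \<subseteq> carrier R"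
  have prod: "prod_list (map e (map2 (\<otimes>) us vs)) = prod_list (map e us) * prod_list (map e vs)"
    if "length us = length vs" "set us \<subseteq> carrier R" "set vs \<subseteq> carrier R" for us vs
    using that ring_hom_mult[OF e] by (induction us vs rule: list_induct2) auto
  have take: "length (take n xs) = n" "set (take n xs) \<subseteq> carrier R"
    "length (take n ys) = n" "set (take n ys) \<subseteq> carrier R"
    using xs ys le set_take_subset[of n xs] set_take_subset[of n ys] by auto
  have drop: "length (drop n xs) = length (drop n ys)" "set (drop n xs) \<subseteq> carrier R" "set (drop n ys) \<subseteq> carrier R"
    using xs ys le set_drop_subset[of n xs] set_drop_subset[of n ys] by auto
  note cl = pure_tensor_closed[OF take(1,2)] pure_tensor_closed[OF take(3,4)]
  have "tr (map2 (\<otimes>) xs ys) = [(prod_list (map e (drop n xs)) * prod_list (map e (drop n ys)))]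
      \<cdot>\<^bsub>TP n\<^esub> (pure_tensor R (take n xs) \<otimes>\<^bsub>TP n\<^esub> pure_tensor R (take n ys))"
    using take prod[OF drop]
    by (simp add: pure_tensor_mult take_map take_zip drop_map drop_zip)
  also have "\<dots> = tr xs \<otimes>\<^bsub>TP n\<^esub> tr ys"
    using cl by (simp add: T.add_pow_ldistr_int T.add_pow_rdistr_int T.add.int_pow_pow mult.commute)
  finally show "tr (map2 (\<otimes>) xs ys) = tr xs \<otimes>\<^bsub>TP n\<^esub> tr ys" .
next
  interpret T: ring "TP n" by (rule tensor_power_is_ring)
  have "prod_list (map e (replicate k \<one>)) = 1" for k
    using ring_hom_one[OF e] by (induction k) auto
  then show "tr (replicate m \<one>) = \<one>\<^bsub>TP n\<^esub>"
    using le T.one_closed T.add.int_pow_1 by (simp add: one_tensor_power min_absorb1)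
qed

end

end

context finite_group
begin

abbreviation "T n \<equiv> tensor_power Q n"

sublocale T: ring_basis "T n" "Q.words n" Q.word_tensor Q.word_coord for n
  by (rule Q.tensor_power_basis)

lemma word_coord_permute:
  assumes p: "p permutes {..<n}" and w: "w \<in> Q.words n" and t: "t \<in> carrier (T n)"
  shows "Q.word_coord (permute_list p w) (permute_tensor G n p t) = Q.word_coord w t"
proof (rule Q.tensor_hom_eqI[OF abelian_group_int _ _ _ t])
  have pw: "permute_list p w \<in> Q.words n" using p w by (auto simp: Q.words_def)
  show "(\<lambda>t. Q.word_coord (permute_list p w) (permute_tensor G n p t)) \<in> add_hom (T n) \<Z>"
    unfolding permute_tensor_def
    using Q.tensor_lift_hom[OF T.abelian_group_axioms Q.multilinear_permute[OF p]] Q.word_coord_hom[OF pw]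
    by (rule add_hom_compose)
  show "Q.word_coord w \<in> add_hom (T n) \<Z>" using w by (rule Q.word_coord_hom)
  fix qs assume qs: "length qs = n" "set qs \<subseteq> carrier Q"
  then have pqs: "length (permute_list p qs) = n" "set (permute_list p qs) \<subseteq> carrier Q" using p by auto
  have "permute_tensor G n p (pure_tensor Q qs) = pure_tensor Q (permute_list p qs)"
    unfolding permute_tensor_def
    by (rule Q.tensor_lift_pure[OF T.abelian_group_axioms Q.multilinear_permute[OF p] qs])
  then have "Q.word_coord (permute_list p w) (permute_tensor G n p (pure_tensor Q qs))
      = prod_list (map2 letter_coord (permute_list p w) (permute_list p qs))"
    using Q.word_coord_pure[OF pw pqs] by simp
  also have "\<dots> = prod_list (permute_list p (map2 letter_coord w qs))"
    using p w qs by (subst permute_list_map2) (auto simp: Q.words_def)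
  also have "\<dots> = prod_list (map2 letter_coord w qs)"
    using p w qs by (intro prod_list_permute) (auto simp: Q.words_def)
  also have "\<dots> = Q.word_coord w (pure_tensor Q qs)"
    using Q.word_coord_pure[OF w qs] by simp
  finally show "Q.word_coord (permute_list p w) (permute_tensor G n p (pure_tensor Q qs))
      = Q.word_coord w (pure_tensor Q qs)" .
qed

lemma permute_tensor_hom:
  "p permutes {..<n} \<Longrightarrow> permute_tensor G n p \<in> ring_hom (T n) (T n)"
  unfolding permute_tensor_def by (rule Q.permute_ring_hom)

lemma truncate_tensor_hom:
  "n \<le> m \<Longrightarrow> truncate_tensor G n \<in> ring_hom (T m) (T n)"
  unfolding truncate_tensor_def by (rule Q.truncate_ring_hom[OF Q_eval0_hom])

lemma None_letter [simp]: "None \<in> letters"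
  by (simp add: letters_def)

lemma words_pad: "u \<in> Q.words n \<Longrightarrow> n \<le> m \<Longrightarrow> u @ replicate (m - n) None \<in> Q.words m"
  by (auto simp: Q.words_def)

lemma word_coord_truncate:
  assumes le: "n \<le> m" and u: "u \<in> Q.words n" and t: "t \<in> carrier (T m)"
  shows "Q.word_coord u (truncate_tensor G n t) = Q.word_coord (u @ replicate (m - n) None) t"
proof (rule Q.tensor_hom_eqI[OF abelian_group_int _ _ _ t])
  let ?w = "u @ replicate (m - n) None"
  note w = words_pad[OF u le]
  note ml = Q.multilinear_truncate[OF Q_eval0_hom le]
  show "(\<lambda>t. Q.word_coord u (truncate_tensor G n t)) \<in> add_hom (T m) \<Z>"
    unfolding truncate_tensor_def
    using Q.tensor_lift_hom[OF T.abelian_group_axioms ml] Q.word_coord_hom[OF u]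
    by (rule add_hom_compose)
  show "Q.word_coord ?w \<in> add_hom (T m) \<Z>" using w by (rule Q.word_coord_hom)
  fix qs assume qs: "length qs = m" "set qs \<subseteq> carrier Q"
  have take: "length (take n qs) = n" "set (take n qs) \<subseteq> carrier Q"
    using qs le set_take_subset[of n qs] by auto
  have none: "prod_list (map2 letter_coord (replicate (length ys) None) ys) = prod_list (map (Q_eval0 G) ys)"
    if "set ys \<subseteq> carrier Q" for ys
    using that letter_coord_None by (induction ys) (auto simp del: Q_ring_simps letter_coord.simps)
  have drop: "set (drop n qs) \<subseteq> carrier Q" using qs set_drop_subset[of n qs] by auto
  have "truncate_tensor G n (pure_tensor Q qs)
      = [prod_list (map (Q_eval0 G) (drop n qs))] \<cdot>\<^bsub>T n\<^esub> pure_tensor Q (take n qs)"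
    unfolding truncate_tensor_def by (rule Q.tensor_lift_pure[OF T.abelian_group_axioms ml qs])
  then have "Q.word_coord u (truncate_tensor G n (pure_tensor Q qs))
      = prod_list (map (Q_eval0 G) (drop n qs)) * prod_list (map2 letter_coord u (take n qs))"
    using T.coord_simps(4)[OF u Q.pure_tensor_closed[OF take]] Q.word_coord_pure[OF u take] by simp
  also have "\<dots> = prod_list (map2 letter_coord ?w (take n qs @ drop n qs))"
    using none[OF drop] u take qs by (subst map2_append) (auto simp: Q.words_def mult.commute)
  also have "\<dots> = Q.word_coord ?w (pure_tensor Q qs)"
    using Q.word_coord_pure[OF w qs] by simp
  finally show "Q.word_coord u (truncate_tensor G n (pure_tensor Q qs)) = Q.word_coord ?w (pure_tensor Q qs)" .
qed

text \<open>
  A permutation of the factors permutes the coordinates, and two words are permutations of each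
  other exactly if they have the same letters with multiplicity.
\<close>

lemma Lambda_fin_iff:
  "t \<in> Lambda_fin G n \<longleftrightarrow> t \<in> carrier (T n) \<and>
    (\<forall>v\<in>Q.words n. \<forall>w\<in>Q.words n. mset v = mset w \<longrightarrow> Q.word_coord v t = Q.word_coord w t)"
proof (intro iffI conjI ballI impI)
  fix v w assume t: "t \<in> Lambda_fin G n" and vw: "v \<in> Q.words n" "w \<in> Q.words n" "mset v = mset w"
  obtain p where p: "p permutes {..<length w}" "permute_list p w = v"
    using mset_eq_permutation[OF vw(3)] by blast
  then have p': "p permutes {..<n}" using vw by (simp add: Q.words_def)
  then have "permute_tensor G n p t = t" "t \<in> carrier (T n)" using t by (auto simp: Lambda_fin_def)
  then show "Q.word_coord v t = Q.word_coord w t" using word_coord_permute[OF p' vw(2)] p(2) by metis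
next
  assume *: "t \<in> carrier (T n) \<and>
    (\<forall>v\<in>Q.words n. \<forall>w\<in>Q.words n. mset v = mset w \<longrightarrow> Q.word_coord v t = Q.word_coord w t)"
  have "permute_tensor G n p t = t" if p: "p permutes {..<n}" for p
  proof (rule T.coord_eqI)
    show "permute_tensor G n p t \<in> carrier (T n)"
      using ring_hom_closed[OF permute_tensor_hom[OF p]] * by blast
    fix v assume v: "v \<in> Q.words n"
    define w where "w = permute_list (inv_into UNIV p) v"
    have ip: "inv_into UNIV p permutes {..<n}" using p by (rule permutes_inv)
    have w: "w \<in> Q.words n" "mset w = mset v" using v ip by (auto simp: w_def Q.words_def)
    have "permute_list p w = v"
      using permute_list_compose[of p v "inv_into UNIV p"] p v permutes_inv_o(2)[OF p]
      by (simp add: w_def Q.words_def)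
    then show "Q.word_coord v (permute_tensor G n p t) = Q.word_coord v t"
      using word_coord_permute[OF p w(1)] * v w by metis
  qed (use * in blast)
  then show "t \<in> Lambda_fin G n" using * by (simp add: Lambda_fin_def)
qed (simp add: Lambda_fin_def)

section \<open>Degree and weight of words\<close>

definition word_deg :: "('a set \<times> nat) option list \<Rightarrow> nat" where
  "word_deg w = sum_list (map letter_deg w)"

lemma word_coord_degree:
  assumes t: "t \<in> Q_tensor_deg G n k" and w: "w \<in> Q.words n" "word_deg w \<noteq> k"
  shows "Q.word_coord w t = 0"
proof -
  have gen: "t \<in> carrier (T n) \<and> Q.word_coord w t = 0"
    if "length qs = n" "set qs \<subseteq> carrier Q" "sum_list js = k" "t = pure_tensor Q qs"
      "list_all2 (\<lambda>q j. \<exists>a\<in>carrier Z. q = up_ring.monom P a j) qs js" for t qs js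
  proof -
    have "prod_list (map2 letter_coord w qs) = 0 \<or> sum_list (map letter_deg w) = sum_list js"
      if "list_all2 (\<lambda>q j. \<exists>a\<in>carrier Z. q = up_ring.monom P a j) qs js" "length w = length qs"
      using that
    proof (induction qs js arbitrary: w rule: list_all2_induct)
      case (Cons q qs j js)
      then obtain l w' where w: "w = l # w'" by (cases w) auto
      obtain a where a: "a \<in> carrier Z" "q = up_ring.monom P a j" using Cons.hyps(1) by blast
      show ?case
        using Cons.IH[of w'] Cons.prems letter_coord_monom[OF a(1), of l j]
        by (auto simp: w a(2) simp del: class_ring_simps)
    qed simp
    then show ?thesis using that w Q.word_coord_pure[OF w(1) that(1,2)]
      by (auto simp: word_deg_def Q.words_def)
  qed
  have "t \<in> carrier (T n) \<and> Q.word_coord w t = 0"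
    using t unfolding Q_tensor_deg_def
  proof (induction t rule: generate.induct)
    case one
    then show ?case using T.coord_simps(1)[OF w(1)] by simp
  next
    case (incl h)
    then show ?case using gen by auto
  next
    case (inv h)
    then have "h \<in> carrier (T n) \<and> Q.word_coord w h = 0" using gen by auto
    then show ?case using T.coord_simps(3)[OF w(1)] T.a_inv_closed by (simp add: a_inv_def)
  next
    case (eng h1 h2)
    then show ?case using T.coord_simps(2)[OF w(1)] by simp
  qed
  then show ?thesis by blast
qed

lemma Q_tensor_deg_closed: "Q_tensor_deg G n k \<subseteq> carrier (T n)"
  unfolding Q_tensor_deg_def using T.add.generate_incl by (fastforce intro!: T.add.generate_incl)

text \<open>
  The words of degree \<open>k\<close> are among the generators of the degree \<open>k\<close> part, and conversely only
  coordinates at such words can be nonzero on a tensor of monomials of total degree \<open>k\<close>.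
\<close>

lemma Q_tensor_deg_iff:
  "t \<in> Q_tensor_deg G n k \<longleftrightarrow> t \<in> carrier (T n) \<and>
    (\<forall>w\<in>Q.words n. word_deg w \<noteq> k \<longrightarrow> Q.word_coord w t = 0)"
proof (intro iffI conjI ballI impI)
  assume *: "t \<in> carrier (T n) \<and> (\<forall>w\<in>Q.words n. word_deg w \<noteq> k \<longrightarrow> Q.word_coord w t = 0)"
  let ?gens = "{pure_tensor Q qs | qs js.
         qs \<in> carrier (tuple_monoid Q n) \<and> sum_list js = k \<and>
         list_all2 (\<lambda>q j. \<exists>a\<in>carrier Z. q = up_ring.monom P a j) qs js}"
  have sub: "subgroup (Q_tensor_deg G n k) (add_monoid (T n))"
    unfolding Q_tensor_deg_def by (rule T.add.generate_is_subgroup) auto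
  have basis: "Q.word_tensor w \<in> Q_tensor_deg G n k" if w: "w \<in> Q.words n" "word_deg w = k" for w
  proof -
    have "\<exists>a\<in>carrier Z. letter l = up_ring.monom P a (letter_deg l)" if "l \<in> set w" for l
    proof -
      have "l \<in> letters" using that w(1) by (auto simp: Q.words_def)
      then show ?thesis by (rule letter_monom) blast
    qed
    then have "list_all2 (\<lambda>q j. \<exists>a\<in>carrier Z. q = up_ring.monom P a j) (map letter w) (map letter_deg w)"
      by (simp add: list_all2_conv_all_nth del: class_ring_simps)
    moreover have "map letter w \<in> carrier (tuple_monoid Q n)"
      using w(1) Q.basis_closed by (auto simp: Q.words_def simp del: Q_ring_simps)
    ultimately have "Q.word_tensor w \<in> ?gens"
      unfolding Q.word_tensor_def using w(2) unfolding word_deg_def by blast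
    then show ?thesis unfolding Q_tensor_deg_def by (rule generate.incl)
  qed
  have "t = (\<Oplus>\<^bsub>T n\<^esub>w\<in>T.support n t. [Q.word_coord w t] \<cdot>\<^bsub>T n\<^esub> Q.word_tensor w)"
    using * T.support_subset by (intro T.basis_expansion) auto
  also have "\<dots> \<in> Q_tensor_deg G n k"
  proof (rule additive_subgroup_finsum[OF T.abelian_group_axioms additive_subgroup.intro[OF sub]], rule funcsetI)
    fix w assume "w \<in> T.support n t"
    then have "w \<in> Q.words n" "word_deg w = k" using * by (auto simp: T.support_def)
    then show "[Q.word_coord w t] \<cdot>\<^bsub>T n\<^esub> Q.word_tensor w \<in> Q_tensor_deg G n k"
      using T.add.subgroup_int_pow_closed[OF sub basis] by (simp add: add_pow_def)
  qed
  finally show "t \<in> Q_tensor_deg G n k" .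
qed (use Q_tensor_deg_closed word_coord_degree in auto)

lemma word_mult_degree:
  assumes "u \<in> Q.words n" "v \<in> Q.words n" "w \<in> Q.words n"
    and "Q.word_coord w (Q.word_tensor u \<otimes>\<^bsub>T n\<^esub> Q.word_tensor v) \<noteq> 0"
  shows "word_deg w = word_deg u + word_deg v"
proof -
  have "length u = length v" "length v = length w" "set u \<subseteq> letters" "set v \<subseteq> letters"
    using assms by (auto simp: Q.words_def)
  moreover have "prod_list (map2 letter_coord w (map2 (\<otimes>\<^bsub>Q\<^esub>) (map letter u) (map letter v))) \<noteq> 0"
    using assms Q.word_coord_mult[of w n u v] by simp
  ultimately show ?thesis
    unfolding word_deg_def
  proof (induction u v w rule: list_induct3)
    case (Cons a u b v c w)
    then show ?case
      using letter_mult_degree[of a b c] by (auto simp del: Q_ring_simps)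
  qed simp
qed

text \<open>
  The multipartition with the single part \<open>j\<close> at the class \<open>c\<close>.  Multipartitions are added pointwise
  as functions, so that the weight of a word is a sum.
\<close>

fun letter_wt :: "('a set \<times> nat) option \<Rightarrow> 'a set \<Rightarrow> nat multiset" where
  "letter_wt None = 0"
| "letter_wt (Some (c, j)) = (\<lambda>d. if d = c then {#j#} else {#})"

definition word_wt :: "('a set \<times> nat) option list \<Rightarrow> 'a set \<Rightarrow> nat multiset" where
  "word_wt w = sum_list (map letter_wt w)"

lemma word_wt_simps [simp]:
  "word_wt [] = 0" "word_wt (l # w) = letter_wt l + word_wt w" "word_wt (v @ w) = word_wt v + word_wt w"
  by (simp_all add: word_wt_def)

lemma word_wt_replicate_None [simp]: "word_wt (replicate n None) = 0"
  by (induction n) simp_all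

lemma multipartitions_add:
  "l \<in> multipartitions G \<Longrightarrow> m \<in> multipartitions G \<Longrightarrow> l + m \<in> multipartitions G"
  by (auto simp: multipartitions_def)

lemma multipartitions_zero: "0 \<in> multipartitions G"
  by (auto simp: multipartitions_def)

lemma letter_wt_multipartition: "l \<in> letters \<Longrightarrow> letter_wt l \<in> multipartitions G"
  by (erule letter_cases) (auto simp: multipartitions_def)

lemma word_wt_multipartition: "w \<in> Q.words n \<Longrightarrow> word_wt w \<in> multipartitions G"
  by (induction w arbitrary: n)
    (auto simp: Q.words_def multipartitions_zero intro!: multipartitions_add letter_wt_multipartition)

lemma mp_size_add: "mp_size G (l + m) = mp_size G l + mp_size G m"
  by (simp add: mp_size_def sum.distrib)

lemma mp_size_zero: "mp_size G 0 = 0"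
  by (simp add: mp_size_def)

lemma mp_size_letter_wt:
  assumes l: "l \<in> letters"
  shows "mp_size G (letter_wt l) = letter_deg l"
proof (cases rule: letter_cases[OF l])
  case (2 c j)
  have "(\<Sum>d\<in>conj_classes G. sum_mset (letter_wt (Some (c, j)) d)) = (\<Sum>d\<in>conj_classes G. if d = c then j else 0)"
    by (intro sum.cong) auto
  also have "\<dots> = j" using 2 finite_conj_classes by simp
  finally show ?thesis using 2 by (simp add: mp_size_def)
qed (simp add: mp_size_zero)

lemma mp_size_word_wt: "w \<in> Q.words n \<Longrightarrow> mp_size G (word_wt w) = word_deg w"
  by (induction w arbitrary: n) (auto simp: Q.words_def word_deg_def mp_size_zero mp_size_add mp_size_letter_wt)

lemma count_word_wt: "count (word_wt w c) j = count_list w (Some (c, j))"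
proof (induction w)
  case (Cons l w)
  then show ?case by (cases l) (auto split: if_splits)
qed simp

text \<open>
  The weight counts all letters except \<^const>\<open>None\<close>, and the length then fixes the number of those.
\<close>

lemma mset_eq_of_word_wt:
  assumes "length v = length w" "word_wt v = word_wt w"
  shows "mset v = mset w"
proof -
  have some: "count_list v (Some x) = count_list w (Some x)" for x
    using count_word_wt[of v "fst x" "snd x"] count_word_wt[of w "fst x" "snd x"] assms(2) by simp
  have "filter_mset (\<lambda>x. x \<noteq> None) (mset v) = filter_mset (\<lambda>x. x \<noteq> None) (mset w)"
    by (rule multiset_eqI) (use some in \<open>auto simp: count_mset\<close>)
  moreover have "size (mset u) = size (filter_mset (\<lambda>x. x \<noteq> None) (mset u)) + count (mset u) None"
    for u :: "('a set \<times> nat) option list"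
    by (induction u) auto
  ultimately have "count (mset v) None = count (mset w) None"
    using assms(1) by (metis add_left_cancel size_mset)
  then have "count (mset v) x = count (mset w) x" for x
    using some by (cases x) (auto simp: count_mset)
  then show ?thesis by (rule multiset_eqI)
qed

lemma word_of_multipartition:
  assumes "l \<in> multipartitions G"
  shows "\<exists>w. set w \<subseteq> letters \<and> length w \<le> mp_size G l \<and> word_wt w = l"
  using assms
proof (induction "mp_size G l" arbitrary: l rule: less_induct)
  case less
  show ?case
  proof (cases "l = 0")
    case True
    then show ?thesis by (intro exI[of _ "[]"]) simp
  next
    case False
    then obtain c j where cj: "j \<in># l c" by (metis multiset_nonemptyE ext zero_fun_apply zero_multiset_def)
    then have c: "c \<in> conj_classes G" "j \<ge> 1"
      using less.prems by (auto simp: multipartitions_def Suc_le_eq)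
    define m where "m = l(c := l c - {#j#})"
    have lm: "l = letter_wt (Some (c, j)) + m"
      using cj by (auto simp: m_def fun_eq_iff)
    have "m \<in> multipartitions G"
      using less.prems by (auto simp: multipartitions_def m_def dest: in_diffD)
    moreover have "Some (c, j) \<in> letters" using c by (simp add: letters_def)
    moreover from this have size: "mp_size G m < mp_size G l"
      using lm mp_size_add[of "letter_wt (Some (c, j))" m] mp_size_letter_wt[of "Some (c, j)"] c by simp
    ultimately obtain w where "set w \<subseteq> letters" "length w \<le> mp_size G m" "word_wt w = m"
      using less.hyps by blast
    then show ?thesis
      using lm size \<open>Some (c, j) \<in> letters\<close> by (intro exI[of _ "Some (c, j) # w"]) simp
  qed
qed

lemma finite_letters_deg: "finite {l \<in> letters. letter_deg l \<le> d}"
proof -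
  have "{l \<in> letters. letter_deg l \<le> d} \<subseteq> insert None (Some ` (conj_classes G \<times> {..d}))"
    by (auto simp: letters_def)
  then show ?thesis by (rule finite_subset) (simp add: finite_conj_classes)
qed

text \<open>
  There are infinitely many words of length \<open>n\<close>, but only letters of degree at most \<open>d\<close> can
  contribute to a coordinate of degree at most \<open>d\<close>.  These words form a finite range of summation
  that is stable under concatenation.
\<close>

definition bounded_words :: "nat \<Rightarrow> nat \<Rightarrow> ('a set \<times> nat) option list set" where
  "bounded_words d n = {w. set w \<subseteq> {l \<in> letters. letter_deg l \<le> d} \<and> length w = n}"

lemma finite_bounded_words: "finite (bounded_words d n)"
  unfolding bounded_words_def by (rule finite_lists_length_eq[OF finite_letters_deg])

lemma bounded_words_subset: "bounded_words d n \<subseteq> Q.words n"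
  by (auto simp: bounded_words_def Q.words_def)

lemma letter_deg_le: "l \<in> set w \<Longrightarrow> letter_deg l \<le> word_deg w"
  unfolding word_deg_def by (rule member_le_sum_list) auto

lemma words_bounded: "w \<in> Q.words n \<Longrightarrow> word_deg w \<le> d \<Longrightarrow> w \<in> bounded_words d n"
  using letter_deg_le[of _ w] by (fastforce simp: bounded_words_def Q.words_def)

end

section \<open>The ring of symmetric functions\<close>

text \<open>
  A set with operations that embeds into a family of rings compatibly with the operations is a ring
  once it is closed under them.
\<close>

lemma ring_pullback:
  fixes R (structure) and T :: "'n \<Rightarrow> ('b, 'c) ring_scheme" and \<phi> :: "'n \<Rightarrow> 'a \<Rightarrow> 'b"
  assumes T: "\<And>n. ring (T n)"
    and closed: "\<And>n x. x \<in> carrier R \<Longrightarrow> \<phi> n x \<in> carrier (T n)"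
    and ops: "\<And>x y. x \<in> carrier R \<Longrightarrow> y \<in> carrier R \<Longrightarrow> x \<oplus> y \<in> carrier R"
      "\<And>x y. x \<in> carrier R \<Longrightarrow> y \<in> carrier R \<Longrightarrow> x \<otimes> y \<in> carrier R"
      "\<zero> \<in> carrier R" "\<one> \<in> carrier R"
    and neg: "\<And>x. x \<in> carrier R \<Longrightarrow> \<exists>y\<in>carrier R. y \<oplus> x = \<zero>"
    and add: "\<And>n x y. x \<in> carrier R \<Longrightarrow> y \<in> carrier R \<Longrightarrow> \<phi> n (x \<oplus> y) = \<phi> n x \<oplus>\<^bsub>T n\<^esub> \<phi> n y"
    and mult: "\<And>n x y. x \<in> carrier R \<Longrightarrow> y \<in> carrier R \<Longrightarrow> \<phi> n (x \<otimes> y) = \<phi> n x \<otimes>\<^bsub>T n\<^esub> \<phi> n y"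
    and zero: "\<And>n. \<phi> n \<zero> = \<zero>\<^bsub>T n\<^esub>" and one: "\<And>n. \<phi> n \<one> = \<one>\<^bsub>T n\<^esub>"
    and inj: "\<And>x y. x \<in> carrier R \<Longrightarrow> y \<in> carrier R \<Longrightarrow> (\<And>n. \<phi> n x = \<phi> n y) \<Longrightarrow> x = y"
  shows "ring R"
proof -
  interpret T: ring "T n" for n by (rule T)
  note simps = closed ops add mult zero one
  show ?thesis
  proof (rule ringI)
    show "abelian_group R"
      by (rule abelian_groupI)
        (auto intro!: inj neg simp: simps T.a_assoc, auto intro!: inj simp: simps T.a_comm)
    show "Group.monoid R"
      by (rule monoidI) (auto intro!: inj simp: simps T.m_assoc)
  qed (auto intro!: inj simp: simps T.l_distr T.r_distr)
qed

context finite_group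
begin

abbreviation "\<Lambda> \<equiv> Lambda G"

lemma Lambda_simps:
  "f \<otimes>\<^bsub>\<Lambda>\<^esub> g = (\<lambda>k n. \<Oplus>\<^bsub>T n\<^esub>i\<in>{..k}. f i n \<otimes>\<^bsub>T n\<^esub> g (k - i) n)"
  "\<one>\<^bsub>\<Lambda>\<^esub> = (\<lambda>k n. if k = 0 then \<one>\<^bsub>T n\<^esub> else \<zero>\<^bsub>T n\<^esub>)"
  "\<zero>\<^bsub>\<Lambda>\<^esub> = (\<lambda>k n. \<zero>\<^bsub>T n\<^esub>)"
  "f \<oplus>\<^bsub>\<Lambda>\<^esub> g = (\<lambda>k n. f k n \<oplus>\<^bsub>T n\<^esub> g k n)"
  "carrier \<Lambda> = {f. (\<forall>k. f k \<in> Lambda_deg G k) \<and> finite {k. f k \<noteq> (\<lambda>n. \<zero>\<^bsub>T n\<^esub>)}}"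
  by (simp_all add: Lambda_def)

lemma Lambda_degD:
  assumes "g \<in> Lambda_deg G k"
  shows "g n \<in> carrier (T n)" "g n \<in> Lambda_fin G n" "g n \<in> Q_tensor_deg G n k"
    and "n \<le> m \<Longrightarrow> u \<in> Q.words n \<Longrightarrow> Q.word_coord u (g n) = Q.word_coord (u @ replicate (m - n) None) (g m)"
proof -
  show gn: "g n \<in> Lambda_fin G n" "g n \<in> Q_tensor_deg G n k" "g n \<in> carrier (T n)" for n
    using assms by (auto simp: Lambda_deg_def Lambda_fin_deg_def Lambda_fin_def)
  assume *: "n \<le> m" "u \<in> Q.words n"
  show "Q.word_coord u (g n) = Q.word_coord (u @ replicate (m - n) None) (g m)"
  proof (cases "n < m")
    case True
    then have "truncate_tensor G n (g m) = g n" using assms by (auto simp: Lambda_deg_def)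
    then show ?thesis using word_coord_truncate[OF * gn(3)] by metis
  qed (use * in simp)
qed

text \<open>
  The shorter word is padded with \<^const>\<open>None\<close> to the length of the other, which is harmless by
  compatibility with truncation; then the two words are permutations of each other.
\<close>

lemma coord_depends_on_weight:
  assumes g: "g \<in> Lambda_deg G k" and v: "v \<in> Q.words m" and w: "w \<in> Q.words n"
    and wt: "word_wt v = word_wt w"
  shows "Q.word_coord v (g m) = Q.word_coord w (g n)"
proof -
  have *: "Q.word_coord v (g m) = Q.word_coord w (g n)"
    if v: "v \<in> Q.words m" and w: "w \<in> Q.words n" and wt: "word_wt v = word_wt w" and le: "n \<le> m" for v w m n
  proof -
    let ?w = "w @ replicate (m - n) None"
    have w': "?w \<in> Q.words m" using words_pad[OF w le] .
    then have "mset v = mset ?w"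
      using v wt by (intro mset_eq_of_word_wt) (auto simp: Q.words_def)
    then have "Q.word_coord v (g m) = Q.word_coord ?w (g m)"
      using Lambda_degD(2)[OF g, of m, unfolded Lambda_fin_iff] v w' by blast
    then show ?thesis using Lambda_degD(4)[OF g le w] by simp
  qed
  show ?thesis
    using *[OF v w wt] *[OF w v wt[symmetric]] by (cases "n \<le> m") auto
qed

lemma word_wt_mset: "mset v = mset w \<Longrightarrow> word_wt v = word_wt w"
  unfolding word_wt_def by (metis mset_map sum_mset_sum_list)

lemma Lambda_degI:
  assumes closed: "\<And>n. g n \<in> carrier (T n)"
    and coord: "\<And>n w. w \<in> Q.words n \<Longrightarrow> Q.word_coord w (g n) = (if k = word_deg w then F (word_wt w) else 0)"
  shows "g \<in> Lambda_deg G k"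
proof -
  have "g n \<in> Lambda_fin G n" for n
    unfolding Lambda_fin_iff
  proof (intro conjI ballI impI closed)
    fix v w assume vw: "v \<in> Q.words n" "w \<in> Q.words n" "mset v = mset w"
    then have "word_deg v = word_deg w" "word_wt v = word_wt w"
      using word_wt_mset mp_size_word_wt by metis+
    then show "Q.word_coord v (g n) = Q.word_coord w (g n)" using coord vw by simp
  qed
  moreover have "g n \<in> Q_tensor_deg G n k" for n
    unfolding Q_tensor_deg_iff using closed coord by auto
  moreover have "truncate_tensor G n (g m) = g n" if nm: "n < m" for n m
  proof (rule T.coord_eqI)
    show "truncate_tensor G n (g m) \<in> carrier (T n)"
      using ring_hom_closed[OF truncate_tensor_hom closed] nm by simp
    fix u assume u: "u \<in> Q.words n"
    then have "word_deg (u @ replicate (m - n) None) = word_deg u"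
      by (simp add: word_deg_def sum_list_replicate)
    then show "Q.word_coord u (truncate_tensor G n (g m)) = Q.word_coord u (g n)"
      using word_coord_truncate[OF _ u closed[of m]] words_pad[OF u, of m] coord u nm by simp
  qed (rule closed)
  ultimately show ?thesis by (simp add: Lambda_deg_def Lambda_fin_deg_def)
qed

text \<open>
  Converse of the description by functions of the weight: every such function of finite support
  defines an element.
\<close>

lemma LambdaI:
  assumes closed: "\<And>k n. f k n \<in> carrier (T n)"
    and coord: "\<And>k n w. w \<in> Q.words n \<Longrightarrow>
      Q.word_coord w (f k n) = (if k = word_deg w then F (word_wt w) else 0)"
    and fin: "finite {l \<in> multipartitions G. F l \<noteq> 0}"
  shows "f \<in> carrier \<Lambda>"
proof -
  have "{k. f k \<noteq> (\<lambda>n. \<zero>\<^bsub>T n\<^esub>)} \<subseteq> mp_size G ` {l \<in> multipartitions G. F l \<noteq> 0}"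
  proof clarify
    fix k assume "f k \<noteq> (\<lambda>n. \<zero>\<^bsub>T n\<^esub>)"
    then obtain n where "f k n \<noteq> \<zero>\<^bsub>T n\<^esub>" by blast
    then obtain w where w: "w \<in> Q.words n" "Q.word_coord w (f k n) \<noteq> 0"
      using T.coord_separates[OF closed] by blast
    then have "k = mp_size G (word_wt w)" "F (word_wt w) \<noteq> 0"
      using coord[OF w(1), of k] mp_size_word_wt[OF w(1)] by (auto split: if_splits)
    then show "k \<in> mp_size G ` {l \<in> multipartitions G. F l \<noteq> 0}"
      using word_wt_multipartition[OF w(1)] by blast
  qed
  then have "finite {k. f k \<noteq> (\<lambda>n. \<zero>\<^bsub>T n\<^esub>)}" using fin finite_subset by blast
  moreover have "f k \<in> Lambda_deg G k" for k
    using closed coord by (rule Lambda_degI)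
  ultimately show ?thesis by (simp add: Lambda_simps)
qed

definition rep_word :: "('a set \<Rightarrow> nat multiset) \<Rightarrow> ('a set \<times> nat) option list" where
  "rep_word l = (SOME w. set w \<subseteq> letters \<and> word_wt w = l)"

text \<open>
  The choice of the word of weight \<open>l\<close> does not matter, by \<open>coord_depends_on_weight\<close>.
\<close>

definition Lambda_coord :: "('a set \<Rightarrow> nat multiset) \<Rightarrow> (nat \<Rightarrow> nat \<Rightarrow> 'a Q_tensor) \<Rightarrow> int" where
  "Lambda_coord l f = Q.word_coord (rep_word l) (f (mp_size G l) (length (rep_word l)))"

lemma rep_word:
  assumes "l \<in> multipartitions G"
  shows "rep_word l \<in> Q.words (length (rep_word l))" "word_wt (rep_word l) = l"
proof -
  obtain w where "set w \<subseteq> letters \<and> word_wt w = l"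
    using word_of_multipartition[OF assms] by blast
  then have "set (rep_word l) \<subseteq> letters \<and> word_wt (rep_word l) = l"
    unfolding rep_word_def by (rule someI)
  then show "rep_word l \<in> Q.words (length (rep_word l))" "word_wt (rep_word l) = l"
    by (auto simp: Q.words_def)
qed

lemma Lambda_closed: "f \<in> carrier \<Lambda> \<Longrightarrow> f k n \<in> carrier (T n)"
  using Lambda_degD(1) by (auto simp: Lambda_simps)

lemma word_coord_Lambda:
  assumes f: "f \<in> carrier \<Lambda>" and w: "w \<in> Q.words n"
  shows "Q.word_coord w (f k n) = (if k = word_deg w then Lambda_coord (word_wt w) f else 0)"
proof (cases "k = word_deg w")
  case True
  note wt = word_wt_multipartition[OF w]
  have "f k \<in> Lambda_deg G k" using f by (simp add: Lambda_simps)
  then have "Q.word_coord w (f k n) = Q.word_coord (rep_word (word_wt w)) (f k (length (rep_word (word_wt w))))"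
    using w rep_word[OF wt] by (intro coord_depends_on_weight) auto
  then show ?thesis using True mp_size_word_wt[OF w] by (simp add: Lambda_coord_def)
next
  case False
  have "f k n \<in> Q_tensor_deg G n k" using f Lambda_degD(3) by (auto simp: Lambda_simps)
  then show ?thesis using False word_coord_degree[OF _ w] by simp
qed

lemma Lambda_coord_unique:
  assumes "\<And>k n w. w \<in> Q.words n \<Longrightarrow>
      Q.word_coord w (f k n) = (if k = word_deg w then F (word_wt w) else 0)"
    and l: "l \<in> multipartitions G"
  shows "Lambda_coord l f = F l"
  using assms(1)[OF rep_word(1)[OF l], of "mp_size G l"] rep_word(2)[OF l] mp_size_word_wt[OF rep_word(1)[OF l]]
  by (simp add: Lambda_coord_def)

lemma finite_multipartitions: "finite {l \<in> multipartitions G. mp_size G l \<le> d}"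
proof -
  have "{l \<in> multipartitions G. mp_size G l \<le> d} \<subseteq> word_wt ` bounded_words d d"
  proof clarify
    fix l assume l: "l \<in> multipartitions G" "mp_size G l \<le> d"
    obtain w where w: "set w \<subseteq> letters" "length w \<le> mp_size G l" "word_wt w = l"
      using word_of_multipartition[OF l(1)] by blast
    define v where "v = w @ replicate (d - length w) None"
    have "v \<in> Q.words d" "word_wt v = l" using w l(2) by (auto simp: v_def Q.words_def)
    then show "l \<in> word_wt ` bounded_words d d"
      using words_bounded[of v d d] mp_size_word_wt[of v d] l(2) by auto
  qed
  then show ?thesis using finite_bounded_words finite_subset by blast
qed

lemma Lambda_bound:
  assumes "f \<in> carrier \<Lambda>"
  obtains N where "\<And>k n. N < k \<Longrightarrow> f k n = \<zero>\<^bsub>T n\<^esub>"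
proof -
  have "finite {k. f k \<noteq> (\<lambda>n. \<zero>\<^bsub>T n\<^esub>)}" using assms by (simp add: Lambda_simps)
  then obtain N where "\<forall>k\<in>{k. f k \<noteq> (\<lambda>n. \<zero>\<^bsub>T n\<^esub>)}. k \<le> N"
    using finite_nat_set_iff_bounded_le by blast
  then have "f k n = \<zero>\<^bsub>T n\<^esub>" if "N < k" for k n
    using that by (metis (mono_tags, lifting) leD mem_Collect_eq)
  then show ?thesis by (rule that)
qed

lemma finite_Lambda_coord:
  assumes f: "f \<in> carrier \<Lambda>"
  shows "finite {l \<in> multipartitions G. Lambda_coord l f \<noteq> 0}"
proof -
  obtain N where N: "\<And>k n. N < k \<Longrightarrow> f k n = \<zero>\<^bsub>T n\<^esub>" using Lambda_bound[OF f] by blast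
  have "mp_size G l \<le> N" if "l \<in> multipartitions G" "Lambda_coord l f \<noteq> 0" for l
    using that N[of "mp_size G l"] T.coord_simps(1)[OF rep_word(1)[OF that(1)]]
    unfolding Lambda_coord_def by (metis not_le)
  then have "{l \<in> multipartitions G. Lambda_coord l f \<noteq> 0} \<subseteq> {l \<in> multipartitions G. mp_size G l \<le> N}"
    by blast
  then show ?thesis using finite_multipartitions finite_subset by blast
qed

lemma Lambda_zero: "\<zero>\<^bsub>\<Lambda>\<^esub> \<in> carrier \<Lambda>"
  by (rule LambdaI[where F = "\<lambda>_. 0"]) (auto simp: Lambda_simps T.coord_simps)

lemma word_coord_Lambda_one:
  assumes w: "w \<in> Q.words n"
  shows "Q.word_coord w (\<one>\<^bsub>\<Lambda>\<^esub> k n) = (if k = word_deg w then (if word_wt w = 0 then 1 else 0) else 0)"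
proof -
  let ?o = "replicate n None"
  have o: "?o \<in> Q.words n" by (auto simp: Q.words_def)
  have one: "\<one>\<^bsub>T n\<^esub> = Q.word_tensor ?o"
    using Q.one_tensor_power by (simp add: Q.word_tensor_def)
  have "w = ?o" if "word_wt w = 0"
  proof -
    have "mset w = mset ?o"
      using w that by (intro mset_eq_of_word_wt) (auto simp: Q.words_def)
    then have "set w = set ?o" by (rule mset_eq_setD)
    then show ?thesis using w by (auto simp: Q.words_def intro!: replicate_eqI)
  qed
  then have iff: "w = ?o \<longleftrightarrow> word_wt w = 0" by auto
  have "word_deg w = 0" if "word_wt w = 0"
    using mp_size_word_wt[OF w] that by (simp add: mp_size_zero)
  then show ?thesis
    using w o T.coord_basis[OF w o] T.coord_simps(1)[OF w] iff by (auto simp: Lambda_simps one)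
qed

lemma Lambda_one: "\<one>\<^bsub>\<Lambda>\<^esub> \<in> carrier \<Lambda>"
proof (rule LambdaI)
  show "\<one>\<^bsub>\<Lambda>\<^esub> k n \<in> carrier (T n)" for k n by (simp add: Lambda_simps)
  have "{l \<in> multipartitions G. (if l = 0 then 1 else 0 :: int) \<noteq> 0} \<subseteq> {0}" by auto
  then show "finite {l \<in> multipartitions G. (if l = 0 then 1 else 0 :: int) \<noteq> 0}"
    by (rule finite_subset) simp
qed (rule word_coord_Lambda_one)

lemma word_coord_Lambda_add:
  assumes f: "f \<in> carrier \<Lambda>" and g: "g \<in> carrier \<Lambda>" and w: "w \<in> Q.words n"
  shows "Q.word_coord w ((f \<oplus>\<^bsub>\<Lambda>\<^esub> g) k n)
    = (if k = word_deg w then Lambda_coord (word_wt w) f + Lambda_coord (word_wt w) g else 0)"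
  using word_coord_Lambda[OF f w] word_coord_Lambda[OF g w] T.coord_simps(2)[OF w Lambda_closed[OF f] Lambda_closed[OF g]]
  by (simp add: Lambda_simps)

lemma Lambda_add:
  assumes f: "f \<in> carrier \<Lambda>" and g: "g \<in> carrier \<Lambda>"
  shows "f \<oplus>\<^bsub>\<Lambda>\<^esub> g \<in> carrier \<Lambda>"
proof (rule LambdaI)
  show "(f \<oplus>\<^bsub>\<Lambda>\<^esub> g) k n \<in> carrier (T n)" for k n
    using Lambda_closed[OF f] Lambda_closed[OF g] by (simp add: Lambda_simps)
  have "{l \<in> multipartitions G. Lambda_coord l f + Lambda_coord l g \<noteq> 0}
      \<subseteq> {l \<in> multipartitions G. Lambda_coord l f \<noteq> 0} \<union> {l \<in> multipartitions G. Lambda_coord l g \<noteq> 0}"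
    by auto
  then show "finite {l \<in> multipartitions G. Lambda_coord l f + Lambda_coord l g \<noteq> 0}"
    by (rule finite_subset) (simp add: finite_Lambda_coord f g)
qed (rule word_coord_Lambda_add[OF f g])

lemma Lambda_neg:
  assumes f: "f \<in> carrier \<Lambda>"
  shows "\<exists>g\<in>carrier \<Lambda>. g \<oplus>\<^bsub>\<Lambda>\<^esub> f = \<zero>\<^bsub>\<Lambda>\<^esub>"
proof (rule bexI)
  let ?g = "\<lambda>k n. \<ominus>\<^bsub>T n\<^esub> f k n"
  show "?g \<in> carrier \<Lambda>"
  proof (rule LambdaI[where F = "\<lambda>l. - Lambda_coord l f"])
    fix k n w assume w: "w \<in> Q.words n"
    show "Q.word_coord w (?g k n) = (if k = word_deg w then - Lambda_coord (word_wt w) f else 0)"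
      using word_coord_Lambda[OF f w] T.coord_simps(3)[OF w Lambda_closed[OF f]] by simp
  qed (use Lambda_closed[OF f] finite_Lambda_coord[OF f] in auto)
  show "?g \<oplus>\<^bsub>\<Lambda>\<^esub> f = \<zero>\<^bsub>\<Lambda>\<^esub>"
    using Lambda_closed[OF f] by (simp add: Lambda_simps T.l_neg)
qed

lemma Q_tensor_deg_mult:
  assumes s: "s \<in> Q_tensor_deg G n i" and t: "t \<in> Q_tensor_deg G n j"
  shows "s \<otimes>\<^bsub>T n\<^esub> t \<in> Q_tensor_deg G n (i + j)"
  unfolding Q_tensor_deg_iff
proof (intro conjI ballI impI)
  have cl: "s \<in> carrier (T n)" "t \<in> carrier (T n)" using s t Q_tensor_deg_closed by blast+
  then show "s \<otimes>\<^bsub>T n\<^esub> t \<in> carrier (T n)" by simp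
  fix w assume w: "w \<in> Q.words n" "word_deg w \<noteq> i + j"
  have "Q.word_coord w (s \<otimes>\<^bsub>T n\<^esub> t) = (\<Sum>u\<in>T.support n s. \<Sum>v\<in>T.support n t.
      Q.word_coord u s * Q.word_coord v t * Q.word_coord w (Q.word_tensor u \<otimes>\<^bsub>T n\<^esub> Q.word_tensor v))"
    using cl w(1) T.support_subset by (intro T.coord_mult) auto
  also have "\<dots> = 0"
  proof (intro sum.neutral ballI)
    fix u v assume u: "u \<in> T.support n s" and v: "v \<in> T.support n t"
    then have uv: "u \<in> Q.words n" "v \<in> Q.words n" using T.support_subset by blast+
    then have "word_deg u = i" "word_deg v = j"
      using u v s t by (auto simp: T.support_def Q_tensor_deg_iff)
    then have "Q.word_coord w (Q.word_tensor u \<otimes>\<^bsub>T n\<^esub> Q.word_tensor v) = 0"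
      using word_mult_degree[OF uv w(1)] w(2) by auto
    then show "Q.word_coord u s * Q.word_coord v t * Q.word_coord w (Q.word_tensor u \<otimes>\<^bsub>T n\<^esub> Q.word_tensor v) = 0"
      by simp
  qed
  finally show "Q.word_coord w (s \<otimes>\<^bsub>T n\<^esub> t) = 0" .
qed

text \<open>
  Permutations and truncations are ring homomorphisms, so they respect the Cauchy products that
  define the multiplication.
\<close>

lemma Lambda_mult:
  assumes f: "f \<in> carrier \<Lambda>" and g: "g \<in> carrier \<Lambda>"
  shows "f \<otimes>\<^bsub>\<Lambda>\<^esub> g \<in> carrier \<Lambda>"
proof -
  note fc = Lambda_closed[OF f] and gc = Lambda_closed[OF g]
  have fd: "f k \<in> Lambda_deg G k" and gd: "g k \<in> Lambda_deg G k" for k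
    using f g by (simp_all add: Lambda_simps)
  let ?t = "\<lambda>k n i. f i n \<otimes>\<^bsub>T n\<^esub> g (k - i) n"
  have closed: "?t k n i \<in> carrier (T n)" for k n i using fc gc by simp
  have hom: "h (\<Oplus>\<^bsub>T n\<^esub>i\<in>{..k}. ?t k n i) = (\<Oplus>\<^bsub>T m\<^esub>i\<in>{..k}. ?t k m i)"
    if h: "h \<in> ring_hom (T n) (T m)" and hf: "\<And>i. h (f i n) = f i m" and hg: "\<And>i. h (g i n) = g i m" for h k n m
  proof -
    have "h (\<Oplus>\<^bsub>T n\<^esub>i\<in>{..k}. ?t k n i) = (\<Oplus>\<^bsub>T m\<^esub>i\<in>{..k}. h (?t k n i))"
      using closed by (intro add_hom_finsum[OF T.abelian_group_axioms T.abelian_group_axioms ring_hom_add_hom[OF h]]) auto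
    then show ?thesis using ring_hom_mult[OF h fc gc] hf hg by simp
  qed
  have "(f \<otimes>\<^bsub>\<Lambda>\<^esub> g) k \<in> Lambda_deg G k" for k
    unfolding Lambda_deg_def Lambda_fin_deg_def
  proof (intro CollectI conjI allI impI IntI)
    fix n
    show "(f \<otimes>\<^bsub>\<Lambda>\<^esub> g) k n \<in> Lambda_fin G n"
      unfolding Lambda_fin_def Lambda_simps
    proof (intro CollectI conjI allI impI)
      show "(\<Oplus>\<^bsub>T n\<^esub>i\<in>{..k}. ?t k n i) \<in> carrier (T n)"
        using closed by (intro T.finsum_closed) auto
      fix p assume p: "p permutes {..<n}"
      show "permute_tensor G n p (\<Oplus>\<^bsub>T n\<^esub>i\<in>{..k}. ?t k n i) = (\<Oplus>\<^bsub>T n\<^esub>i\<in>{..k}. ?t k n i)"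
        using Lambda_degD(2)[OF fd, of _ n] Lambda_degD(2)[OF gd, of _ n] p
        by (intro hom permute_tensor_hom) (auto simp: Lambda_fin_def)
    qed
    have sub: "additive_subgroup (Q_tensor_deg G n k) (T n)"
      unfolding Q_tensor_deg_def
      by (intro additive_subgroup.intro T.add.generate_is_subgroup) auto
    have "?t k n i \<in> Q_tensor_deg G n k" if "i \<le> k" for i
      using Q_tensor_deg_mult[OF Lambda_degD(3)[OF fd] Lambda_degD(3)[OF gd], of n i "k - i"] that by simp
    then show "(f \<otimes>\<^bsub>\<Lambda>\<^esub> g) k n \<in> Q_tensor_deg G n k"
      unfolding Lambda_simps by (intro additive_subgroup_finsum[OF T.abelian_group_axioms sub]) auto
    fix m assume "n < m"
    then show "truncate_tensor G n ((f \<otimes>\<^bsub>\<Lambda>\<^esub> g) k m) = (f \<otimes>\<^bsub>\<Lambda>\<^esub> g) k n"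
      unfolding Lambda_simps using fd gd
      by (intro hom truncate_tensor_hom) (auto simp: Lambda_deg_def)
  qed
  moreover have "finite {k. (f \<otimes>\<^bsub>\<Lambda>\<^esub> g) k \<noteq> (\<lambda>n. \<zero>\<^bsub>T n\<^esub>)}"
  proof -
    obtain M N where M: "\<And>k n. M < k \<Longrightarrow> f k n = \<zero>\<^bsub>T n\<^esub>" and N: "\<And>k n. N < k \<Longrightarrow> g k n = \<zero>\<^bsub>T n\<^esub>"
      using Lambda_bound[OF f] Lambda_bound[OF g] by metis
    have "(f \<otimes>\<^bsub>\<Lambda>\<^esub> g) k n = \<zero>\<^bsub>T n\<^esub>" if "M + N < k" for k n
    proof -
      have "?t k n i = \<zero>\<^bsub>T n\<^esub>" for i
      proof (cases "M < i")
        case True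
        then show ?thesis using M gc by simp
      next
        case False
        then have "N < k - i" using that by simp
        then show ?thesis using N fc by simp
      qed
      then show ?thesis by (simp add: Lambda_simps)
    qed
    then have "{k. (f \<otimes>\<^bsub>\<Lambda>\<^esub> g) k \<noteq> (\<lambda>n. \<zero>\<^bsub>T n\<^esub>)} \<subseteq> {..M + N}"
      by (auto simp: not_le[symmetric])
    then show ?thesis using finite_subset by blast
  qed
  ultimately show ?thesis by (simp add: Lambda_simps(5))
qed

text \<open>
  For fixed \<open>n\<close>, the components \<open>f k n\<close> are the coefficients of a polynomial in \<open>k\<close> over the tensor
  power \<open>T n\<close>, and the operations of \<open>\<Lambda>\<close> are those of polynomials.  So \<open>\<Lambda>\<close> embeds into the family
  of these polynomial rings.
\<close>

lemma Lambda_is_ring: "ring \<Lambda>"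
proof (rule ring_pullback[where T = "\<lambda>n. UP (T n)" and \<phi> = "\<lambda>n f k. f k n"])
  show "ring (UP (T n))" for n
  proof -
    interpret UP_ring "T n" "UP (T n)" by unfold_locales
    show ?thesis by (rule UP_ring)
  qed
  have up: "(\<lambda>k. f k n) \<in> up (T n)" if f: "f \<in> carrier \<Lambda>" for f n
  proof -
    obtain N where "\<And>k n. N < k \<Longrightarrow> f k n = \<zero>\<^bsub>T n\<^esub>" using Lambda_bound[OF f] by blast
    then have "bound \<zero>\<^bsub>T n\<^esub> N (\<lambda>k. f k n)" by (intro bound.intro)
    then show ?thesis using Lambda_closed[OF f] by (intro mem_upI) auto
  qed
  then show "(\<lambda>k. f k n) \<in> carrier (UP (T n))" if "f \<in> carrier \<Lambda>" for f n
    using that by (simp add: UP_def)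
  show "(\<lambda>k. (f \<oplus>\<^bsub>\<Lambda>\<^esub> g) k n) = (\<lambda>k. f k n) \<oplus>\<^bsub>UP (T n)\<^esub> (\<lambda>k. g k n)"
    "(\<lambda>k. (f \<otimes>\<^bsub>\<Lambda>\<^esub> g) k n) = (\<lambda>k. f k n) \<otimes>\<^bsub>UP (T n)\<^esub> (\<lambda>k. g k n)"
    if "f \<in> carrier \<Lambda>" "g \<in> carrier \<Lambda>" for f g n
    using up[OF that(1)] up[OF that(2)] by (simp_all add: UP_def Lambda_simps)
  show "f = g" if "\<And>n. (\<lambda>k. f k n) = (\<lambda>k. g k n)" for f g :: "nat \<Rightarrow> nat \<Rightarrow> 'a Q_tensor"
    using that by (metis ext)
qed (simp_all only: Lambda_add Lambda_mult Lambda_zero Lambda_one Lambda_neg, simp_all add: UP_def Lambda_simps)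

sublocale \<Lambda>: ring \<Lambda> by (rule Lambda_is_ring)

section \<open>The basis of monomial symmetric functions\<close>

lemma letter_inj: "inj_on letter letters"
proof (rule inj_onI)
  fix i j assume "i \<in> letters" "j \<in> letters" "letter i = letter j"
  then show "i = j" using Q.coord_basis[of i i] Q.coord_basis[of i j] by (simp split: if_splits)
qed

lemma Q_basis_eq: "Q_basis G = letter ` letters"
proof (intro equalityI subsetI)
  fix q assume "q \<in> Q_basis G"
  then consider "q = \<one>\<^bsub>Q\<^esub>" | c j where "q = class_monom G c j" "c \<in> conj_classes G" "j \<ge> 1"
    unfolding Q_basis_def by blast
  then show "q \<in> letter ` letters"
  proof cases
    case 1
    then show ?thesis by (intro image_eqI[of _ _ None]) auto
  next
    case (2 c j)
    then show ?thesis by (intro image_eqI[of _ _ "Some (c, j)"]) (auto simp: letters_def)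
  qed
next
  fix q assume "q \<in> letter ` letters"
  then show "q \<in> Q_basis G"
    unfolding Q_basis_def by (elim imageE letter_cases) auto
qed

lemma count_list_map_inj:
  "inj_on f A \<Longrightarrow> set xs \<subseteq> A \<Longrightarrow> x \<in> A \<Longrightarrow> count_list (map f xs) (f x) = count_list xs x"
  by (induction xs) (auto dest: inj_onD)

definition weight_words :: "('a set \<Rightarrow> nat multiset) \<Rightarrow> nat \<Rightarrow> ('a set \<times> nat) option list set" where
  "weight_words l n = {w \<in> Q.words n. word_wt w = l}"

lemma finite_weight_words: "finite (weight_words l n)"
proof -
  have "weight_words l n \<subseteq> bounded_words (mp_size G l) n"
    using words_bounded mp_size_word_wt by (fastforce simp: weight_words_def)
  then show ?thesis using finite_bounded_words finite_subset by blast
qed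

text \<open>
  The condition on multiplicities in the definition of the monomial symmetric polynomial says that
  the word of letters has weight \<open>l\<close>.
\<close>

lemma monomial_poly_eq:
  assumes l: "l \<in> multipartitions G"
  shows "monomial_poly G l n = (\<Oplus>\<^bsub>T n\<^esub>w\<in>weight_words l n. Q.word_tensor w)"
proof -
  let ?S = "{qs. length qs = n \<and> set qs \<subseteq> Q_basis G \<and>
            (\<forall>c\<in>conj_classes G. \<forall>j\<ge>1. count_list qs (class_monom G c j) = count (l c) j)}"
  have iff: "(\<forall>c\<in>conj_classes G. \<forall>j\<ge>1. count_list (map letter w) (class_monom G c j) = count (l c) j)
      \<longleftrightarrow> word_wt w = l" if w: "w \<in> Q.words n" for w
  proof -
    have "count_list (map letter w) (class_monom G c j) = count (word_wt w c) j"
      if "c \<in> conj_classes G" "j \<ge> 1" for c j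
    proof -
      have "Some (c, j) \<in> letters" using that by (simp add: letters_def)
      then show ?thesis
        using count_list_map_inj[OF letter_inj, of w "Some (c, j)"] w
        by (simp add: Q.words_def count_word_wt)
    qed
    then have "(\<forall>c\<in>conj_classes G. \<forall>j\<ge>1. count_list (map letter w) (class_monom G c j) = count (l c) j)
      \<longleftrightarrow> (\<forall>c\<in>conj_classes G. \<forall>j\<ge>1. count (word_wt w c) j = count (l c) j)" by simp
    also have "\<dots> \<longleftrightarrow> word_wt w = l"
    proof
      assume *: "\<forall>c\<in>conj_classes G. \<forall>j\<ge>1. count (word_wt w c) j = count (l c) j"
      show "word_wt w = l"
      proof (intro ext multiset_eqI)
        fix c j
        have "word_wt w \<in> multipartitions G" using w by (rule word_wt_multipartition)
        then show "count (word_wt w c) j = count (l c) j"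
          using * l by (cases "c \<in> conj_classes G"; cases "j = 0")
            (auto simp: multipartitions_def not_in_iff)
      qed
    qed simp
    finally show ?thesis .
  qed
  have "?S = map letter ` weight_words l n"
  proof (intro equalityI subsetI)
    fix qs assume qs: "qs \<in> ?S"
    then have "qs \<in> lists (letter ` letters)" by (auto simp: Q_basis_eq)
    then obtain w where w: "qs = map letter w" "set w \<subseteq> letters" by (auto simp: lists_image)
    then have "w \<in> Q.words n" using qs by (auto simp: Q.words_def)
    then show "qs \<in> map letter ` weight_words l n"
      using iff qs w by (auto simp: weight_words_def)
  next
    fix qs assume "qs \<in> map letter ` weight_words l n"
    then obtain w where w: "qs = map letter w" "w \<in> Q.words n" "word_wt w = l"
      by (auto simp: weight_words_def)
    then show "qs \<in> ?S" using iff[OF w(2)] by (auto simp: Q.words_def Q_basis_eq)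
  qed
  moreover have "inj_on (map letter) (weight_words l n)"
    using letter_inj by (intro inj_on_mapI inj_on_subset[OF letter_inj]) (auto simp: weight_words_def Q.words_def)
  moreover have "pure_tensor Q \<in> map letter ` weight_words l n \<rightarrow> carrier (T n)"
    using Q.word_tensor_closed by (auto simp: weight_words_def Q.word_tensor_def[symmetric])
  ultimately show ?thesis
    unfolding monomial_poly_def by (simp add: T.finsum_reindex Q.word_tensor_def[abs_def])
qed

lemma word_coord_monomial_sym:
  assumes l: "l \<in> multipartitions G" and w: "w \<in> Q.words n"
  shows "Q.word_coord w (monomial_sym G l k n)
    = (if k = word_deg w then (if word_wt w = l then 1 else 0) else 0)"
proof -
  have cl: "Q.word_tensor \<in> weight_words l n \<rightarrow> carrier (T n)"
    using Q.word_tensor_closed by (auto simp: weight_words_def)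
  have "Q.word_coord w (monomial_poly G l n) = (\<Sum>v\<in>weight_words l n. Q.word_coord w (Q.word_tensor v))"
    unfolding monomial_poly_eq[OF l] using cl by (rule T.coord_simps(5)[OF w])
  also have "\<dots> = (\<Sum>v\<in>weight_words l n. if v = w then 1 else 0)"
    using w by (intro sum.cong) (auto simp: T.coord_basis weight_words_def)
  also have "\<dots> = (if word_wt w = l then 1 else 0)"
    using w finite_weight_words by (simp add: weight_words_def)
  finally show ?thesis
    using mp_size_word_wt[OF w] T.coord_simps(1)[OF w] by (auto simp: monomial_sym_def)
qed

lemma monomial_sym_closed:
  assumes l: "l \<in> multipartitions G"
  shows "monomial_sym G l \<in> carrier \<Lambda>"
proof (rule LambdaI)
  show "monomial_sym G l k n \<in> carrier (T n)" for k n
    using Q.word_tensor_closed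
    by (auto simp: monomial_sym_def monomial_poly_eq[OF l] weight_words_def intro!: T.finsum_closed)
  have "{m \<in> multipartitions G. (if m = l then 1 else 0 :: int) \<noteq> 0} \<subseteq> {l}" by auto
  then show "finite {m \<in> multipartitions G. (if m = l then 1 else 0 :: int) \<noteq> 0}"
    by (rule finite_subset) simp
qed (rule word_coord_monomial_sym[OF l])

lemma Lambda_coord_monomial:
  "l \<in> multipartitions G \<Longrightarrow> m \<in> multipartitions G \<Longrightarrow>
    Lambda_coord l (monomial_sym G m) = (if l = m then 1 else 0)"
  by (rule Lambda_coord_unique[OF word_coord_monomial_sym])

sublocale \<Lambda>: ring_basis \<Lambda> "multipartitions G" "monomial_sym G" Lambda_coord
proof unfold_locales
  fix l assume l: "l \<in> multipartitions G"
  show "Lambda_coord l \<in> add_hom \<Lambda> \<Z>"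
    by (rule int_homI) (rule Lambda_coord_unique[OF word_coord_Lambda_add l])
next
  fix f assume f: "f \<in> carrier \<Lambda>" and 0: "\<And>l. l \<in> multipartitions G \<Longrightarrow> Lambda_coord l f = 0"
  have "f k n = \<zero>\<^bsub>T n\<^esub>" for k n
    using word_coord_Lambda[OF f] 0 word_wt_multipartition
    by (intro T.coord_separates Lambda_closed[OF f]) auto
  then show "f = \<zero>\<^bsub>\<Lambda>\<^esub>" by (simp add: Lambda_simps fun_eq_iff)
qed (simp_all add: monomial_sym_closed finite_Lambda_coord Lambda_coord_monomial)

abbreviation word_struct where
  "word_struct n u v w \<equiv> Q.word_coord w (Q.word_tensor u \<otimes>\<^bsub>T n\<^esub> Q.word_tensor v)"

text \<open>
  The coordinate at the word \<open>w\<close> of a product of two tensors is a bilinear form in the coordinates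
  of the factors; degrees add, so only one summand of the Cauchy product contributes to each pair
  of words.
\<close>

lemma Lambda_coord_mult:
  assumes f: "f \<in> carrier \<Lambda>" and g: "g \<in> carrier \<Lambda>" and w: "w \<in> Q.words n" and d: "word_deg w \<le> d"
  shows "Lambda_coord (word_wt w) (f \<otimes>\<^bsub>\<Lambda>\<^esub> g) =
    (\<Sum>u\<in>bounded_words d n. \<Sum>v\<in>bounded_words d n.
      word_struct n u v w * (Lambda_coord (word_wt u) f * Lambda_coord (word_wt v) g))"
proof -
  let ?k = "word_deg w" and ?B = "bounded_words d n"
  have supp: "T.support n (h i n) \<subseteq> ?B" if h: "h \<in> carrier \<Lambda>" and i: "i \<le> ?k" for h i
  proof
    fix u assume "u \<in> T.support n (h i n)"
    then have u: "u \<in> Q.words n" "Q.word_coord u (h i n) \<noteq> 0" by (auto simp: T.support_def)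
    then have "word_deg u = i" using word_coord_Lambda[OF h u(1), of i] by (auto split: if_splits)
    then show "u \<in> ?B" using words_bounded[OF u(1)] i d by simp
  qed
  have inner: "(\<Sum>i\<le>?k. Q.word_coord u (f i n) * Q.word_coord v (g (?k - i) n) * word_struct n u v w)
      = word_struct n u v w * (Lambda_coord (word_wt u) f * Lambda_coord (word_wt v) g)"
    if "u \<in> ?B" "v \<in> ?B" for u v
  proof (cases "word_struct n u v w = 0")
    case False
    have uv: "u \<in> Q.words n" "v \<in> Q.words n" using that bounded_words_subset by blast+
    have deg: "?k = word_deg u + word_deg v" using word_mult_degree[OF uv w False] .
    have "(\<Sum>i\<le>?k. Q.word_coord u (f i n) * Q.word_coord v (g (?k - i) n) * word_struct n u v w)
      = (\<Sum>i\<le>?k. if i = word_deg u then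
          word_struct n u v w * (Lambda_coord (word_wt u) f * Lambda_coord (word_wt v) g) else 0)"
      using deg word_coord_Lambda[OF f uv(1)] word_coord_Lambda[OF g uv(2)]
      by (intro sum.cong) auto
    then show ?thesis using deg by simp
  qed simp
  have "Lambda_coord (word_wt w) (f \<otimes>\<^bsub>\<Lambda>\<^esub> g) = Q.word_coord w ((f \<otimes>\<^bsub>\<Lambda>\<^esub> g) ?k n)"
    using word_coord_Lambda[OF Lambda_mult[OF f g] w] by simp
  also have "\<dots> = (\<Sum>i\<le>?k. Q.word_coord w (f i n \<otimes>\<^bsub>T n\<^esub> g (?k - i) n))"
    unfolding Lambda_simps using Lambda_closed[OF f] Lambda_closed[OF g]
    by (intro T.coord_simps(5)[OF w]) auto
  also have "\<dots> = (\<Sum>i\<le>?k. \<Sum>u\<in>?B. \<Sum>v\<in>?B.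
      Q.word_coord u (f i n) * Q.word_coord v (g (?k - i) n) * word_struct n u v w)"
    using Lambda_closed[OF f] Lambda_closed[OF g] supp[OF f] supp[OF g] w
    by (intro sum.cong T.coord_mult finite_bounded_words bounded_words_subset) auto
  also have "\<dots> = (\<Sum>u\<in>?B. \<Sum>v\<in>?B. \<Sum>i\<le>?k.
      Q.word_coord u (f i n) * Q.word_coord v (g (?k - i) n) * word_struct n u v w)"
    by (subst sum.swap, intro sum.cong refl, subst sum.swap) simp
  also have "\<dots> = (\<Sum>u\<in>?B. \<Sum>v\<in>?B.
      word_struct n u v w * (Lambda_coord (word_wt u) f * Lambda_coord (word_wt v) g))"
    using inner by (intro sum.cong) auto
  finally show ?thesis .
qed

lemma bounded_words_append:
  "(\<Sum>u\<in>bounded_words d (m + n). \<phi> u) = (\<Sum>u\<in>bounded_words d m. \<Sum>v\<in>bounded_words d n. \<phi> (u @ v))"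
proof -
  let ?app = "\<lambda>(u, v). u @ v"
  have "bounded_words d (m + n) = ?app ` (bounded_words d m \<times> bounded_words d n)"
  proof (intro equalityI subsetI)
    fix w assume w: "w \<in> bounded_words d (m + n)"
    then have "take m w \<in> bounded_words d m" "drop m w \<in> bounded_words d n"
      using set_take_subset[of m w] set_drop_subset[of m w] by (auto simp: bounded_words_def)
    then show "w \<in> ?app ` (bounded_words d m \<times> bounded_words d n)"
      by (intro image_eqI[of _ _ "(take m w, drop m w)"]) auto
  qed (auto simp: bounded_words_def)
  moreover have "inj_on ?app (bounded_words d m \<times> bounded_words d n)"
    by (auto simp: inj_on_def bounded_words_def)
  ultimately show ?thesis
    by (simp add: sum.reindex sum.cartesian_product case_prod_unfold)
qed

text \<open>
  Tensors are multiplied letter by letter.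
\<close>

lemma word_struct_append:
  assumes "u \<in> Q.words m" "v \<in> Q.words m" "w \<in> Q.words m" "u' \<in> Q.words n" "v' \<in> Q.words n" "w' \<in> Q.words n"
  shows "word_struct (m + n) (u @ u') (v @ v') (w @ w') = word_struct m u v w * word_struct n u' v' w'"
  using assms Q.words_append[of _ m _ n]
  by (simp add: Q.word_coord_mult) (auto simp: Q.words_def)

lemma sum_image_weighted:
  fixes g :: "'x \<Rightarrow> int"
  assumes "finite X"
  shows "(\<Sum>x\<in>X. g x * \<Phi> (h x)) = (\<Sum>u\<in>h ` X. (\<Sum>x\<in>{x \<in> X. h x = u}. g x) * \<Phi> u)"
  unfolding sum.image_gen[OF assms, of _ h] sum_distrib_right by (intro sum.cong) auto

text \<open>
  Take words \<open>w\<close> and \<open>w'\<close> of weights \<open>i\<close> and \<open>j\<close>; their concatenation has weight \<open>i + j\<close>.  In the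
  formula of \<open>Lambda_coord_mult\<close> for the concatenation, the words of the factors split into two
  parts and the structure constants into a product.  It remains to collect the words with equal
  weights.
\<close>

lemma Lambda_coord_add_mult:
  assumes i: "i \<in> multipartitions G" and j: "j \<in> multipartitions G"
  shows "\<exists>U V c d. finite U \<and> finite V \<and> U \<subseteq> multipartitions G \<times> multipartitions G \<and>
    V \<subseteq> multipartitions G \<times> multipartitions G \<and> (\<forall>a\<in>carrier \<Lambda>. \<forall>b\<in>carrier \<Lambda>.
      Lambda_coord i (a \<otimes>\<^bsub>\<Lambda>\<^esub> b) = (\<Sum>u\<in>U. c u * (Lambda_coord (fst u) a * Lambda_coord (snd u) b)) \<and>
      Lambda_coord j (a \<otimes>\<^bsub>\<Lambda>\<^esub> b) = (\<Sum>v\<in>V. d v * (Lambda_coord (fst v) a * Lambda_coord (snd v) b)) \<and>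
      Lambda_coord (i + j) (a \<otimes>\<^bsub>\<Lambda>\<^esub> b) = (\<Sum>u\<in>U. \<Sum>v\<in>V. c u * d v *
        (Lambda_coord (fst u + fst v) a * Lambda_coord (snd u + snd v) b)))"
proof -
  obtain m n w w' where w: "w \<in> Q.words m" "word_wt w = i" and w': "w' \<in> Q.words n" "word_wt w' = j"
    using rep_word[OF i] rep_word[OF j] by blast
  \<comment> \<open>one bound on the degrees that serves \<open>w\<close>, \<open>w'\<close> and their concatenation\<close>
  define e where "e = word_deg w + word_deg w'"
  define X where "X = bounded_words e m \<times> bounded_words e m"
  define Y where "Y = bounded_words e n \<times> bounded_words e n"
  define h :: "_ \<Rightarrow> ('a set \<Rightarrow> nat multiset) \<times> ('a set \<Rightarrow> nat multiset)"
    where "h x = (word_wt (fst x), word_wt (snd x))" for x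
  define p where "p x = word_struct m (fst x) (snd x) w" for x
  define q where "q y = word_struct n (fst y) (snd y) w'" for y
  define c where "c u = (\<Sum>x\<in>{x \<in> X. h x = u}. p x)" for u
  define d where "d v = (\<Sum>y\<in>{y \<in> Y. h y = v}. q y)" for v
  have fin: "finite X" "finite Y" by (simp_all add: X_def Y_def finite_bounded_words)
  have mem: "h x \<in> multipartitions G \<times> multipartitions G" if "x \<in> X \<or> x \<in> Y" for x
    using that word_wt_multipartition bounded_words_subset unfolding X_def Y_def h_def by (auto; blast)
  have groupX: "(\<Sum>x\<in>X. p x * \<Phi> (h x)) = (\<Sum>u\<in>h ` X. c u * \<Phi> u)" for \<Phi>
    unfolding c_def using fin(1) by (rule sum_image_weighted)
  have groupY: "(\<Sum>y\<in>Y. q y * \<Phi> (h y)) = (\<Sum>v\<in>h ` Y. d v * \<Phi> v)" for \<Phi>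
    unfolding d_def using fin(2) by (rule sum_image_weighted)
  have main: "Lambda_coord i (a \<otimes>\<^bsub>\<Lambda>\<^esub> b) = (\<Sum>u\<in>h ` X. c u * (Lambda_coord (fst u) a * Lambda_coord (snd u) b)) \<and>
      Lambda_coord j (a \<otimes>\<^bsub>\<Lambda>\<^esub> b) = (\<Sum>v\<in>h ` Y. d v * (Lambda_coord (fst v) a * Lambda_coord (snd v) b)) \<and>
      Lambda_coord (i + j) (a \<otimes>\<^bsub>\<Lambda>\<^esub> b) = (\<Sum>u\<in>h ` X. \<Sum>v\<in>h ` Y. c u * d v *
        (Lambda_coord (fst u + fst v) a * Lambda_coord (snd u + snd v) b))"
    if a: "a \<in> carrier \<Lambda>" and b: "b \<in> carrier \<Lambda>" for a b
  proof (intro conjI)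
    show "Lambda_coord i (a \<otimes>\<^bsub>\<Lambda>\<^esub> b) = (\<Sum>u\<in>h ` X. c u * (Lambda_coord (fst u) a * Lambda_coord (snd u) b))"
      unfolding groupX[symmetric] w(2)[symmetric]
      by (subst Lambda_coord_mult[OF a b w(1), of e])
        (simp_all add: e_def X_def sum.cartesian_product p_def h_def case_prod_unfold)
    show "Lambda_coord j (a \<otimes>\<^bsub>\<Lambda>\<^esub> b) = (\<Sum>v\<in>h ` Y. d v * (Lambda_coord (fst v) a * Lambda_coord (snd v) b))"
      unfolding groupY[symmetric] w'(2)[symmetric]
      by (subst Lambda_coord_mult[OF a b w'(1), of e])
        (simp_all add: e_def Y_def sum.cartesian_product q_def h_def case_prod_unfold)
    let ?\<Phi> = "\<lambda>x y. Lambda_coord (fst x + fst y) a * Lambda_coord (snd x + snd y) b"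
    let ?Bm = "bounded_words e m" and ?Bn = "bounded_words e n"
    have "Lambda_coord (i + j) (a \<otimes>\<^bsub>\<Lambda>\<^esub> b) = (\<Sum>u\<in>bounded_words e (m + n). \<Sum>v\<in>bounded_words e (m + n).
        word_struct (m + n) u v (w @ w') * (Lambda_coord (word_wt u) a * Lambda_coord (word_wt v) b))"
      using Lambda_coord_mult[OF a b Q.words_append[OF w(1) w'(1)], of e] w w'
      by (simp add: e_def word_deg_def)
    also have "\<dots> = (\<Sum>u\<in>?Bm. \<Sum>u'\<in>?Bn. \<Sum>v\<in>?Bm. \<Sum>v'\<in>?Bn. p (u, v) * (q (u', v') * ?\<Phi> (h (u, v)) (h (u', v'))))"
      unfolding bounded_words_append
      using bounded_words_subset w w'
      by (intro sum.cong refl) (subst word_struct_append, auto simp: p_def q_def h_def)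
    also have "\<dots> = (\<Sum>u\<in>?Bm. \<Sum>v\<in>?Bm. \<Sum>u'\<in>?Bn. \<Sum>v'\<in>?Bn. p (u, v) * (q (u', v') * ?\<Phi> (h (u, v)) (h (u', v'))))"
      by (intro sum.cong refl sum.swap)
    also have "\<dots> = (\<Sum>x\<in>X. p x * (\<Sum>y\<in>Y. q y * ?\<Phi> (h x) (h y)))"
      by (simp add: X_def Y_def sum.cartesian_product' sum_distrib_left)
    also have "\<dots> = (\<Sum>u\<in>h ` X. c u * (\<Sum>v\<in>h ` Y. d v * ?\<Phi> u v))"
    proof -
      have "(\<Sum>x\<in>X. p x * (\<Sum>y\<in>Y. q y * ?\<Phi> (h x) (h y))) = (\<Sum>x\<in>X. p x * (\<Sum>v\<in>h ` Y. d v * ?\<Phi> (h x) v))"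
        by (intro sum.cong refl arg_cong2[of _ _ _ _ "(*)"] groupY)
      also have "\<dots> = (\<Sum>u\<in>h ` X. c u * (\<Sum>v\<in>h ` Y. d v * ?\<Phi> u v))"
        by (rule groupX)
      finally show ?thesis .
    qed
    also have "\<dots> = (\<Sum>u\<in>h ` X. \<Sum>v\<in>h ` Y. c u * d v * ?\<Phi> u v)"
      by (simp add: sum_distrib_left mult.assoc)
    finally show "Lambda_coord (i + j) (a \<otimes>\<^bsub>\<Lambda>\<^esub> b) = (\<Sum>u\<in>h ` X. \<Sum>v\<in>h ` Y. c u * d v * ?\<Phi> u v)" .
  qed
  show ?thesis
  proof (rule exI[of _ "h ` X"], rule exI[of _ "h ` Y"], rule exI[of _ c], rule exI[of _ d], intro conjI)
    show "finite (h ` X)" "finite (h ` Y)" using fin by simp_all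
    show "h ` X \<subseteq> multipartitions G \<times> multipartitions G" "h ` Y \<subseteq> multipartitions G \<times> multipartitions G"
      using mem by blast+
  qed (intro ballI main)
qed

sublocale \<Lambda>: graded_monoid_basis \<Lambda> "multipartitions G" "monomial_sym G" Lambda_coord "mp_size G"
proof unfold_locales
  fix l assume l: "l \<in> multipartitions G" "mp_size G l = 0"
  then show "l = 0" using word_of_multipartition[OF l(1)] by auto
next
  show "monomial_sym G 0 = \<one>\<^bsub>\<Lambda>\<^esub>"
    using multipartitions_zero
    by (intro \<Lambda>.coord_eqI)
      (auto simp: monomial_sym_closed Lambda_one Lambda_coord_monomial Lambda_coord_unique[OF word_coord_Lambda_one])
next
  fix a b assume a: "a \<in> carrier \<Lambda>" and b: "b \<in> carrier \<Lambda>"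
  have w: "[] \<in> Q.words 0" by (simp add: Q.words_def)
  have "bounded_words 0 0 = {[]}" by (auto simp: bounded_words_def)
  moreover have "word_struct 0 [] [] [] = 1" using Q.word_coord_mult[OF w w w] by simp
  ultimately show "Lambda_coord 0 (a \<otimes>\<^bsub>\<Lambda>\<^esub> b) = Lambda_coord 0 a * Lambda_coord 0 b"
    using Lambda_coord_mult[OF a b w, of 0] by (simp add: word_deg_def)
qed ((rule Lambda_coord_add_mult; assumption) |
    simp add: multipartitions_zero multipartitions_add mp_size_add finite_multipartitions)+

text \<open>
  Parts are positive and vanish away from the conjugacy classes, so comparing the multiplicities of
  positive parts at the classes compares the multipartitions.
\<close>

lemma splits_eq:
  assumes l: "l \<in> multipartitions G"
  shows "{(\<mu>, \<nu>). \<mu> \<in> multipartitions G \<and> \<nu> \<in> multipartitions G \<and>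
      (\<forall>c\<in>conj_classes G. \<forall>i>0. count (\<mu> c) i + count (\<nu> c) i = count (l c) i)} = \<Lambda>.splits l"
proof -
  have "(\<forall>c\<in>conj_classes G. \<forall>i>0. count (\<mu> c) i + count (\<nu> c) i = count (l c) i) \<longleftrightarrow> \<mu> + \<nu> = l"
    if "\<mu> \<in> multipartitions G" "\<nu> \<in> multipartitions G" for \<mu> \<nu>
  proof
    assume *: "\<forall>c\<in>conj_classes G. \<forall>i>0. count (\<mu> c) i + count (\<nu> c) i = count (l c) i"
    show "\<mu> + \<nu> = l"
    proof (intro ext multiset_eqI)
      fix c i
      show "count ((\<mu> + \<nu>) c) i = count (l c) i"
        using * l that by (cases "c \<in> conj_classes G"; cases "i = 0")
          (auto simp: multipartitions_def not_in_iff)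
    qed
  qed auto
  then show ?thesis by (auto simp: \<Lambda>.splits_def)
qed

end

theorem theoremA1:
  fixes \<Gamma> :: "('g, 'b) monoid_scheme"
  assumes "group \<Gamma>"
    and "finite (carrier \<Gamma>)"
  shows "\<exists>\<Delta> \<epsilon> S. hopf_algebra (Lambda \<Gamma>) \<Delta> \<epsilon> S \<and>
    (\<forall>l\<in>multipartitions \<Gamma>.
       \<Delta> (monomial_sym \<Gamma> l) =
         finsum (tensor_power (Lambda \<Gamma>) 2)
           (\<lambda>(\<mu>, \<nu>). pure_tensor (Lambda \<Gamma>) [monomial_sym \<Gamma> \<mu>, monomial_sym \<Gamma> \<nu>])
           {(\<mu>, \<nu>). \<mu> \<in> multipartitions \<Gamma> \<and> \<nu> \<in> multipartitions \<Gamma> \<and>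
              (\<forall>c\<in>conj_classes \<Gamma>. \<forall>i>0. count (\<mu> c) i + count (\<nu> c) i = count (l c) i)}) \<and>
    (\<forall>\<mu>\<in>multipartitions \<Gamma>. mp_size \<Gamma> \<mu> > 0 \<longrightarrow> \<epsilon> (monomial_sym \<Gamma> \<mu>) = 0) \<and>
    \<epsilon> \<one>\<^bsub>Lambda \<Gamma>\<^esub> = 1"
proof -
  interpret finite_group \<Gamma>
    using assms by (intro finite_group.intro finite_group_axioms.intro)
  obtain S where S: "hopf_algebra (Lambda \<Gamma>) \<Lambda>.comult (Lambda_coord 0) S"
    using \<Lambda>.hopf_algebra_exists by blast
  show ?thesis
  proof (intro exI conjI ballI impI)
    show "hopf_algebra (Lambda \<Gamma>) \<Lambda>.comult (Lambda_coord 0) S" by (rule S)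
    show "\<Lambda>.comult (monomial_sym \<Gamma> l) =
         finsum (tensor_power (Lambda \<Gamma>) 2)
           (\<lambda>(\<mu>, \<nu>). pure_tensor (Lambda \<Gamma>) [monomial_sym \<Gamma> \<mu>, monomial_sym \<Gamma> \<nu>])
           {(\<mu>, \<nu>). \<mu> \<in> multipartitions \<Gamma> \<and> \<nu> \<in> multipartitions \<Gamma> \<and>
              (\<forall>c\<in>conj_classes \<Gamma>. \<forall>i>0. count (\<mu> c) i + count (\<nu> c) i = count (l c) i)}"
      if l: "l \<in> multipartitions \<Gamma>" for l
      unfolding \<Lambda>.comult_basis[OF l] \<Lambda>.comult_basis_def splits_eq[OF l]
      by (simp add: \<Lambda>.word_tensor_def case_prod_unfold)
    show "Lambda_coord 0 (monomial_sym \<Gamma> \<mu>) = 0" if "\<mu> \<in> multipartitions \<Gamma>" "mp_size \<Gamma> \<mu> > 0" for \<mu>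
      using that multipartitions_zero by (auto simp: Lambda_coord_monomial mp_size_zero)
    show "Lambda_coord 0 \<one>\<^bsub>Lambda \<Gamma>\<^esub> = 1"
      using Lambda_coord_unique[OF word_coord_Lambda_one multipartitions_zero] by simp
  qed
qed

end
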